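(* Let $F=(F_1,F_2,F_3):\mathbb{P}^n\times\mathbb{P}^m\times\mathbb{P}^s\to\mathbb{P}^n\times\mathbb{P}^m\times\mathbb{P}^s$ be a generic map over $\mathbb{C}$, where $F_1$, $F_2$, $F_3$ have multidegrees $(d_1,d_2,d_3)$, $(e_1,e_2,e_3)$ and $(f_1,f_2,f_3)$ respectively. Then the number of fixed points of $F$ is the coefficient of $\alpha^n\beta^m\gamma^s$ in the following polynomial in $\mathbb{Z}[\alpha,\beta,\gamma]$: $$\sum_{i=0}^n\sum_{j=0}^m\sum_{k=0}^s(d_1\alpha+d_2\beta+d_3\gamma)^{n-i}(e_1\alpha+e_2\beta+e_3\gamma)^{m-j}(f_1\alpha+f_2\beta+f_3\gamma)^{s-k}\alpha^{i}\beta^{j}\gamma^{k}.$$ More generally, for a generic map $F=(F_1,\dots,F_k):\mathbb{P}^{n_1}\times\cdots\times\mathbb{P}^{n_k}\to\mathbb{P}^{n_1}\times\cdots\times\mathbb{P}^{n_k}$ over $\mathbb{C}$ with $F_i$ of multidegree $(d_{i1},\dots,d_{ik})$, the number of fixed points of $F$ is the coefficient of $\alpha_1^{n_1}\cdots\alpha_k^{n_k}$ in $$\sum_{t_1=0}^{n_1}\cdots\sum_{t_k=0}^{n_k}\ \prod_{i=1}^k\left(d_{i1}\alpha_1+\cdots+d_{ik}\alpha_k\right)^{n_i-t_i}\alpha_i^{t_i}\in\mathbb{Z}[\alpha_1,\dots,\alpha_k].$$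
   Context: Projective spaces are complex. A map $F_i:\mathbb{P}^{n_1}\times\cdots\times\mathbb{P}^{n_k}\to\mathbb{P}^{m}$ of multidegree $(d_1,\dots,d_k)$, with $d_j\ge 0$, is given by $m+1$ polynomials, each multihomogeneous of multidegree $(d_1,\dots,d_k)$, i.e. satisfying $P(\lambda_1x^1,\dots,\lambda_kx^k)=\lambda_1^{d_1}\cdots\lambda_k^{d_k}P(x^1,\dots,x^k)$. A map into a product of projective spaces is a tuple of such maps; the components may have different multidegrees. "Generic" means that the property holds for all tuples of coefficients of the defining polynomials in some nonempty Zariski open subset of the space of all coefficients (for the fixed multidegrees). A zeroth power is taken to be $1$ (including $0^0=1$). *)

theory Defs
  imports Complex_Main "HOL-Library.Poly_Mapping" "HOL-Library.FuncSet"
begin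

type_synonym ('v, 'a) mpoly = "('v \<Rightarrow>\<^sub>0 nat) \<Rightarrow>\<^sub>0 'a"

definition mvar :: "'v \<Rightarrow> ('v, 'a::comm_ring_1) mpoly" where
  "mvar v = Poly_Mapping.single (Poly_Mapping.single v 1) 1"

definition mpoly_vars :: "('v, 'a::zero) mpoly \<Rightarrow> 'v set" where
  "mpoly_vars P = (\<Union>\<mu>\<in>Poly_Mapping.keys P. Poly_Mapping.keys \<mu>)"

definition mpoly_eval :: "('v \<Rightarrow> 'a) \<Rightarrow> ('v, 'a::comm_ring_1) mpoly \<Rightarrow> 'a" where
  "mpoly_eval x P = (\<Sum>\<mu>\<in>Poly_Mapping.keys P. Poly_Mapping.lookup P \<mu> *
     (\<Prod>v\<in>Poly_Mapping.keys \<mu>. x v ^ Poly_Mapping.lookup \<mu> v))"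


(* The space of nonzero vectors of dimension n + 1; coordinates are numbered 0, ..., n and a
   vector is extended by zero. *)
definition nonzero_vecs :: "nat \<Rightarrow> (nat \<Rightarrow> complex) set" where
  "nonzero_vecs n = {x. (\<forall>j>n. x j = 0) \<and> (\<exists>j. x j \<noteq> 0)}"

definition proj_rel :: "nat \<Rightarrow> ((nat \<Rightarrow> complex) \<times> (nat \<Rightarrow> complex)) set" where
  "proj_rel n = {(x, y). x \<in> nonzero_vecs n \<and> y \<in> nonzero_vecs n \<and>
     (\<exists>c. c \<noteq> 0 \<and> y = (\<lambda>j. c * x j))}"

definition proj_space :: "nat \<Rightarrow> (nat \<Rightarrow> complex) set set" where
  "proj_space n = nonzero_vecs n // proj_rel n"

(* Factors are numbered 0, ..., k - 1. *)
definition multiproj_space :: "nat \<Rightarrow> (nat \<Rightarrow> nat) \<Rightarrow> (nat \<Rightarrow> (nat \<Rightarrow> complex) set) set" where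
  "multiproj_space k n = (\<Pi>\<^sub>E i\<in>{..<k}. proj_space (n i))"


(* The variable (i, j) is the j-th homogeneous coordinate of the i-th factor. *)
definition multihomogeneous ::
  "nat \<Rightarrow> (nat \<Rightarrow> nat) \<Rightarrow> (nat \<Rightarrow> nat) \<Rightarrow> (nat \<times> nat, complex) mpoly \<Rightarrow> bool" where
  "multihomogeneous k n d P \<longleftrightarrow>
     mpoly_vars P \<subseteq> {(i, j). i < k \<and> j \<le> n i} \<and>
     (\<forall>(c :: nat \<Rightarrow> complex) x.
        mpoly_eval (\<lambda>(i, j). c i * x i j) P =
        (\<Prod>i<k. c i ^ d i) * mpoly_eval (\<lambda>(i, j). x i j) P)"

(* F i l is the l-th of the n i + 1 polynomials defining the i-th component, which has multidegree
   d i.  The entries outside the index range are set to zero, so that this set is exactly the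
   finite-dimensional space of tuples of defining polynomials. *)
definition multiproj_maps ::
  "nat \<Rightarrow> (nat \<Rightarrow> nat) \<Rightarrow> (nat \<Rightarrow> nat \<Rightarrow> nat) \<Rightarrow> (nat \<Rightarrow> nat \<Rightarrow> (nat \<times> nat, complex) mpoly) set" where
  "multiproj_maps k n d = {F.
     (\<forall>i<k. \<forall>l\<le>n i. multihomogeneous k n (d i) (F i l)) \<and>
     (\<forall>i l. \<not> (i < k \<and> l \<le> n i) \<longrightarrow> F i l = 0)}"

definition component_value ::
  "(nat \<Rightarrow> nat \<Rightarrow> (nat \<times> nat, complex) mpoly) \<Rightarrow> nat \<Rightarrow> (nat \<Rightarrow> nat \<Rightarrow> complex) \<Rightarrow> nat \<Rightarrow> complex" where
  "component_value F i x = (\<lambda>l. mpoly_eval (\<lambda>(i, j). x i j) (F i l))"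

(* The map defined by F is in general only a rational map: p is sent to q if, for homogeneous
   coordinates x of p, every component value F i (x) is a vector of homogeneous coordinates of q i.
   Elements of a point q i of a projective space are nonzero vectors, so p has no image where some
   component vanishes identically.  By multihomogeneity the choice of x is irrelevant. *)
definition maps_to ::
  "nat \<Rightarrow> (nat \<Rightarrow> nat) \<Rightarrow> (nat \<Rightarrow> nat \<Rightarrow> (nat \<times> nat, complex) mpoly) \<Rightarrow>
   (nat \<Rightarrow> (nat \<Rightarrow> complex) set) \<Rightarrow> (nat \<Rightarrow> (nat \<Rightarrow> complex) set) \<Rightarrow> bool" where
  "maps_to k n F p q \<longleftrightarrow>
     p \<in> multiproj_space k n \<and> q \<in> multiproj_space k n \<and>
     (\<exists>x. (\<forall>i<k. x i \<in> p i) \<and> (\<forall>i<k. component_value F i x \<in> q i))"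

definition fixed_points ::
  "nat \<Rightarrow> (nat \<Rightarrow> nat) \<Rightarrow> (nat \<Rightarrow> nat \<Rightarrow> (nat \<times> nat, complex) mpoly) \<Rightarrow>
   (nat \<Rightarrow> (nat \<Rightarrow> complex) set) set" where
  "fixed_points k n F = {p. maps_to k n F p p}"


definition map_coeff ::
  "(nat \<Rightarrow> nat \<Rightarrow> (nat \<times> nat, complex) mpoly) \<Rightarrow> nat \<times> nat \<times> (nat \<times> nat \<Rightarrow>\<^sub>0 nat) \<Rightarrow> complex" where
  "map_coeff F = (\<lambda>(i, l, \<mu>). Poly_Mapping.lookup (F i l) \<mu>)"

(* The complement of the common zero locus of a set S of polynomials in the coefficients of F.
   Variables of S belonging to monomials of the wrong multidegree evaluate to 0 on the whole space
   and hence produce no additional open sets. *)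
definition zariski_open_maps ::
  "nat \<Rightarrow> (nat \<Rightarrow> nat) \<Rightarrow> (nat \<Rightarrow> nat \<Rightarrow> nat) \<Rightarrow>
   (nat \<Rightarrow> nat \<Rightarrow> (nat \<times> nat, complex) mpoly) set \<Rightarrow> bool" where
  "zariski_open_maps k n d U \<longleftrightarrow>
     (\<exists>S :: (nat \<times> nat \<times> (nat \<times> nat \<Rightarrow>\<^sub>0 nat), complex) mpoly set.
        U = {F \<in> multiproj_maps k n d. \<exists>g\<in>S. mpoly_eval (map_coeff F) g \<noteq> 0})"

definition for_generic_map ::
  "nat \<Rightarrow> (nat \<Rightarrow> nat) \<Rightarrow> (nat \<Rightarrow> nat \<Rightarrow> nat) \<Rightarrow>
   ((nat \<Rightarrow> nat \<Rightarrow> (nat \<times> nat, complex) mpoly) \<Rightarrow> bool) \<Rightarrow> bool" where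
  "for_generic_map k n d Q \<longleftrightarrow>
     (\<exists>U. zariski_open_maps k n d U \<and> U \<noteq> {} \<and> (\<forall>F\<in>U. Q F))"

(* Finiteness is part of the statement because card is 0 on infinite sets. *)
definition has_num_fixed_points ::
  "nat \<Rightarrow> (nat \<Rightarrow> nat) \<Rightarrow> (nat \<Rightarrow> nat \<Rightarrow> (nat \<times> nat, complex) mpoly) \<Rightarrow> int \<Rightarrow> bool" where
  "has_num_fixed_points k n F N \<longleftrightarrow>
     finite (fixed_points k n F) \<and> int (card (fixed_points k n F)) = N"

end

theory Submission
  imports Defs "Subresultants.Subresultant_Gcd" "HOL-Computational_Algebra.Computational_Algebra"
    "HOL-Computational_Algebra.Field_as_Ring" "Jordan_Normal_Form.Char_Poly" "HOL-Library.Nat_Bijection"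
begin

text \<open>
  The fixed points are the solutions of \<open>F\<^sub>i\<^sub>l x\<^sub>i\<^sub>m = F\<^sub>i\<^sub>m x\<^sub>i\<^sub>l\<close>. They are counted by degeneration:
  the equations \<open>F\<^sub>i\<^sub>l x\<^sub>i\<^sub>m = s\<^bsup>m-l\<^esup> F\<^sub>i\<^sub>m x\<^sub>i\<^sub>l\<close> (\<open>l < m\<close>) are equivalent to those of the map
  \<open>s\<^sup>l F\<^sub>i\<^sub>l\<close> for \<open>s \<noteq> 0\<close>, and for \<open>s = 0\<close> they read \<open>F\<^sub>i\<^sub>l x\<^sub>i\<^sub>m = 0\<close>. If moreover every \<open>F\<^sub>i\<^sub>l\<close> is a
  product of linear forms in general position, the solutions at \<open>s = 0\<close> are found by choosing, for each
  \<open>i\<close>, the largest \<open>t\<^sub>i\<close> with \<open>x\<^sub>i\<^sub>t \<noteq> 0\<close> and one vanishing factor of each \<open>F\<^sub>i\<^sub>l\<close> with \<open>l < t\<^sub>i\<close>; a choice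
  gives a point precisely when it contains \<open>t\<^sub>j\<close> forms in the \<open>j\<close>-th group of variables for every \<open>j\<close>. The
  number \<open>N\<close> of these choices is the coefficient in question.

  Generically the number of solutions is also \<open>N\<close>. The same choices show that, in all large multidegrees,
  the degenerate equations have corank at most \<open>N\<close>, and this persists for generic parameters. Conversely,
  the \<open>N\<close> solutions lift to power series along every line through the degenerate parameters, so the corank
  is exactly \<open>N\<close>, uniformly in the parameters. The functionals annihilating the equations then form an
  \<open>N\<close>-dimensional space on which multiplication by a linear form acts with generically distinct
  eigenvalues, and its eigenvectors are the evaluations at the solutions.
\<close>

section \<open>Evaluation of multivariate polynomials\<close>

text \<open>The obstacle is that the equations at s = 0 are not those of a map, and that solutions
  may collide or appear when parameters move. So the count rests on the corank. That it is at most N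
  is an open condition, witnessed by a determinant that is nonzero at the degenerate parameters.
  That it is at least N is a closed condition, obtained as polynomial identities in the parameters
  that are checked along every line through the degenerate point. All open conditions are
  nonvanishing of polynomials in the parameters; their product also survives a move to some s
  \<noteq> 0, and this s is then scaled away. Three consecutive degrees occur: the eigenvalue
  relation for a functional is an equation one degree below it, and reading off single coordinates
  takes a functional one degree above it. The coordinates x_i0 are distinguished throughout. No leaf
  point has x_i0 = 0, monomials in the x_i0 serve to homogenize, and generically all solutions lie
  in the chart where all x_i0 are nonzero. A solution at which a whole component of F vanishes is
  not a fixed point. For each i, the system enlarged by all F_il = 0 has corank 0, which excludes
  such solutions generically.\<close>

abbreviation lookup where "lookup \<equiv> Poly_Mapping.lookup"
abbreviation keys where "keys \<equiv> Poly_Mapping.keys"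
abbreviation single where "single \<equiv> Poly_Mapping.single"

definition mon_eval :: "('v \<Rightarrow> 'a::comm_semiring_1) \<Rightarrow> ('v \<Rightarrow>\<^sub>0 nat) \<Rightarrow> 'a" where
  "mon_eval x \<mu> = (\<Prod>v\<in>keys \<mu>. x v ^ lookup \<mu> v)"

text \<open>The coefficients are moved along \<iota> so that one notion covers complex values,
  substitution of polynomials, restriction to a line and power series arguments.\<close>

definition hom_eval :: "('a \<Rightarrow> 'b) \<Rightarrow> ('v \<Rightarrow> 'b::comm_ring_1) \<Rightarrow> ('v, 'a::comm_ring_1) mpoly \<Rightarrow> 'b" where
  "hom_eval \<iota> x P = (\<Sum>\<mu>\<in>keys P. \<iota> (lookup P \<mu>) * mon_eval x \<mu>)"

abbreviation cst :: "'a::comm_ring_1 \<Rightarrow> ('v, 'a) mpoly" where "cst c \<equiv> single 0 c"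

lemma mon_eval_superset:
  assumes "finite A" "keys \<mu> \<subseteq> A"
  shows "mon_eval x \<mu> = (\<Prod>v\<in>A. x v ^ lookup \<mu> v)"
  unfolding mon_eval_def using assms
  by (intro prod.mono_neutral_left) (auto simp: in_keys_iff)

lemma mon_eval_0 [simp]: "mon_eval x 0 = 1"
  by (simp add: mon_eval_def)

lemma mon_eval_add: "mon_eval x (\<mu> + \<nu>) = mon_eval x \<mu> * mon_eval x \<nu>"
proof -
  let ?A = "keys \<mu> \<union> keys \<nu>"
  have "keys (\<mu> + \<nu>) \<subseteq> ?A" by (rule Poly_Mapping.keys_add)
  then show ?thesis
    by (simp add: mon_eval_superset[of ?A] lookup_add power_add prod.distrib)
qed

lemma mon_eval_single [simp]: "mon_eval x (single v a) = x v ^ a"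
  by (cases "a = 0") (auto simp: mon_eval_def)

lemma mon_eval_sum: "mon_eval x (\<Sum>i\<in>A. f i) = (\<Prod>i\<in>A. mon_eval x (f i))"
  by (induction A rule: infinite_finite_induct) (auto simp: mon_eval_add)

lemma mpoly_eval_hom_eval: "mpoly_eval x P = hom_eval (\<lambda>c. c) x P"
  by (simp add: mpoly_eval_def hom_eval_def mon_eval_def)

lemma mpoly_sum_single: "P = (\<Sum>\<mu>\<in>keys P. single \<mu> (lookup P \<mu>))"
  by (rule poly_mapping_eqI)
    (auto simp: lookup_sum lookup_single when_def in_keys_iff sum.delta')

context comm_ring_hom
begin

lemma hom_eval_superset:
  assumes "finite A" "keys P \<subseteq> A"
  shows "hom_eval hom x P = (\<Sum>\<mu>\<in>A. hom (lookup P \<mu>) * mon_eval x \<mu>)"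
  unfolding hom_eval_def using assms
  by (intro sum.mono_neutral_left) (auto simp: in_keys_iff)

lemma hom_eval_add: "hom_eval hom x (P + Q) = hom_eval hom x P + hom_eval hom x Q"
proof -
  let ?A = "keys P \<union> keys Q"
  have "keys (P + Q) \<subseteq> ?A" by (rule Poly_Mapping.keys_add)
  then show ?thesis
    by (simp add: hom_eval_superset[of ?A] lookup_add hom_add sum.distrib algebra_simps)
qed

lemma hom_eval_zero: "hom_eval hom x 0 = 0"
  by (simp add: hom_eval_def)

lemma hom_eval_single: "hom_eval hom x (single \<mu> a) = hom a * mon_eval x \<mu>"
  by (cases "a = 0") (auto simp: hom_eval_def)

lemma hom_eval_sum: "hom_eval hom x (\<Sum>i\<in>A. f i) = (\<Sum>i\<in>A. hom_eval hom x (f i))"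
  by (induction A rule: infinite_finite_induct) (auto simp: hom_eval_add hom_eval_zero)

lemma hom_eval_mult: "hom_eval hom x (P * Q) = hom_eval hom x P * hom_eval hom x Q"
proof -
  have "P * Q = (\<Sum>\<mu>\<in>keys P. \<Sum>\<nu>\<in>keys Q. single (\<mu> + \<nu>) (lookup P \<mu> * lookup Q \<nu>))"
    by (subst mpoly_sum_single[of P], subst mpoly_sum_single[of Q])
      (simp add: sum_product mult_single)
  then have "hom_eval hom x (P * Q) = (\<Sum>\<mu>\<in>keys P. \<Sum>\<nu>\<in>keys Q.
      hom (lookup P \<mu> * lookup Q \<nu>) * mon_eval x (\<mu> + \<nu>))"
    by (simp add: hom_eval_sum hom_eval_single)
  also have "\<dots> = hom_eval hom x P * hom_eval hom x Q"
    by (simp add: hom_eval_def sum_product mon_eval_add hom_mult algebra_simps)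
  finally show ?thesis .
qed

lemma hom_eval_one: "hom_eval hom x 1 = 1"
  using hom_eval_single[of x 0 1] by simp

lemma comm_ring_hom_hom_eval: "comm_ring_hom (hom_eval hom x)"
  by unfold_locales (auto simp: hom_eval_add hom_eval_mult hom_eval_zero hom_eval_one)

lemma hom_eval_mvar: "hom_eval hom x (mvar v) = x v"
  by (simp add: mvar_def hom_eval_single)

end

lemma comm_ring_hom_ident: "comm_ring_hom (\<lambda>c :: 'a::comm_ring_1. c)"
  by unfold_locales auto

interpretation mpe: comm_ring_hom "mpoly_eval x" for x :: "'v \<Rightarrow> 'a::comm_ring_1"
proof -
  have eq: "mpoly_eval x = hom_eval (\<lambda>c. c) x" by (rule ext) (rule mpoly_eval_hom_eval)
  show "comm_ring_hom (mpoly_eval x)"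
    unfolding eq by (rule comm_ring_hom.comm_ring_hom_hom_eval[OF comm_ring_hom_ident])
qed

lemma mpoly_eval_single: "mpoly_eval x (single \<mu> a) = a * mon_eval x \<mu>"
  by (simp add: mpoly_eval_hom_eval comm_ring_hom.hom_eval_single[OF comm_ring_hom_ident])

lemma mpoly_eval_cst [simp]: "mpoly_eval x (cst a) = a"
  by (simp add: mpoly_eval_single)

lemma mpoly_eval_mvar [simp]: "mpoly_eval x (mvar v) = x v"
  by (simp add: mvar_def mpoly_eval_single)

lemma mpoly_eval_superset:
  assumes "finite A" "keys P \<subseteq> A"
  shows "mpoly_eval x P = (\<Sum>\<mu>\<in>A. lookup P \<mu> * mon_eval x \<mu>)"
  using comm_ring_hom.hom_eval_superset[OF comm_ring_hom_ident assms, of x]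
  by (simp add: mpoly_eval_hom_eval)

lemma mpoly_eval_alt: "mpoly_eval x P = (\<Sum>\<mu>\<in>keys P. lookup P \<mu> * mon_eval x \<mu>)"
  by (simp add: mpoly_eval_superset)

text \<open>Kronecker substitution: for \<open>B\<close> above all exponents, \<open>v \<mapsto> t ^ (B ^ idx v)\<close> separates monomials.\<close>

lemma digits_unique:
  fixes f g :: "nat \<Rightarrow> nat"
  assumes "\<And>i. i < m \<Longrightarrow> f i < B" "\<And>i. i < m \<Longrightarrow> g i < B"
    and "(\<Sum>i<m. f i * B ^ i) = (\<Sum>i<m. g i * B ^ i)" and "i < m"
  shows "f i = g i"
  using assms
proof (induction m arbitrary: f g i)
  case (Suc m)
  have split: "(\<Sum>i<Suc m. h i * B ^ i) = h 0 + B * (\<Sum>i<m. h (Suc i) * B ^ i)" for h :: "nat \<Rightarrow> nat"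
    by (subst sum.lessThan_Suc_shift) (simp add: sum_distrib_left algebra_simps)
  have eq: "f 0 + B * (\<Sum>i<m. f (Suc i) * B ^ i) = g 0 + B * (\<Sum>i<m. g (Suc i) * B ^ i)"
    using Suc.prems(3) unfolding split .
  have B: "f 0 < B" "g 0 < B" using Suc.prems by auto
  have z: "f 0 = g 0"
    using arg_cong[OF eq, of "\<lambda>z. z mod B"] B by simp
  then have s: "(\<Sum>i<m. f (Suc i) * B ^ i) = (\<Sum>i<m. g (Suc i) * B ^ i)"
    using eq B by auto
  show ?case
  proof (cases i)
    case (Suc j)
    with Suc.prems have "j < m" by simp
    then have "f (Suc j) = g (Suc j)"
      using Suc.IH[of "\<lambda>i. f (Suc i)" "\<lambda>i. g (Suc i)" j] Suc.prems s by auto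
    with Suc show ?thesis by simp
  qed (use z in simp)
qed simp

lemma mpoly_eq_0_if_eval_0:
  fixes P :: "('v, complex) mpoly"
  assumes "\<And>x. mpoly_eval x P = 0"
  shows "P = 0"
proof -
  let ?V = "mpoly_vars P"
  have fin: "finite ?V" by (simp add: mpoly_vars_def)
  obtain idx :: "'v \<Rightarrow> nat" where idx: "bij_betw idx ?V {..<card ?V}"
    using ex_bij_betw_finite_nat[OF fin] by (auto simp: atLeast0LessThan)
  \<comment> \<open>\<open>B\<close> exceeds every exponent, so exponents are digits in base
    \<open>B\<close>; the inserted 0 keeps \<open>Max\<close> meaningful for P = 0.\<close>
  define B where "B = Suc (Max (insert 0 ((\<lambda>(\<mu>, v). lookup \<mu> v) ` (keys P \<times> ?V))))"
  have B: "lookup \<mu> v < B" if "\<mu> \<in> keys P" "v \<in> ?V" for \<mu> v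
  proof -
    have "lookup \<mu> v \<le> Max (insert 0 ((\<lambda>(\<mu>, v). lookup \<mu> v) ` (keys P \<times> ?V)))"
      by (rule Max_ge) (use fin that in auto)
    then show ?thesis by (simp add: B_def)
  qed
  \<comment> \<open>The degree in t to which the substitution sends the monomial \<mu>.\<close>
  define w where "w \<mu> = (\<Sum>v\<in>?V. lookup \<mu> v * B ^ idx v)" for \<mu>
  have kV: "keys \<mu> \<subseteq> ?V" if "\<mu> \<in> keys P" for \<mu> using that by (auto simp: mpoly_vars_def)
  have w_inj: "inj_on w (keys P)"
  proof (rule inj_onI)
    fix \<mu> \<nu> assume in_keys: "\<mu> \<in> keys P" "\<nu> \<in> keys P" and eq: "w \<mu> = w \<nu>"
    define iv where "iv = inv_into ?V idx"
    have iv: "bij_betw iv {..<card ?V} ?V" unfolding iv_def by (rule bij_betw_inv_into[OF idx])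
    have wd: "w \<rho> = (\<Sum>i<card ?V. lookup \<rho> (iv i) * B ^ i)" for \<rho>
    proof -
      have "(\<Sum>i<card ?V. lookup \<rho> (iv i) * B ^ i) = (\<Sum>v\<in>?V. lookup \<rho> (iv (idx v)) * B ^ idx v)"
        by (rule sum.reindex_bij_betw[OF idx, symmetric])
      also have "\<dots> = w \<rho>" unfolding w_def
        by (rule sum.cong) (use idx in \<open>auto simp: iv_def bij_betw_def\<close>)
      finally show ?thesis ..
    qed
    have ivV: "iv i \<in> ?V" if "i < card ?V" for i
      using bij_betwE[OF iv] that by blast
    have "lookup \<mu> (iv i) = lookup \<nu> (iv i)" if "i < card ?V" for i
      by (rule digits_unique[where m = "card ?V" and B = B and f = "\<lambda>i. lookup \<mu> (iv i)" and g = "\<lambda>i. lookup \<nu> (iv i)"])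
        (use B[OF in_keys(1) ivV] B[OF in_keys(2) ivV] that eq wd in auto)
    then have "lookup \<mu> v = lookup \<nu> v" if "v \<in> ?V" for v
    proof -
      from that iv obtain i where "i < card ?V" "v = iv i"
        by (auto simp: bij_betw_def image_iff set_eq_iff)
      then show ?thesis using \<open>\<And>i. i < card ?V \<Longrightarrow> lookup \<mu> (iv i) = lookup \<nu> (iv i)\<close> by simp
    qed
    moreover have "lookup \<mu> v = lookup \<nu> v" if "v \<notin> ?V" for v
      using that kV in_keys by (metis in_keys_iff subsetD)
    ultimately show "\<mu> = \<nu>" by (intro poly_mapping_eqI) blast
  qed
  define q where "q = (\<Sum>\<mu>\<in>keys P. Polynomial.monom (lookup P \<mu>) (w \<mu>))"
  have "poly q t = 0" for t
  proof -
    have "mpoly_eval (\<lambda>v. t ^ (B ^ idx v)) P = poly q t"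
      unfolding mpoly_eval_alt q_def poly_sum poly_monom w_def
      by (intro sum.cong refl arg_cong2[where f = times])
        (simp add: mon_eval_superset[OF fin kV] power_sum power_mult[symmetric] mult.commute)
    with assms show ?thesis by simp
  qed
  then have q0: "q = 0" using poly_all_0_iff_0 by blast
  have "lookup P \<mu> = 0" if "\<mu> \<in> keys P" for \<mu>
  proof -
    have "coeff q (w \<mu>) = (\<Sum>\<nu>\<in>keys P. if \<nu> = \<mu> then lookup P \<nu> else 0)"
      unfolding q_def coeff_sum by (rule sum.cong) (use w_inj that in \<open>auto simp: inj_on_def\<close>)
    also have "\<dots> = lookup P \<mu>" using that by simp
    finally show ?thesis using q0 by simp
  qed
  then show ?thesis by (intro poly_mapping_eqI) (metis in_keys_iff lookup_zero)
qed

section \<open>Linear forms in general position\<close>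

text \<open>Each interval between neighbouring zeros contributes a zero of the derivative. The
  strict bound by \<open>Max T\<close> keeps the zero found in the last interval apart from those
  collected before.\<close>

lemma Rolle_zeros:
  fixes f f' :: "real \<Rightarrow> real"
  assumes "finite T" "T \<noteq> {}" "\<And>t. t \<in> T \<Longrightarrow> 0 < t \<and> f t = 0"
    and der: "\<And>t. (f has_real_derivative f' t) (at t)"
  shows "\<exists>T'. finite T' \<and> card T \<le> Suc (card T') \<and> (\<forall>t\<in>T'. 0 < t \<and> t < Max T \<and> f' t = 0)"
  using assms(1-3)
proof (induction T rule: finite_linorder_max_induct)
  case (insert b A)
  show ?case
  proof (cases "A = {}")
    case False
    from insert False obtain T' where T': "finite T'" "card A \<le> Suc (card T')"
      "\<forall>t\<in>T'. 0 < t \<and> t < Max A \<and> f' t = 0" by auto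
    have MA: "Max A \<in> A" "Max A < b" using insert False by auto
    obtain z where z: "Max A < z" "z < b" "f' z = 0"
    proof -
      have "\<exists>z>Max A. z < b \<and> (f has_real_derivative 0) (at z)"
      proof (rule Rolle)
        show "continuous_on {Max A..b} f"
          using der DERIV_continuous by (intro continuous_at_imp_continuous_on) blast
        show "f differentiable (at x)" for x
          using der real_differentiable_def by blast
      qed (use MA insert in auto)
      with der DERIV_unique that show ?thesis by blast
    qed
    have "Max (insert b A) = b" using insert by (intro Max_eqI) (auto intro: less_imp_le)
    moreover have "z \<notin> T'" using T' z by auto
    moreover have "0 < Max A" using insert MA by auto
    ultimately show ?thesis
      using T' z insert by (intro exI[of _ "insert z T'"]) (auto simp: card_insert_if)
  qed (auto intro: exI[of _ "{}"])
qed simp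

text \<open>This is what Descartes' rule of signs says about the number of positive zeros.\<close>

lemma sparse_poly_positive_zeros:
  fixes c :: "nat \<Rightarrow> real"
  assumes "finite S" "finite T" "card S \<le> card T"
    and "\<And>t. t \<in> T \<Longrightarrow> 0 < t \<and> (\<Sum>l\<in>S. c l * t ^ l) = 0" and "l \<in> S"
  shows "c l = 0"
  using assms
proof (induction "card S" arbitrary: S T c l)
  case (Suc m)
  \<comment> \<open>Divided by t^a, the term of least exponent becomes constant, so the derivative
    has one term fewer, while at most one zero is lost.\<close>
  define a where "a = Min S"
  have ne: "S \<noteq> {}" using Suc by auto
  have aS: "a \<in> S" and amin: "\<And>l. l \<in> S \<Longrightarrow> a \<le> l"
    using Suc ne by (auto simp: a_def)
  define f where "f t = (\<Sum>l\<in>S. c l * t ^ (l - a))" for t :: real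
  define f' where "f' t = (\<Sum>l\<in>S. c l * (real (l - a) * t ^ (l - a - Suc 0)))" for t :: real
  have fa: "(\<Sum>l\<in>S. c l * t ^ l) = t ^ a * f t" for t
    unfolding f_def sum_distrib_left
    by (intro sum.cong refl) (use amin in \<open>simp add: power_add[symmetric]\<close>)
  have Tne: "T \<noteq> {}" using Suc by auto
  have fT: "0 < t \<and> f t = 0" if "t \<in> T" for t using Suc.prems(4)[OF that] fa[of t] by auto
  have der: "(f has_real_derivative f' t) (at t)" for t
    unfolding f_def f'_def
    by (intro DERIV_sum DERIV_cmult DERIV_pow)
  then obtain T' where T': "finite T'" "card T \<le> Suc (card T')" "\<forall>t\<in>T'. 0 < t \<and> f' t = 0"
    using Rolle_zeros[where f = f and f' = f', OF Suc.prems(2) Tne fT der] by blast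
  \<comment> \<open>Multiplying the derivative by t^(a+1) restores the original exponents, now
    without \<open>a\<close>; positive zeros are unaffected.\<close>
  have f'a: "(\<Sum>l\<in>S - {a}. (c l * real (l - a)) * t ^ l) = t ^ Suc a * f' t" for t
  proof -
    have "t ^ Suc a * f' t = (\<Sum>l\<in>S. (c l * real (l - a)) * t ^ l)"
      unfolding f'_def sum_distrib_left
    proof (intro sum.cong refl)
      fix l assume l: "l \<in> S"
      show "t ^ Suc a * (c l * (real (l - a) * t ^ (l - a - Suc 0))) = c l * real (l - a) * t ^ l"
      proof (cases "l = a")
        case False
        with amin[OF l] have "l = Suc a + (l - a - 1)" by simp
        then have "t ^ l = t ^ Suc a * t ^ (l - a - 1)" by (metis power_add)
        then show ?thesis by simp
      qed simp
    qed
    also have "\<dots> = (\<Sum>l\<in>S - {a}. (c l * real (l - a)) * t ^ l)"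
      by (rule sum.mono_neutral_right) (use Suc in auto)
    finally show ?thesis ..
  qed
  have "c l' * real (l' - a) = 0" if "l' \<in> S - {a}" for l'
  proof (rule Suc.hyps(1)[of "S - {a}" T' "\<lambda>l. c l * real (l - a)"])
    show "m = card (S - {a})" using Suc aS by simp
    show "card (S - {a}) \<le> card T'" using Suc aS T' by simp
    show "0 < t \<and> (\<Sum>l\<in>S - {a}. c l * real (l - a) * t ^ l) = 0" if "t \<in> T'" for t
      using T' that f'a by simp
  qed (use Suc T' that in auto)
  then have c0: "c l' = 0" if "l' \<in> S - {a}" for l'
    using that amin by (metis Diff_iff diff_is_0_eq insertCI le_antisym mult_eq_0_iff of_nat_eq_0_iff)
  obtain t where t: "t \<in> T" using Tne by blast
  have "(\<Sum>l\<in>S. c l * t ^ l) = c a * t ^ a"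
    using Suc.prems(1) aS c0 by (subst sum.remove[of _ a]) auto
  with Suc.prems(4)[OF t] have "c a = 0" by auto
  with c0 Suc.prems(5) show ?case by blast
qed auto

text \<open>A label stands for a linear form on \<open>\<complex>\<^bsup>n+1\<^esup>\<close>: \<open>Inl l\<close> for the coordinate \<open>l\<close>,
  \<open>Inr \<tau>\<close> for evaluation of the polynomial with the given coefficients at \<open>\<tau>\<close>.\<close>

type_synonym label = "nat + nat"

fun label_vec :: "label \<Rightarrow> nat \<Rightarrow> complex" where
  "label_vec (Inl l) i = (if i = l then 1 else 0)"
| "label_vec (Inr \<tau>) i = of_nat \<tau> ^ i"

definition labels :: "nat \<Rightarrow> label set" where
  "labels n = Inl ` {..n} \<union> Inr ` {0<..}"

text \<open>Coordinate labels remove entries of \<open>u\<close>; the evaluation labels say that the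
  remaining sparse polynomial has at least as many positive zeros as coefficients. The nodes are
  real, so real and imaginary parts can be treated separately by the sign rule.\<close>

lemma labels_general_position:
  assumes Z: "Z \<subseteq> labels n" "finite Z" "n < card Z"
    and zero: "\<And>a. a \<in> Z \<Longrightarrow> (\<Sum>l\<le>n. label_vec a l * u l) = 0" and "l \<le> n"
  shows "u l = 0"
proof -
  define L where "L = {l. Inl l \<in> Z}"
  define T where "T = {\<tau>. Inr \<tau> \<in> Z}"
  have Zeq: "Z = Inl ` L \<union> Inr ` T"
    using Z(1) by (auto simp: L_def T_def labels_def)
  have LT: "finite L" "finite T"
    using Z(2) unfolding Zeq by (auto simp: finite_image_iff)
  have L: "L \<subseteq> {..n}" and T: "\<And>\<tau>. \<tau> \<in> T \<Longrightarrow> 0 < \<tau>"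
    using Z(1) by (auto simp: L_def T_def labels_def)
  have "card Z = card L + card T"
    unfolding Zeq using LT by (subst card_Un_disjoint) (auto simp: card_image)
  then have card: "card ({..n} - L) \<le> card (real ` T)"
    using Z(3) L LT by (subst card_Diff_subset) (auto simp: card_image)
  have uL: "u l = 0" if "l \<in> L" for l
  proof -
    have "(\<Sum>i\<le>n. label_vec (Inl l) i * u i) = (\<Sum>i\<le>n. if i = l then u i else 0)"
      by (intro sum.cong) auto
    moreover have "l \<le> n" using that L by auto
    ultimately show ?thesis using zero[of "Inl l"] that by (simp add: L_def)
  qed
  have uT: "(\<Sum>i\<in>{..n} - L. u i * of_nat \<tau> ^ i) = 0" if "\<tau> \<in> T" for \<tau>
  proof -
    have "(\<Sum>i\<in>{..n} - L. u i * of_nat \<tau> ^ i) = (\<Sum>i\<le>n. label_vec (Inr \<tau>) i * u i)"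
      by (rule sum.mono_neutral_cong_left) (auto simp: uL)
    with zero[of "Inr \<tau>"] that show ?thesis by (simp add: T_def)
  qed
  show ?thesis
  proof (cases "l \<in> L")
    case False
    then have l: "l \<in> {..n} - L" using \<open>l \<le> n\<close> by simp
    have "Re (u l) = 0"
    proof (rule sparse_poly_positive_zeros[OF _ _ card _ l])
      fix t assume "t \<in> real ` T"
      then obtain \<tau> where t: "\<tau> \<in> T" "t = real \<tau>" by blast
      have "Re (u i) * t ^ i = Re (u i * of_nat \<tau> ^ i)" for i
        by (simp add: t flip: of_nat_power)
      then have "(\<Sum>i\<in>{..n} - L. Re (u i) * t ^ i) = Re (\<Sum>i\<in>{..n} - L. u i * of_nat \<tau> ^ i)"
        unfolding Re_sum by (intro sum.cong refl)
      with uT t T show "0 < t \<and> (\<Sum>i\<in>{..n} - L. Re (u i) * t ^ i) = 0" by simp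
    qed (use LT in auto)
    moreover have "Im (u l) = 0"
    proof (rule sparse_poly_positive_zeros[OF _ _ card _ l])
      fix t assume "t \<in> real ` T"
      then obtain \<tau> where t: "\<tau> \<in> T" "t = real \<tau>" by blast
      have "Im (u i) * t ^ i = Im (u i * of_nat \<tau> ^ i)" for i
        by (simp add: t flip: of_nat_power)
      then have "(\<Sum>i\<in>{..n} - L. Im (u i) * t ^ i) = Im (\<Sum>i\<in>{..n} - L. u i * of_nat \<tau> ^ i)"
        unfolding Im_sum by (intro sum.cong refl)
      with uT t T show "0 < t \<and> (\<Sum>i\<in>{..n} - L. Im (u i) * t ^ i) = 0" by simp
    qed (use LT in auto)
    ultimately show ?thesis by (simp add: complex_eq_iff)
  qed (rule uL)
qed

text \<open>General position makes the square matrix of the labels injective; the columns of its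
  inverse are the dual basis.\<close>

lemma labels_dual_basis:
  assumes Z: "Z \<subseteq> labels n" "finite Z" "card Z = Suc n"
  obtains M where "\<And>a b. a \<in> Z \<Longrightarrow> b \<in> Z \<Longrightarrow>
    (\<Sum>l\<le>n. label_vec a l * M b l) = (if a = b then 1 else 0)"
proof -
  obtain e where e: "bij_betw e {..<Suc n} Z"
    using ex_bij_betw_nat_finite[OF Z(2)] Z(3) by (auto simp: atLeast0LessThan)
  define A where "A = mat (Suc n) (Suc n) (\<lambda>(i, l). label_vec (e i) l)"
  have A: "A \<in> carrier_mat (Suc n) (Suc n)" by (simp add: A_def)
  have ix: "(A * C) $$ (i, j) = (\<Sum>l\<le>n. label_vec (e i) l * C $$ (l, j))"
    if "i \<le> n" "j \<le> n" "C \<in> carrier_mat (Suc n) (Suc n)" for C i j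
    using that A unfolding A_def
    by (auto simp: scalar_prod_def atLeast0LessThan lessThan_Suc_atMost intro!: sum.cong)
  have "det A \<noteq> 0"
  proof
    assume "det A = 0"
    then obtain v where v: "v \<in> carrier_vec (Suc n)" "v \<noteq> 0\<^sub>v (Suc n)" "A *\<^sub>v v = 0\<^sub>v (Suc n)"
      using det_0_iff_vec_prod_zero[OF A] by blast
    have zero: "(\<Sum>l\<le>n. label_vec a l * v $ l) = 0" if "a \<in> Z" for a
    proof -
      from that e obtain i where i: "i < Suc n" "a = e i" by (auto simp: bij_betw_def)
      have "(A *\<^sub>v v) $ i = (\<Sum>l\<le>n. label_vec a l * v $ l)"
        using i v(1) unfolding A_def
        by (auto simp: scalar_prod_def atLeast0LessThan lessThan_Suc_atMost intro!: sum.cong)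
      with v i show ?thesis by simp
    qed
    have "v $ l = 0" if "l \<le> n" for l
      by (rule labels_general_position[where u = "\<lambda>l. v $ l", OF Z(1,2) _ zero that]) (use Z in auto)
    then have "v = 0\<^sub>v (Suc n)" using v(1) by (intro eq_vecI) auto
    with v show False by simp
  qed
  moreover define C where "C = inverse (det A) \<cdot>\<^sub>m adj_mat A"
  ultimately have C: "C \<in> carrier_mat (Suc n) (Suc n)" "A * C = 1\<^sub>m (Suc n)"
    using adj_mat[OF A] A by (auto simp: mult_smult_distrib[OF A])
  define M where "M b l = C $$ (l, inv_into {..<Suc n} e b)" for b l
  show ?thesis
  proof (rule that)
    fix a b assume "a \<in> Z" "b \<in> Z"
    then obtain i j where ij: "i < Suc n" "j < Suc n" "a = e i" "b = e j"
      using e by (auto simp: bij_betw_def)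
    have "inv_into {..<Suc n} e b = j"
      using ij e by (auto simp: bij_betw_def intro: inv_into_f_f)
    then have "(\<Sum>l\<le>n. label_vec a l * M b l) = (A * C) $$ (i, j)"
      using ix[OF _ _ C(1)] ij by (simp add: M_def)
    also have "\<dots> = (if a = b then 1 else 0)"
      using ij e by (auto simp: C bij_betw_def inj_on_def)
    finally show "(\<Sum>l\<le>n. label_vec a l * M b l) = (if a = b then 1 else 0)" .
  qed
qed

section \<open>Multigraded systems and their coranks\<close>

text \<open>Functionals take the place of quotient spaces: those annihilating a system in degree D
  are dual to the forms of degree D modulo the multiples of the system.\<close>

definition clin :: "(('v, complex) mpoly \<Rightarrow> complex) \<Rightarrow> bool" where
  "clin \<phi> \<longleftrightarrow> (\<forall>P Q. \<phi> (P + Q) = \<phi> P + \<phi> Q) \<and> (\<forall>c P. \<phi> (cst c * P) = c * \<phi> P)"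

lemma clinD:
  assumes "clin \<phi>"
  shows clin_add: "\<phi> (P + Q) = \<phi> P + \<phi> Q" and clin_scale: "\<phi> (cst c * P) = c * \<phi> P"
    and clin_zero: "\<phi> 0 = 0"
proof -
  show "\<phi> (P + Q) = \<phi> P + \<phi> Q" "\<phi> (cst c * P) = c * \<phi> P" using assms by (auto simp: clin_def)
  have "\<phi> (cst 0 * 0) = 0 * \<phi> 0" using assms unfolding clin_def by blast
  then show "\<phi> 0 = 0" by simp
qed

lemma clin_sum: "clin \<phi> \<Longrightarrow> \<phi> (\<Sum>i\<in>A. f i) = (\<Sum>i\<in>A. \<phi> (f i))"
  by (induction A rule: infinite_finite_induct) (auto simp: clin_add clin_zero)

lemma clin_expand:
  assumes "clin \<phi>"
  shows "\<phi> P = (\<Sum>\<mu>\<in>keys P. lookup P \<mu> * \<phi> (single \<mu> 1))"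
proof -
  have s: "\<phi> (single \<mu> c) = c * \<phi> (single \<mu> 1)" for \<mu> c
    using clin_scale[OF assms, of c "single \<mu> 1"] by (simp add: mult_single)
  have "\<phi> P = \<phi> (\<Sum>\<mu>\<in>keys P. single \<mu> (lookup P \<mu>))"
    by (rule arg_cong[OF mpoly_sum_single])
  also have "\<dots> = (\<Sum>\<mu>\<in>keys P. lookup P \<mu> * \<phi> (single \<mu> 1))"
    unfolding clin_sum[OF assms] by (intro sum.cong refl s)
  finally show ?thesis .
qed

lemma clin_mult_left: "clin \<phi> \<Longrightarrow> clin (\<lambda>P. \<phi> (G * P))"
  by (simp add: clin_def distrib_left mult.left_commute[of G])

lemma clin_mpoly_eval: "clin (mpoly_eval x)"
  by (auto simp: clin_def mpe.hom_add mpe.hom_mult)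

section \<open>Multidegrees, monomials and forms\<close>

locale multigrading =
  fixes k :: nat and n :: "nat \<Rightarrow> nat"
begin

definition vars :: "(nat \<times> nat) set" where
  "vars = {(i, j). i < k \<and> j \<le> n i}"

definition mdeg :: "(nat \<times> nat \<Rightarrow>\<^sub>0 nat) \<Rightarrow> nat \<Rightarrow> nat" where
  "mdeg \<mu> i = (\<Sum>j\<le>n i. lookup \<mu> (i, j))"

definition Mon :: "(nat \<Rightarrow> nat) \<Rightarrow> (nat \<times> nat \<Rightarrow>\<^sub>0 nat) set" where
  "Mon D = {\<mu>. keys \<mu> \<subseteq> vars \<and> (\<forall>i<k. mdeg \<mu> i = D i)}"

definition Forms :: "(nat \<Rightarrow> nat) \<Rightarrow> (nat \<times> nat, 'a::comm_ring_1) mpoly set" where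
  "Forms D = {P. keys P \<subseteq> Mon D}"

lemma finite_vars: "finite vars"
proof -
  have "vars = (SIGMA i:{..<k}. {..n i})" by (auto simp: vars_def)
  then show ?thesis by simp
qed

lemma mdeg_add: "mdeg (\<mu> + \<nu>) i = mdeg \<mu> i + mdeg \<nu> i"
  by (simp add: mdeg_def lookup_add sum.distrib)

lemma mdeg_single: "mdeg (single (i, l) a) j = (if i = j \<and> l \<le> n i then a else 0)"
proof -
  have "mdeg (single (i, l) a) j = (\<Sum>j'\<le>n j. if j' = l then (if i = j then a else 0) else 0)"
    unfolding mdeg_def by (intro sum.cong) (auto simp: lookup_single when_def)
  then show ?thesis by auto
qed

lemma mdeg_0 [simp]: "mdeg 0 i = 0"
  by (simp add: mdeg_def)

lemma mdeg_sum: "mdeg (\<Sum>i\<in>A. f i) j = (\<Sum>i\<in>A. mdeg (f i) j)"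
  by (induction A rule: infinite_finite_induct) (auto simp: mdeg_add)

lemma finite_Mon: "finite (Mon D)"
proof -
  define b where "b = (\<Sum>i<k. D i)"
  have "lookup \<mu> v \<le> b" if "\<mu> \<in> Mon D" "v \<in> vars" for \<mu> v
  proof -
    obtain i j where ij: "v = (i, j)" by (cases v)
    with that have v: "v = (i, j)" "i < k" "j \<le> n i" by (auto simp: vars_def)
    have "lookup \<mu> v \<le> mdeg \<mu> i" unfolding mdeg_def v(1) by (rule member_le_sum) (use v in auto)
    also have "\<dots> = D i" using that v by (auto simp: Mon_def)
    also have "\<dots> \<le> b" unfolding b_def by (rule member_le_sum) (use v in auto)
    finally show ?thesis .
  qed
  then have "lookup ` Mon D \<subseteq> {f. \<forall>v. (v \<in> vars \<longrightarrow> f v \<in> {..b}) \<and> (v \<notin> vars \<longrightarrow> f v = 0)}"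
    by (auto simp: Mon_def in_keys_iff)
  then have "finite (lookup ` Mon D)"
    by (rule finite_subset) (intro finite_set_of_finite_funs finite_vars finite_atMost)
  then show ?thesis
    by (rule finite_imageD) (auto intro!: inj_onI poly_mapping_eqI)
qed

lemma Mon_cong: "(\<And>i. i < k \<Longrightarrow> D i = D' i) \<Longrightarrow> Mon D = Mon D'"
  by (auto simp: Mon_def)

lemma Forms_cong: "(\<And>i. i < k \<Longrightarrow> D i = D' i) \<Longrightarrow> Forms D = Forms D'"
  using Mon_cong[of D D'] by (simp add: Forms_def)

lemma Mon_add: "\<mu> \<in> Mon D \<Longrightarrow> \<nu> \<in> Mon D' \<Longrightarrow> \<mu> + \<nu> \<in> Mon (\<lambda>i. D i + D' i)"
  using Poly_Mapping.keys_add[of \<mu> \<nu>] by (auto simp: Mon_def mdeg_add)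

lemma Forms_mult: "P \<in> Forms D \<Longrightarrow> Q \<in> Forms D' \<Longrightarrow> P * Q \<in> Forms (\<lambda>i. D i + D' i)"
  using keys_mult[of P Q] by (force simp: Forms_def intro: Mon_add)

lemma Forms_add: "P \<in> Forms D \<Longrightarrow> Q \<in> Forms D \<Longrightarrow> P + Q \<in> Forms D"
  using Poly_Mapping.keys_add[of P Q] by (auto simp: Forms_def)

lemma Forms_0 [simp]: "0 \<in> Forms D"
  by (simp add: Forms_def)

lemma Forms_diff: "P \<in> Forms D \<Longrightarrow> Q \<in> Forms D \<Longrightarrow> P - Q \<in> Forms D"
  using keys_diff[of P Q] by (auto simp: Forms_def)

lemma Forms_sum: "(\<And>i. i \<in> A \<Longrightarrow> f i \<in> Forms D) \<Longrightarrow> (\<Sum>i\<in>A. f i) \<in> Forms D"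
  by (induction A rule: infinite_finite_induct) (auto intro: Forms_add)

lemma Forms_cst: "P \<in> Forms D \<Longrightarrow> cst c * P \<in> Forms D"
  using keys_mult[of "cst c" P] by (cases "c = 0") (auto simp: Forms_def)

lemma Forms_single: "\<mu> \<in> Mon D \<Longrightarrow> single \<mu> a \<in> Forms D"
  by (simp add: Forms_def)

lemma Forms_1: "(1 :: (nat \<times> nat, 'a::comm_ring_1) mpoly) \<in> Forms (\<lambda>_. 0)"
  by (simp add: Forms_def Mon_def)

abbreviation udeg :: "nat \<Rightarrow> nat \<Rightarrow> nat" where
  "udeg i \<equiv> (\<lambda>j. if j = i then 1 else 0)"

lemma Mon_var: "(i, l) \<in> vars \<Longrightarrow> single (i, l) 1 \<in> Mon (udeg i)"
  by (auto simp: Mon_def vars_def mdeg_single)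

lemma Forms_mvar: "(i, l) \<in> vars \<Longrightarrow> mvar (i, l) \<in> Forms (udeg i)"
  unfolding mvar_def by (intro Forms_single Mon_var)

lemma Forms_prod:
  "finite A \<Longrightarrow> (\<And>a. a \<in> A \<Longrightarrow> f a \<in> Forms (D a)) \<Longrightarrow> (\<Prod>a\<in>A. f a) \<in> Forms (\<lambda>i. \<Sum>a\<in>A. D a i)"
  by (induction A rule: finite_induct) (auto simp: Forms_1 intro: Forms_mult)

text \<open>The homogenizing monomial. It takes the value 1 wherever all coordinates (i, 0) are 1,
  so it disappears from evaluations at normalized points.\<close>

definition x0m :: "(nat \<Rightarrow> nat) \<Rightarrow> (nat \<times> nat \<Rightarrow>\<^sub>0 nat)" where
  "x0m D = (\<Sum>i<k. single (i, 0) (D i))"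

definition x0 :: "(nat \<Rightarrow> nat) \<Rightarrow> (nat \<times> nat, 'a::comm_ring_1) mpoly" where
  "x0 D = single (x0m D) 1"

lemma lookup_x0m: "lookup (x0m D) (i, l) = (if i < k \<and> l = 0 then D i else 0)"
proof -
  have "lookup (x0m D) (i, l) = (\<Sum>i'<k. if i' = i then (if l = 0 then D i else 0) else 0)"
    unfolding x0m_def lookup_sum by (intro sum.cong) (auto simp: lookup_single when_def)
  then show ?thesis by auto
qed

lemma x0m_in_Mon: "x0m D \<in> Mon D"
  by (auto simp: Mon_def vars_def mdeg_def lookup_x0m in_keys_iff sum.delta' split: if_splits)

lemma x0_in_Forms: "x0 D \<in> Forms D"
  unfolding x0_def by (intro Forms_single x0m_in_Mon)

lemma x0_add: "x0 (\<lambda>i. D i + D' i) = x0 D * x0 D'"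
  by (simp add: x0_def x0m_def mult_single single_add sum.distrib)

lemma x0_cong: "(\<And>i. i < k \<Longrightarrow> D i = D' i) \<Longrightarrow> x0 D = x0 D'"
  by (simp add: x0_def x0m_def)

lemma mon_eval_x0m: "mon_eval x (x0m D) = (\<Prod>i<k. x (i, 0) ^ D i)"
  by (simp add: x0m_def mon_eval_sum)

text \<open>A graded system is a set of pairs of a multidegree and a form.\<close>

definition annihilates ::
  "((nat \<times> nat, complex) mpoly \<Rightarrow> complex) \<Rightarrow> ((nat \<Rightarrow> nat) \<times> (nat \<times> nat, complex) mpoly) set \<Rightarrow> (nat \<Rightarrow> nat) \<Rightarrow> bool" where
  "annihilates \<phi> S D \<longleftrightarrow>
    (\<forall>(g, E)\<in>S. \<forall>D' P. (\<forall>i<k. g i + D' i = D i) \<longrightarrow> P \<in> Forms D' \<longrightarrow> \<phi> (E * P) = 0)"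

text \<open>In all large degrees \<open>D\<close>, the forms of degree \<open>D\<close> are spanned by the multiples of \<open>S\<close> together with \<open>B\<close>,
  homogenized to degree \<open>D\<close> by a monomial in the variables \<open>(i, 0)\<close>. The bound \<open>\<Gamma>\<close> has to dominate the
  degrees of \<open>B\<close> for this reading, as the subtraction is truncated.\<close>

definition spanned ::
  "((nat \<Rightarrow> nat) \<times> (nat \<times> nat, complex) mpoly) set \<Rightarrow> ((nat \<Rightarrow> nat) \<times> (nat \<times> nat, complex) mpoly) list \<Rightarrow> nat \<Rightarrow> bool" where
  "spanned S B \<Gamma> \<longleftrightarrow> (\<forall>D. (\<forall>i<k. \<Gamma> \<le> D i) \<longrightarrow> (\<forall>\<phi>. clin \<phi> \<longrightarrow> annihilates \<phi> S D \<longrightarrow>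
     (\<forall>(\<gamma>, b)\<in>set B. \<phi> (b * x0 (\<lambda>i. D i - \<gamma> i)) = 0) \<longrightarrow> (\<forall>P\<in>Forms D. \<phi> P = 0)))"

text \<open>One list \<open>B\<close> serves all large degrees at once. This compatibility lets the
  same spanning forms, multiplied by powers of the x_i0, be used in three consecutive degrees later
  on.\<close>

definition corank_le :: "((nat \<Rightarrow> nat) \<times> (nat \<times> nat, complex) mpoly) set \<Rightarrow> nat \<Rightarrow> bool" where
  "corank_le S N \<longleftrightarrow> (\<exists>B \<Gamma>. length B = N \<and> (\<forall>(\<gamma>, b)\<in>set B. b \<in> Forms \<gamma>) \<and> spanned S B \<Gamma>)"

lemma annihilatesD:
  assumes "annihilates \<phi> S D" "(g, E) \<in> S" "\<And>i. i < k \<Longrightarrow> g i + D' i = D i" "P \<in> Forms D'"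
  shows "\<phi> (E * P) = 0"
  using bspec[OF assms(1)[unfolded annihilates_def] assms(2)] assms(3,4) by auto

lemma annihilates_mono: "annihilates \<phi> S' D \<Longrightarrow> S \<subseteq> S' \<Longrightarrow> annihilates \<phi> S D"
  unfolding annihilates_def by blast

lemma spannedD:
  assumes "spanned S B \<Gamma>" "\<And>i. i < k \<Longrightarrow> \<Gamma> \<le> D i" "clin \<phi>" "annihilates \<phi> S D"
    "\<And>\<gamma> b. (\<gamma>, b) \<in> set B \<Longrightarrow> \<phi> (b * x0 (\<lambda>i. D i - \<gamma> i)) = 0" "P \<in> Forms D"
  shows "\<phi> P = 0"
proof -
  have "\<forall>P\<in>Forms D. \<phi> P = 0"
    by (rule assms(1)[unfolded spanned_def, THEN spec, THEN mp, THEN spec, THEN mp, THEN mp, THEN mp])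
      (use assms in auto)
  with assms(6) show ?thesis by blast
qed

lemma spanned_mono:
  assumes "spanned S B \<Gamma>" "S \<subseteq> S'"
  shows "spanned S' B \<Gamma>"
  unfolding spanned_def
proof (intro allI impI ballI)
  fix D \<phi> and P :: "(nat \<times> nat, complex) mpoly"
  assume D: "\<forall>i<k. \<Gamma> \<le> D i" and \<phi>: "clin \<phi>" and ann: "annihilates \<phi> S' D" and P: "P \<in> Forms D"
    and B: "\<forall>(\<gamma>, b)\<in>set B. \<phi> (b * x0 (\<lambda>i. D i - \<gamma> i)) = 0"
  show "\<phi> P = 0"
    by (rule spannedD[OF assms(1) _ \<phi> annihilates_mono[OF ann assms(2)] _ P]) (use D B in auto)
qed

lemma corank_le_mono:
  assumes "corank_le S N" "S \<subseteq> S'"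
  shows "corank_le S' N"
proof -
  obtain B \<Gamma> where B: "length B = N" "\<forall>(\<gamma>, b)\<in>set B. b \<in> Forms \<gamma>" "spanned S B \<Gamma>"
    using assms(1) by (auto simp: corank_le_def)
  show ?thesis
    unfolding corank_le_def
    by (intro exI[of _ B] exI[of _ \<Gamma>] conjI B(1,2) spanned_mono[OF B(3) assms(2)])
qed

text \<open>A functional killing \<open>J\<close> and \<open>G K\<close> at degree \<open>D\<close> gives, after multiplication by \<open>G\<close>,
  a functional killing \<open>J\<close> and \<open>K\<close>; if that vanishes, the original one kills \<open>J\<close> and \<open>G\<close>.\<close>

lemma corank_le_product:
  assumes G: "G \<in> Forms g"
    and 1: "corank_le (insert (g, G) J) N1" and 2: "corank_le (J \<union> K) N2"
    and S: "S = J \<union> (\<lambda>(h, E). (\<lambda>i. g i + h i, G * E)) ` K"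
  shows "corank_le S (N1 + N2)"
proof -
  obtain B1 \<Gamma>1 where B1: "length B1 = N1" "\<forall>(\<gamma>, b)\<in>set B1. b \<in> Forms \<gamma>" "spanned (insert (g, G) J) B1 \<Gamma>1"
    using 1 by (auto simp: corank_le_def)
  obtain B2 \<Gamma>2 where B2: "length B2 = N2" "\<forall>(\<gamma>, b)\<in>set B2. b \<in> Forms \<gamma>" "spanned (J \<union> K) B2 \<Gamma>2"
    using 2 by (auto simp: corank_le_def)
  define B where "B = B1 @ map (\<lambda>(\<gamma>, b). (\<lambda>i. g i + \<gamma> i, G * b)) B2"
  \<comment> \<open>The sum of the \<open>g i\<close> ensures that D - g is a genuine difference and
    still at least \<Gamma>2.\<close>
  define \<Gamma> where "\<Gamma> = \<Gamma>1 + \<Gamma>2 + (\<Sum>i<k. g i)"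
  have "spanned S B \<Gamma>"
    unfolding spanned_def
  proof (intro allI impI)
    fix D \<phi>
    assume D: "\<forall>i<k. \<Gamma> \<le> D i" and \<phi>: "clin \<phi>" "annihilates \<phi> S D"
      and zB: "\<forall>(\<gamma>, b)\<in>set B. \<phi> (b * x0 (\<lambda>i. D i - \<gamma> i)) = 0"
    have gD: "g i + \<Gamma>2 \<le> D i" if "i < k" for i
    proof -
      have "g i \<le> (\<Sum>i<k. g i)" by (rule member_le_sum) (use that in auto)
      with D that show ?thesis by (force simp: \<Gamma>_def)
    qed
    define \<psi> :: "(nat \<times> nat, complex) mpoly \<Rightarrow> complex" where "\<psi> P = \<phi> (G * P)" for P
    have \<psi>: "clin \<psi>" unfolding \<psi>_def by (rule clin_mult_left[OF \<phi>(1)])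
    have "annihilates \<psi> (J \<union> K) (\<lambda>i. D i - g i)"
      unfolding annihilates_def
    proof (safe)
      fix h E D' and P :: "(nat \<times> nat, complex) mpoly"
      assume hE: "(h, E) \<in> J" "\<forall>i<k. h i + D' i = D i - g i" "P \<in> Forms D'"
      have "G * P \<in> Forms (\<lambda>i. g i + D' i)" using G hE by (intro Forms_mult)
      moreover have "h i + (g i + D' i) = D i" if "i < k" for i using gD[OF that] hE that by (metis add.left_commute add_leE le_add_diff_inverse)
      ultimately have "\<phi> (E * (G * P)) = 0"
        by (intro annihilatesD[OF \<phi>(2), of h E]) (use hE(1) in \<open>auto simp: S\<close>)
      then show "\<psi> (E * P) = 0" by (simp add: \<psi>_def mult.left_commute)
    next
      fix h E D' and P :: "(nat \<times> nat, complex) mpoly"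
      assume hE: "(h, E) \<in> K" "\<forall>i<k. h i + D' i = D i - g i" "P \<in> Forms D'"
      have "(\<lambda>i. g i + h i, G * E) \<in> S" using hE(1) by (force simp: S)
      moreover have "(g i + h i) + D' i = D i" if "i < k" for i using gD[OF that] hE that by (metis add.assoc add_leE le_add_diff_inverse)
      ultimately have "\<phi> ((G * E) * P) = 0"
        by (intro annihilatesD[OF \<phi>(2) _ _ hE(3)])
      then show "\<psi> (E * P) = 0" by (simp add: \<psi>_def mult.assoc)
    qed
    moreover have "\<forall>(\<gamma>, b)\<in>set B2. \<psi> (b * x0 (\<lambda>i. (D i - g i) - \<gamma> i)) = 0"
    proof clarify
      fix \<gamma> b assume "(\<gamma>, b) \<in> set B2"
      then have "(\<lambda>i. g i + \<gamma> i, G * b) \<in> set B" by (force simp: B_def)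
      with zB have "\<phi> (G * b * x0 (\<lambda>i. D i - (g i + \<gamma> i))) = 0" by fast
      then show "\<psi> (b * x0 (\<lambda>i. (D i - g i) - \<gamma> i)) = 0"
        by (simp add: \<psi>_def mult.assoc diff_diff_left)
    qed
    moreover have "\<forall>i<k. \<Gamma>2 \<le> D i - g i"
      using gD by (metis add.commute le_diff_conv2 add_leE)
    ultimately have \<psi>0: "\<psi> P = 0" if "P \<in> Forms (\<lambda>i. D i - g i)" for P
      by (intro spannedD[where D = "\<lambda>i. D i - g i" and \<phi> = \<psi>, OF B2(3) _ \<psi>(1) _ _ that]) auto
    have ann1: "annihilates \<phi> (insert (g, G) J) D"
      unfolding annihilates_def
    proof (safe)
      fix D' and P :: "(nat \<times> nat, complex) mpoly" assume "\<forall>i<k. g i + D' i = D i" "P \<in> Forms D'"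
      then have "P \<in> Forms (\<lambda>i. D i - g i)"
        using Forms_cong[of D' "\<lambda>i. D i - g i"] by (metis add_diff_cancel_left')
      then show "\<phi> (G * P) = 0" using \<psi>0 by (simp add: \<psi>_def)
    next
      fix h E D' and P :: "(nat \<times> nat, complex) mpoly"
      assume hE: "(h, E) \<in> J" "\<forall>i<k. h i + D' i = D i" "P \<in> Forms D'"
      show "\<phi> (E * P) = 0"
        by (rule annihilatesD[OF \<phi>(2) _ _ hE(3), of h]) (use hE in \<open>auto simp: S\<close>)
    qed
    have zB1: "\<phi> (b * x0 (\<lambda>i. D i - \<gamma> i)) = 0" if "(\<gamma>, b) \<in> set B1" for \<gamma> b
      using zB that by (auto simp: B_def)
    have D1: "\<Gamma>1 \<le> D i" if "i < k" for i using D that by (auto simp: \<Gamma>_def)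
    show "\<forall>P\<in>Forms D. \<phi> P = 0"
    proof
      fix P :: "(nat \<times> nat, complex) mpoly" assume P: "P \<in> Forms D"
      show "\<phi> P = 0"
        by (rule spannedD[OF B1(3) _ \<phi>(1) ann1 _ P]) (fact D1, fact zB1)
    qed
  qed
  moreover have "\<forall>(\<gamma>, b)\<in>set B. b \<in> Forms \<gamma>"
    using B1(2) B2(2) G by (auto simp: B_def intro: Forms_mult)
  moreover have "length B = N1 + N2" by (simp add: B_def B1 B2)
  ultimately show ?thesis unfolding corank_le_def by blast
qed

text \<open>The zeros of a product are the union of the zeros of its factors, so coranks add up. The
  empty product 1 spans everything, which starts the induction at 0.\<close>

lemma corank_le_prod:
  assumes "finite A" "\<And>a. a \<in> A \<Longrightarrow> f a \<in> Forms (D a)"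
    and "\<And>a. a \<in> A \<Longrightarrow> corank_le (insert (D a, f a) J) (M a)"
  shows "corank_le (insert (\<lambda>i. \<Sum>a\<in>A. D a i, \<Prod>a\<in>A. f a) J) (\<Sum>a\<in>A. M a)"
  using assms
proof (induction A rule: finite_induct)
  case empty
  have "spanned (insert (\<lambda>i. 0, 1) J) [] 0"
    unfolding spanned_def annihilates_def by auto
  then show ?case unfolding corank_le_def by (intro exI[of _ "[]"] exI[of _ 0]) simp
next
  case (insert a A)
  have "corank_le (insert (\<lambda>i. D a i + (\<Sum>a\<in>A. D a i), f a * (\<Prod>a\<in>A. f a)) J) (M a + (\<Sum>a\<in>A. M a))"
  proof (rule corank_le_product[where g = "D a" and G = "f a" and J = J and K = "{(\<lambda>i. \<Sum>a\<in>A. D a i, \<Prod>a\<in>A. f a)}"])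
    show "corank_le (J \<union> {(\<lambda>i. \<Sum>a\<in>A. D a i, \<Prod>a\<in>A. f a)}) (\<Sum>a\<in>A. M a)"
      using insert by simp
  qed (use insert in auto)
  with insert.hyps show ?case by simp
qed

section \<open>Systems of labelled linear forms\<close>

definition label_form :: "nat \<times> label \<Rightarrow> (nat \<times> nat, complex) mpoly" where
  "label_form = (\<lambda>(j, a). \<Sum>l\<le>n j. cst (label_vec a l) * mvar (j, l))"

definition label_set :: "(nat \<times> label) set" where
  "label_set = (SIGMA j:{..<k}. labels (n j))"

definition label_sys :: "(nat \<times> label) set \<Rightarrow> ((nat \<Rightarrow> nat) \<times> (nat \<times> nat, complex) mpoly) set" where
  "label_sys \<Lambda> = (\<lambda>a. (udeg (fst a), label_form a)) ` \<Lambda>"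

definition label_count :: "(nat \<times> label) set \<Rightarrow> nat \<Rightarrow> nat" where
  "label_count \<Lambda> j = card {a. (j, a) \<in> \<Lambda>}"

lemma label_form_in_Forms: "a \<in> label_set \<Longrightarrow> label_form a \<in> Forms (udeg (fst a))"
  by (auto simp: label_form_def label_set_def vars_def intro!: Forms_sum Forms_cst Forms_mvar)

lemma label_form_Inl: "l \<le> n j \<Longrightarrow> label_form (j, Inl l) = mvar (j, l)"
proof -
  assume "l \<le> n j"
  have "label_form (j, Inl l) = (\<Sum>i\<le>n j. if i = l then mvar (j, i) else 0)"
    unfolding label_form_def prod.case by (intro sum.cong) auto
  with \<open>l \<le> n j\<close> show ?thesis by simp
qed

lemma mpoly_eval_label_form: "mpoly_eval x (label_form (j, a)) = (\<Sum>l\<le>n j. label_vec a l * x (j, l))"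
  by (simp add: label_form_def mpe.hom_sum mpe.hom_mult)

text \<open>Reduction to linear algebra in one group of variables: for a fixed monomial \<mu>, the
  values of \<phi> on x_jl \<mu> form a vector in l to which general position applies.\<close>

lemma annihilates_label:
  assumes \<phi>: "clin \<phi>" "annihilates \<phi> (label_sys \<Lambda>) D" and a: "(j, a) \<in> \<Lambda>"
    and \<mu>: "\<mu> \<in> Mon D'" "\<And>i. i < k \<Longrightarrow> udeg j i + D' i = D i"
  shows "(\<Sum>l\<le>n j. label_vec a l * \<phi> (mvar (j, l) * single \<mu> 1)) = 0"
proof -
  have "\<phi> (label_form (j, a) * single \<mu> 1) = 0"
    using \<phi>(2) a \<mu> Forms_single[OF \<mu>(1)] unfolding annihilates_def label_sys_def by fastforce
  then show ?thesis
    by (simp add: label_form_def sum_distrib_right clin_sum[OF \<phi>(1)] mult.assoc clin_scale[OF \<phi>(1)])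
qed

lemma Mon_split:
  assumes "\<mu> \<in> Mon D" "(j, l) \<in> keys \<mu>"
  obtains \<mu>' where "\<mu> = single (j, l) 1 + \<mu>'" "\<mu>' \<in> Mon (\<lambda>i. D i - udeg j i)" "(j, l) \<in> vars" "1 \<le> D j"
proof
  let ?\<mu>' = "\<mu> - single (j, l) 1"
  have ge: "1 \<le> lookup \<mu> (j, l)" using assms(2) by (simp add: in_keys_iff)
  show eq: "\<mu> = single (j, l) 1 + ?\<mu>'"
    by (rule poly_mapping_eqI) (use ge in \<open>auto simp: lookup_add lookup_minus lookup_single when_def\<close>)
  show v: "(j, l) \<in> vars" using assms by (auto simp: Mon_def)
  have d: "mdeg \<mu> i = udeg j i + mdeg ?\<mu>' i" for i
    by (subst eq, subst mdeg_add) (use v in \<open>auto simp: mdeg_single vars_def\<close>)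
  have "keys ?\<mu>' \<subseteq> keys \<mu>" by (auto simp: in_keys_iff lookup_minus)
  moreover have "mdeg ?\<mu>' i = D i - udeg j i" if "i < k" for i
    using d[of i] assms(1) that by (simp add: Mon_def)
  ultimately show "?\<mu>' \<in> Mon (\<lambda>i. D i - udeg j i)"
    using assms(1) by (auto simp: Mon_def)
  have "D j = mdeg \<mu> j" using v assms(1) by (auto simp: Mon_def vars_def)
  with d[of j] show "1 \<le> D j" by simp
qed

lemma clin_zero_on_Forms:
  assumes "clin \<phi>" "\<And>\<mu>. \<mu> \<in> Mon D \<Longrightarrow> \<phi> (single \<mu> 1) = 0" "P \<in> Forms D"
  shows "\<phi> P = 0"
  using assms(2,3) by (subst clin_expand[OF assms(1)]) (auto simp: Forms_def intro!: sum.neutral)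

text \<open>More than n_j forms in general position have no common zero in the j-th projective
  space. Degree at least 1 provides a variable of group j to split off from each monomial.\<close>

lemma corank_le_overfull:
  assumes \<Lambda>: "\<Lambda> \<subseteq> label_set" "finite \<Lambda>" and j: "j < k" "n j < label_count \<Lambda> j"
  shows "corank_le (label_sys \<Lambda>) 0"
proof -
  have "spanned (label_sys \<Lambda>) [] 1"
    unfolding spanned_def
  proof (intro allI impI ballI)
    fix D \<phi> and P :: "(nat \<times> nat, complex) mpoly"
    assume D: "\<forall>i<k. 1 \<le> D i" and \<phi>: "clin \<phi>" "annihilates \<phi> (label_sys \<Lambda>) D" and P: "P \<in> Forms D"
    show "\<phi> P = 0"
    proof (rule clin_zero_on_Forms[OF \<phi>(1) _ P])
      fix \<mu> assume \<mu>: "\<mu> \<in> Mon D"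
      have "mdeg \<mu> j \<noteq> 0" using \<mu> D j by (auto simp: Mon_def)
      then obtain l where "(j, l) \<in> keys \<mu>" by (auto simp: mdeg_def in_keys_iff)
      then obtain \<mu>' where \<mu>': "\<mu> = single (j, l) 1 + \<mu>'" "\<mu>' \<in> Mon (\<lambda>i. D i - udeg j i)" "(j, l) \<in> vars"
        using Mon_split \<mu> by blast
      have "\<phi> (mvar (j, l) * single \<mu>' 1) = 0"
      proof (rule labels_general_position[of "{a. (j, a) \<in> \<Lambda>}" "n j"])
        show "{a. (j, a) \<in> \<Lambda>} \<subseteq> labels (n j)" using \<Lambda> by (auto simp: label_set_def)
        have "{a. (j, a) \<in> \<Lambda>} \<subseteq> snd ` \<Lambda>" by force
        then show "finite {a. (j, a) \<in> \<Lambda>}" using \<Lambda> finite_subset by blast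
        show "(\<Sum>l\<le>n j. label_vec a l * \<phi> (mvar (j, l) * single \<mu>' 1)) = 0" if "a \<in> {a. (j, a) \<in> \<Lambda>}" for a
          by (rule annihilates_label[OF \<phi> _ \<mu>'(2)]) (use that D in auto)
      qed (use j \<mu>' in \<open>auto simp: label_count_def vars_def\<close>)
      then show "\<phi> (single \<mu> 1) = 0" by (simp add: mvar_def mult_single \<mu>'(1))
    qed
  qed
  then show ?thesis unfolding corank_le_def by (intro exI[of _ "[]"]) auto
qed

text \<open>Exchanging a variable x_jl, l \<noteq> 0, for x_j0 lowers the number of variables of
  nonzero index, and the exchanges end at the monomial in the x_j0 alone.\<close>

lemma Mon_shift_induct [consumes 1, case_names base shift]:
  assumes "\<mu> \<in> Mon D"
    and base: "Q (x0m D)"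
    and shift: "\<And>j l \<mu>'. (j, l) \<in> vars \<Longrightarrow> (j, 0) \<in> vars \<Longrightarrow> l \<noteq> 0 \<Longrightarrow> 1 \<le> D j \<Longrightarrow> \<mu>' \<in> Mon (\<lambda>i. D i - udeg j i) \<Longrightarrow>
      single (j, 0) 1 + \<mu>' \<in> Mon D \<Longrightarrow> Q (single (j, 0) 1 + \<mu>') \<Longrightarrow> Q (single (j, l) 1 + \<mu>')"
  shows "Q \<mu>"
proof -
  define w :: "(nat \<times> nat \<Rightarrow>\<^sub>0 nat) \<Rightarrow> nat" where "w \<mu> = (\<Sum>v\<in>vars \<inter> {v. snd v \<noteq> 0}. lookup \<mu> v)" for \<mu>
  have w_add: "w (\<mu> + \<nu>) = w \<mu> + w \<nu>" for \<mu> \<nu> by (simp add: w_def lookup_add sum.distrib)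
  have w_var: "w (single (j, l) 1) = (if l = 0 then 0 else 1)" if "(j, l) \<in> vars" for j l
  proof -
    have "w (single (j, l) 1) = (\<Sum>v\<in>vars \<inter> {v. snd v \<noteq> 0}. if v = (j, l) then 1 else 0)"
      unfolding w_def by (intro sum.cong) (auto simp: lookup_single when_def)
    then show ?thesis using that finite_vars by auto
  qed
  show ?thesis
    using assms(1)
  proof (induction "w \<mu>" arbitrary: \<mu> rule: less_induct)
    case less
    show ?case
    proof (cases "\<exists>j l. (j, l) \<in> keys \<mu> \<and> l \<noteq> 0")
      case False
      have "\<mu> = x0m D"
      proof (rule poly_mapping_eqI)
        fix v :: "nat \<times> nat" obtain j l where v: "v = (j, l)" by (cases v)
        show "lookup \<mu> v = lookup (x0m D) v"
        proof (cases "j < k \<and> l = 0")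
          case True
          have "lookup \<mu> (j, l') = 0" if "l' \<noteq> 0" for l' using False that by (auto simp: in_keys_iff)
          then have "mdeg \<mu> j = (\<Sum>l'\<le>n j. if l' = 0 then lookup \<mu> (j, 0) else 0)"
            unfolding mdeg_def by (intro sum.cong) auto
          then have "mdeg \<mu> j = lookup \<mu> (j, 0)" by simp
          with True v less.prems show ?thesis by (simp add: lookup_x0m Mon_def)
        next
          case nt: False
          then have "v \<notin> keys \<mu>" using False less.prems v by (force simp: Mon_def vars_def)
          with nt v show ?thesis by (auto simp: lookup_x0m in_keys_iff)
        qed
      qed
      with base show ?thesis by simp
    next
      case True
      then obtain j l where jl: "(j, l) \<in> keys \<mu>" "l \<noteq> 0" by blast
      then obtain \<mu>' where \<mu>': "\<mu> = single (j, l) 1 + \<mu>'" "\<mu>' \<in> Mon (\<lambda>i. D i - udeg j i)" "(j, l) \<in> vars" "1 \<le> D j"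
        using Mon_split less.prems by blast
      have v0: "(j, 0) \<in> vars" using \<mu>' by (simp add: vars_def)
      have "single (j, 0) 1 + \<mu>' \<in> Mon (\<lambda>i. udeg j i + (D i - udeg j i))"
        by (intro Mon_add Mon_var v0 \<mu>')
      also have "\<dots> = Mon D" by (rule Mon_cong) (use \<mu>' in auto)
      finally have M: "single (j, 0) 1 + \<mu>' \<in> Mon D" .
      then have "Q (single (j, 0) 1 + \<mu>')"
        by (intro less.hyps) (use jl in \<open>simp_all add: \<mu>'(1) w_add w_var[OF \<mu>'(3)] w_var[OF v0] del: One_nat_def\<close>)
      from shift[OF \<mu>'(3) v0 jl(2) \<mu>'(4) \<mu>'(2) M this] \<mu>'(1) show ?thesis by simp
    qed
  qed
qed

text \<open>Together with x_j0 there are more than n_j forms in general position in each group, so a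
  functional that is 0 at x_j0 \<mu>' is 0 at every x_jl \<mu>'. Hence its value at
  \<open>x0 D\<close> determines it. The exclusion of \<open>Inl 0\<close> is what makes x_j0 an
  additional form.\<close>

lemma corank_le_point:
  assumes \<Lambda>: "\<Lambda> \<subseteq> label_set" "finite \<Lambda>" and cnt: "\<And>j. j < k \<Longrightarrow> n j \<le> label_count \<Lambda> j"
    and no0: "\<And>j. (j, Inl 0) \<notin> \<Lambda>"
  shows "corank_le (label_sys \<Lambda>) 1"
proof -
  have "spanned (label_sys \<Lambda>) [(\<lambda>_. 0, 1)] 0"
    unfolding spanned_def
  proof (intro allI impI ballI)
    fix D \<phi> and P :: "(nat \<times> nat, complex) mpoly"
    assume \<phi>: "clin \<phi>" "annihilates \<phi> (label_sys \<Lambda>) D" and P: "P \<in> Forms D"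
      and "\<forall>(\<gamma>, b)\<in>set [(\<lambda>_. 0, 1)]. \<phi> (b * x0 (\<lambda>i. D i - \<gamma> i)) = 0"
    then have zero: "\<phi> (x0 D) = 0" by simp
    show "\<phi> P = 0"
    proof (rule clin_zero_on_Forms[OF \<phi>(1) _ P])
      fix \<mu> assume "\<mu> \<in> Mon D"
      then show "\<phi> (single \<mu> 1) = 0"
      proof (induction rule: Mon_shift_induct)
        case base
        from zero show ?case by (simp add: x0_def)
      next
        case (shift j l \<mu>')
        have jk: "j < k" and l: "l \<le> n j" using shift by (auto simp: vars_def)
        have z: "\<phi> (mvar (j, 0) * single \<mu>' 1) = 0" using shift by (simp add: mvar_def mult_single)
        let ?A = "{a. (j, a) \<in> \<Lambda>}"
        have "?A \<subseteq> snd ` \<Lambda>" by force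
        then have fin: "finite ?A" using \<Lambda> finite_subset by blast
        have "\<phi> (mvar (j, l) * single \<mu>' 1) = 0"
        proof (rule labels_general_position[of "insert (Inl 0) ?A" "n j"])
          show "insert (Inl 0) ?A \<subseteq> labels (n j)" using \<Lambda> by (auto simp: label_set_def labels_def)
          show "n j < card (insert (Inl 0) ?A)"
            using cnt[OF jk] no0 fin by (simp add: label_count_def)
          show "(\<Sum>l\<le>n j. label_vec a l * \<phi> (mvar (j, l) * single \<mu>' 1)) = 0" if "a \<in> insert (Inl 0) ?A" for a
          proof (cases "a = Inl 0")
            case True
            then have "(\<Sum>l\<le>n j. label_vec a l * \<phi> (mvar (j, l) * single \<mu>' 1)) =
                (\<Sum>l\<le>n j. if l = 0 then \<phi> (mvar (j, l) * single \<mu>' 1) else 0)"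
              by (intro sum.cong) auto
            with z show ?thesis by simp
          next
            case False
            with that show ?thesis
              by (intro annihilates_label[OF \<phi> _ shift(5)]) (use shift in auto)
          qed
        qed (use fin l in auto)
        then show ?case by (simp add: mvar_def mult_single)
      qed
    qed
  qed
  then show ?thesis unfolding corank_le_def by (intro exI[of _ "[(\<lambda>_. 0, 1)]"]) (auto simp: Forms_1)
qed

end

lemma sum_PiE_insert:
  assumes "x \<notin> A"
  shows "(\<Sum>c\<in>PiE (insert x A) Ch. f c) = (\<Sum>y\<in>Ch x. \<Sum>c\<in>PiE A Ch. f (c(x := y)))"
proof -
  have "(\<Sum>c\<in>PiE (insert x A) Ch. f c) = (\<Sum>(y, c)\<in>Ch x \<times> PiE A Ch. f (c(x := y)))"
    unfolding PiE_insert_eq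
    by (subst sum.reindex[OF inj_combinator[OF assms]]) (simp add: case_prod_unfold)
  also have "\<dots> = (\<Sum>y\<in>Ch x. \<Sum>c\<in>PiE A Ch. f (c(x := y)))"
    by (rule sum.cartesian_product[symmetric])
  finally show ?thesis .
qed

context multigrading
begin

text \<open>Successive case distinctions multiply out to choice functions. The single step has to
  hold for every \<open>J\<close>, since the conditions not yet split are absorbed into
  \<open>J\<close>.\<close>

lemma corank_le_branch:
  assumes "finite A"
    and step: "\<And>x J N. x \<in> A \<Longrightarrow> (\<And>y. y \<in> Ch x \<Longrightarrow> corank_le (J \<union> L x y) (N y)) \<Longrightarrow> corank_le (J \<union> C x) (\<Sum>y\<in>Ch x. N y)"
    and leaf: "\<And>c. c \<in> PiE A Ch \<Longrightarrow> corank_le (J \<union> (\<Union>x\<in>A. L x (c x))) (N c)"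
  shows "corank_le (J \<union> (\<Union>x\<in>A. C x)) (\<Sum>c\<in>PiE A Ch. N c)"
  using assms
proof (induction A arbitrary: J N rule: finite_induct)
  case empty
  then show ?case using empty(2)[of "\<lambda>_. undefined"] by simp
next
  case (insert x A)
  have "corank_le ((J \<union> (\<Union>z\<in>A. C z)) \<union> L x y) (\<Sum>c\<in>PiE A Ch. N (c(x := y)))" if y: "y \<in> Ch x" for y
  proof -
    have "corank_le ((J \<union> L x y) \<union> (\<Union>z\<in>A. C z)) (\<Sum>c\<in>PiE A Ch. N (c(x := y)))"
    proof (rule insert.IH)
      fix c assume c: "c \<in> PiE A Ch"
      then have "c(x := y) \<in> PiE (insert x A) Ch" using y by (intro PiE_fun_upd)
      from insert.prems(2)[OF this]
      have "corank_le (J \<union> (\<Union>z\<in>insert x A. L z ((c(x := y)) z))) (N (c(x := y)))" .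
      moreover have "(\<Union>z\<in>insert x A. L z ((c(x := y)) z)) = L x y \<union> (\<Union>z\<in>A. L z (c z))"
        using insert.hyps(2) by (auto split: if_splits)
      ultimately show "corank_le ((J \<union> L x y) \<union> (\<Union>z\<in>A. L z (c z))) (N (c(x := y)))"
        by (simp add: Un_assoc)
    qed (use insert.prems(1) in blast)
    then show ?thesis by (simp add: Un_ac)
  qed
  then have "corank_le ((J \<union> (\<Union>z\<in>A. C z)) \<union> C x) (\<Sum>y\<in>Ch x. \<Sum>c\<in>PiE A Ch. N (c(x := y)))"
    by (intro insert.prems(1)) auto
  then show ?case
    unfolding sum_PiE_insert[OF insert.hyps(2)] by (simp add: Un_ac)
qed

end

section \<open>The degenerate system\<close>

locale multigraded_map = multigrading k n for k n +
  fixes d :: "nat \<Rightarrow> nat \<Rightarrow> nat"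
begin

text \<open>Any injection into the positive numbers would do: it makes all the linear factors of all the forms
  \<open>G x\<close> different, hence in general position.\<close>

definition tau :: "nat \<times> nat \<Rightarrow> nat \<Rightarrow> nat" where
  "tau x a = Suc (prod_encode (prod_encode x, a))"

lemma tau_inject: "tau x a = tau x' a' \<longleftrightarrow> x = x' \<and> a = a'"
  by (simp add: tau_def)

text \<open>A pair (j, a) names one linear factor in the j-th group of variables. There are
  \<open>d i j\<close> of them, which gives the product multidegree \<open>d i\<close>.\<close>

definition factors :: "nat \<times> nat \<Rightarrow> (nat \<times> nat) set" where
  "factors x = (SIGMA j:{..<k}. {..<d (fst x) j})"

definition factor_label :: "nat \<times> nat \<Rightarrow> nat \<times> nat \<Rightarrow> nat \<times> label" where
  "factor_label x ya = (fst ya, Inr (tau x (snd ya)))"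

definition G :: "nat \<times> nat \<Rightarrow> (nat \<times> nat, complex) mpoly" where
  "G x = (\<Prod>ya\<in>factors x. label_form (factor_label x ya))"

text \<open>This agrees with \<open>d i\<close> below \<open>k\<close>; as a sum over the factors it
  has the form in which \<open>Forms_prod\<close> and \<open>corank_le_prod\<close> produce
  degrees.\<close>

definition dG :: "nat \<Rightarrow> nat \<Rightarrow> nat" where
  "dG i = (\<lambda>j. \<Sum>ya\<in>factors (i, 0). udeg (fst ya) j)"

lemma finite_factors: "finite (factors x)"
  by (simp add: factors_def)

lemma factors_fst: "factors x = factors (fst x, 0)"
  by (simp add: factors_def)

lemma dG_eq: "j < k \<Longrightarrow> dG i j = d i j"
proof -
  assume j: "j < k"
  have "dG i j = (\<Sum>j'<k. \<Sum>a<d i j'. udeg j' j)"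
    unfolding dG_def factors_def by (subst sum.Sigma) (auto simp: case_prod_unfold)
  also have "\<dots> = (\<Sum>j'<k. if j' = j then d i j else 0)" by (intro sum.cong) auto
  finally show ?thesis using j by simp
qed

lemma factor_label_in: "ya \<in> factors x \<Longrightarrow> factor_label x ya \<in> label_set"
  by (auto simp: factors_def factor_label_def label_set_def labels_def tau_def)

lemma factor_form: "ya \<in> factors x \<Longrightarrow> label_form (factor_label x ya) \<in> Forms (udeg (fst ya))"
  using label_form_in_Forms[OF factor_label_in] by (simp add: factor_label_def)

lemma G_in_Forms: "G x \<in> Forms (dG (fst x))"
  unfolding G_def dG_def factors_fst[of x]
  by (rule Forms_prod) (use finite_factors factor_form in \<open>auto simp: factors_fst[of x, symmetric]\<close>)

definition special_sys :: "nat \<Rightarrow> ((nat \<Rightarrow> nat) \<times> (nat \<times> nat, complex) mpoly) set" where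
  "special_sys i = {(\<lambda>j. dG i j + udeg i j, G (i, l) * mvar (i, l')) | l l'. l < l' \<and> l' \<le> n i}"

definition coord_sys :: "nat \<Rightarrow> nat \<Rightarrow> ((nat \<Rightarrow> nat) \<times> (nat \<times> nat, complex) mpoly) set" where
  "coord_sys i t = {(udeg i, mvar (i, l')) | l'. t < l' \<and> l' \<le> n i}"

text \<open>Suppose G_il = 0 is known for l < m. The products G_im x_il', l' > m, vanish either
  because G_im does, which leads on to m + 1, or because all x_il' with l' > m do, which is the case
  t = m. The stages \<open>Sm m\<close> are summed from m = n_i downwards.\<close>

lemma corank_le_special_step:
  assumes "\<And>t. t \<le> n i \<Longrightarrow> corank_le (J \<union> (coord_sys i t \<union> (\<lambda>l. (dG i, G (i, l))) ` {..<t})) (N t)"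
  shows "corank_le (J \<union> special_sys i) (\<Sum>t\<le>n i. N t)"
proof -
  define Sm where "Sm m = J \<union> (\<lambda>l. (dG i, G (i, l))) ` {..<m} \<union>
    {(\<lambda>j. dG i j + udeg i j, G (i, l) * mvar (i, l')) | l l'. m \<le> l \<and> l < l' \<and> l' \<le> n i}" for m
  have "corank_le (Sm m) (\<Sum>t=m..n i. N t)" if "m \<le> n i" for m
    using that
  proof (induction rule: inc_induct)
    case base
    have "corank_le (Sm (n i)) (N (n i))"
      by (rule corank_le_mono[OF assms[of "n i"]]) (auto simp: Sm_def coord_sys_def)
    then show ?case by simp
  next
    case (step m)
    define J' where "J' = J \<union> (\<lambda>l. (dG i, G (i, l))) ` {..<m} \<union>
      {(\<lambda>j. dG i j + udeg i j, G (i, l) * mvar (i, l')) | l l'. Suc m \<le> l \<and> l < l' \<and> l' \<le> n i}"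
    have "corank_le (Sm m) ((\<Sum>t=Suc m..n i. N t) + N m)"
    proof (rule corank_le_product[where J = J' and g = "dG i" and G = "G (i, m)" and K = "coord_sys i m"])
      show "G (i, m) \<in> Forms (dG i)" using G_in_Forms[of "(i, m)"] by simp
      have "insert (dG i, G (i, m)) J' = Sm (Suc m)"
        by (auto simp: J'_def Sm_def lessThan_Suc)
      with step show "corank_le (insert (dG i, G (i, m)) J') (\<Sum>t=Suc m..n i. N t)" by simp
      show "corank_le (J' \<union> coord_sys i m) (N m)"
        by (rule corank_le_mono[OF assms[of m]]) (use step in \<open>auto simp: J'_def\<close>)
      have "{(\<lambda>j. dG i j + udeg i j, G (i, l) * mvar (i, l')) | l l'. m \<le> l \<and> l < l' \<and> l' \<le> n i} =
        {(\<lambda>j. dG i j + udeg i j, G (i, l) * mvar (i, l')) | l l'. Suc m \<le> l \<and> l < l' \<and> l' \<le> n i} \<union>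
        (\<lambda>(h, E). (\<lambda>ia. dG i ia + h ia, G (i, m) * E)) ` coord_sys i m" (is "?X = ?Y \<union> ?Z")
      proof (intro equalityI subsetI)
        fix z assume "z \<in> ?X"
        then obtain l l' where z: "z = (\<lambda>j. dG i j + udeg i j, G (i, l) * mvar (i, l'))" "m \<le> l" "l < l'" "l' \<le> n i"
          by blast
        show "z \<in> ?Y \<union> ?Z"
        proof (cases "l = m")
          case True
          have "(udeg i, mvar (i, l')) \<in> coord_sys i m" using z True by (auto simp: coord_sys_def)
          then have "z \<in> ?Z" using True z(1) by (intro image_eqI[of _ _ "(udeg i, mvar (i, l'))"]) auto
          then show ?thesis ..
        next
          case False
          then have "Suc m \<le> l" using z by simp
          then show ?thesis using z by blast
        qed
      next
        fix z assume "z \<in> ?Y \<union> ?Z"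
        then show "z \<in> ?X"
        proof
          assume "z \<in> ?Y" then show ?thesis using Suc_leD by blast
        qed (auto simp: coord_sys_def)
      qed
      then show "Sm m = J' \<union> (\<lambda>(h, E). (\<lambda>ia. dG i ia + h ia, G (i, m) * E)) ` coord_sys i m"
        unfolding Sm_def J'_def by (simp add: Un_ac)
    qed
    then show ?case using step by (simp add: sum.atLeast_Suc_atMost add.commute)
  qed
  from this[of 0] show ?thesis
    by (simp add: Sm_def special_sys_def atLeast0AtMost)
qed

text \<open>The set \<open>P\<close> is left open because excluding zeros of a whole component
  requires one pair more than \<open>pending t\<close>.\<close>

definition leaf_labels :: "(nat \<Rightarrow> nat) \<Rightarrow> (nat \<times> nat) set \<Rightarrow> (nat \<times> nat \<Rightarrow> nat \<times> nat) \<Rightarrow> (nat \<times> label) set" where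
  "leaf_labels t P c = (SIGMA i:{..<k}. Inl ` {t i<..n i}) \<union> (\<lambda>x. factor_label x (c x)) ` P"

lemma leaf_labels:
  assumes P: "finite P" and c: "c \<in> PiE P factors"
  shows leaf_labels_subset: "leaf_labels t P c \<subseteq> label_set" and finite_leaf_labels: "finite (leaf_labels t P c)"
    and leaf_label_count: "j < k \<Longrightarrow> label_count (leaf_labels t P c) j = (n j - t j) + card {x\<in>P. fst (c x) = j}"
proof -
  have "(SIGMA i:{..<k}. Inl ` {t i<..n i}) \<subseteq> label_set"
    by (auto simp: label_set_def labels_def)
  moreover have "factor_label x (c x) \<in> label_set" if "x \<in> P" for x
    using c that by (intro factor_label_in) (auto simp: PiE_iff)
  ultimately show "leaf_labels t P c \<subseteq> label_set"
    unfolding leaf_labels_def by blast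
  show "finite (leaf_labels t P c)"
    using P by (auto simp: leaf_labels_def)
  assume j: "j < k"
  have "{a. (j, a) \<in> leaf_labels t P c} = Inl ` {t j<..n j} \<union> (\<lambda>x. Inr (tau x (snd (c x)))) ` {x\<in>P. fst (c x) = j}"
    using j by (auto simp: leaf_labels_def factor_label_def)
  moreover have "inj_on (\<lambda>x. Inr (tau x (snd (c x))) :: label) {x\<in>P. fst (c x) = j}"
    by (auto simp: inj_on_def tau_inject)
  moreover have "card (Inl ` {t j<..n j} \<union> (\<lambda>x. Inr (tau x (snd (c x)))) ` {x\<in>P. fst (c x) = j}) =
      card (Inl ` {t j<..n j} :: label set) + card ((\<lambda>x. Inr (tau x (snd (c x))) :: label) ` {x\<in>P. fst (c x) = j})"
    using P by (intro card_Un_disjoint) auto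
  ultimately show "label_count (leaf_labels t P c) j = (n j - t j) + card {x\<in>P. fst (c x) = j}"
    unfolding label_count_def by (simp add: card_image)
qed

text \<open>A leaf \<open>(t, c)\<close> of the case distinction: \<open>x\<^sub>i\<^sub>l = 0\<close> for \<open>l > t i\<close>, and for the pending pairs \<open>(i, l)\<close>,
  \<open>l < t i\<close>, the factor \<open>c (i, l)\<close> of \<open>G (i, l)\<close> vanishes. It is a point if it is valid and empty otherwise.\<close>

definition pending :: "(nat \<Rightarrow> nat) \<Rightarrow> (nat \<times> nat) set" where
  "pending t = (SIGMA i:{..<k}. {..<t i})"

definition valid :: "(nat \<Rightarrow> nat) \<Rightarrow> (nat \<times> nat \<Rightarrow> nat \<times> nat) \<Rightarrow> bool" where
  "valid t c \<longleftrightarrow> (\<forall>j<k. card {x\<in>pending t. fst (c x) = j} = t j)"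

lemma sum_fibres:
  assumes "finite P" "c \<in> PiE P factors"
  shows "(\<Sum>j<k. card {x\<in>P. fst (c x) = j}) = card P"
proof -
  have "P = (\<Union>j<k. {x\<in>P. fst (c x) = j})"
    using assms(2) by (force simp: PiE_iff factors_def)
  then have "card P = card (\<Union>j<k. {x\<in>P. fst (c x) = j})" by simp
  also have "\<dots> = (\<Sum>j<k. card {x\<in>P. fst (c x) = j})"
    by (rule card_UN_disjoint) (use assms in auto)
  finally show ?thesis ..
qed

lemma finite_pending: "finite (pending t)"
  by (simp add: pending_def)

lemma card_pending: "card (pending t) = (\<Sum>i<k. t i)"
  by (simp add: pending_def)

text \<open>Pigeonhole: at least \<Sum> t_i factors are chosen, so if some group does not receive
  t_j of them, some group receives more. With the n_j - t_j coordinates that group is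
  overfull.\<close>

lemma corank_le_leaf:
  assumes P: "finite P" "c \<in> PiE P factors" and t: "\<And>i. i < k \<Longrightarrow> t i \<le> n i" 
    and card: "(\<Sum>i<k. t i) \<le> card P"
    and nv: "\<exists>j<k. card {x\<in>P. fst (c x) = j} \<noteq> t j"
  shows "corank_le (label_sys (leaf_labels t P c)) 0"
proof -
  have "\<exists>j<k. t j < card {x\<in>P. fst (c x) = j}"
  proof (rule ccontr)
    assume "\<not> ?thesis"
    then have le: "card {x\<in>P. fst (c x) = j} \<le> t j" if "j < k" for j using that by (meson not_less)
    obtain j where j: "j < k" "card {x\<in>P. fst (c x) = j} < t j" using nv le by (meson le_neq_implies_less)
    have "(\<Sum>j<k. card {x\<in>P. fst (c x) = j}) < (\<Sum>j<k. t j)"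
      by (rule sum_strict_mono_ex1) (use le j in auto)
    with card sum_fibres[OF P] show False by simp
  qed
  then obtain j where j: "j < k" "t j < card {x\<in>P. fst (c x) = j}" by blast
  have "n j < label_count (leaf_labels t P c) j"
    using j t[OF j(1)] unfolding leaf_label_count[OF P j(1)] by linarith
  then show ?thesis
    by (rule corank_le_overfull[OF leaf_labels_subset[OF P] finite_leaf_labels[OF P] j(1)])
qed

lemma label_sys_leaf:
  "label_sys (leaf_labels t P c) =
    (\<Union>i<k. coord_sys i (t i)) \<union> (\<Union>x\<in>P. {(udeg (fst (c x)), label_form (factor_label x (c x)))})"
proof -
  have "label_sys (SIGMA i:{..<k}. Inl ` {t i<..n i}) = (\<Union>i<k. coord_sys i (t i))"
    by (force simp: label_sys_def coord_sys_def label_form_Inl)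
  moreover have "label_sys ((\<lambda>x. factor_label x (c x)) ` P) =
      (\<Union>x\<in>P. {(udeg (fst (c x)), label_form (factor_label x (c x)))})"
    by (simp add: label_sys_def image_image UNION_singleton_eq_range) (simp add: factor_label_def)
  ultimately show ?thesis
    by (simp add: leaf_labels_def) (simp add: label_sys_def image_Un)
qed

text \<open>The case distinction over t is followed by one over a factor for each pair in
  \<open>P t\<close>. Pairs beyond the pending ones are allowed if \<open>J\<close> contains their
  forms, so both following corank bounds are instances.\<close>

lemma corank_le_special_gen:
  assumes P: "\<And>t. t \<in> PiE {..<k} (\<lambda>i. {..n i}) \<Longrightarrow> finite (P t) \<and> pending t \<subseteq> P t \<and>
      (\<forall>x\<in>P t - pending t. (dG (fst x), G x) \<in> J)"
    and leaf: "\<And>t c. t \<in> PiE {..<k} (\<lambda>i. {..n i}) \<Longrightarrow> c \<in> PiE (P t) factors \<Longrightarrow>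
      corank_le (label_sys (leaf_labels t (P t) c)) (N t c)"
  shows "corank_le (J \<union> (\<Union>i<k. special_sys i))
    (\<Sum>t\<in>PiE {..<k} (\<lambda>i. {..n i}). \<Sum>c\<in>PiE (P t) factors. N t c)"
proof (rule corank_le_branch)
  fix i J N assume "\<And>t. t \<in> {..n i} \<Longrightarrow> corank_le (J \<union> (coord_sys i t \<union> (\<lambda>l. (dG i, G (i, l))) ` {..<t})) (N t)"
  then show "corank_le (J \<union> special_sys i) (\<Sum>t\<le>n i. N t)"
    by (intro corank_le_special_step) auto
next
  fix t assume t: "t \<in> PiE {..<k} (\<lambda>i. {..n i})"
  let ?A = "\<Union>i<k. coord_sys i (t i)"
  have "corank_le (?A \<union> (\<Union>x\<in>P t. {(dG (fst x), G x)})) (\<Sum>c\<in>PiE (P t) factors. N t c)"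
  proof (rule corank_le_branch)
    fix x J and N :: "nat \<times> nat \<Rightarrow> nat"
    assume "\<And>y. y \<in> factors x \<Longrightarrow> corank_le (J \<union> {(udeg (fst y), label_form (factor_label x y))}) (N y)"
    then have "corank_le (insert (\<lambda>i. \<Sum>a\<in>factors x. udeg (fst a) i, \<Prod>a\<in>factors x. label_form (factor_label x a)) J) (\<Sum>y\<in>factors x. N y)"
      by (intro corank_le_prod finite_factors factor_form) auto
    then show "corank_le (J \<union> {(dG (fst x), G x)}) (\<Sum>y\<in>factors x. N y)"
      by (simp add: dG_def G_def factors_fst[of x, symmetric])
  next
    fix c assume c: "c \<in> PiE (P t) factors"
    show "corank_le (?A \<union> (\<Union>x\<in>P t. {(udeg (fst (c x)), label_form (factor_label x (c x)))})) (N t c)"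
      using leaf[OF t c] by (simp add: label_sys_leaf)
  qed (use P[OF t] in auto)
  then show "corank_le (J \<union> (\<Union>i\<in>{..<k}. coord_sys i (t i) \<union> (\<lambda>l. (dG i, G (i, l))) ` {..<t i})) (\<Sum>c\<in>PiE (P t) factors. N t c)"
  proof (rule corank_le_mono)
    have "(dG (fst x), G x) \<in> J \<union> (\<Union>i\<in>{..<k}. (\<lambda>l. (dG i, G (i, l))) ` {..<t i})" if "x \<in> P t" for x
    proof (cases "x \<in> pending t")
      case True
      then obtain i l where "x = (i, l)" "i < k" "l < t i" by (auto simp: pending_def)
      then show ?thesis by (intro UnI2 UN_I[of i]) auto
    qed (use P[OF t] that in auto)
    then show "?A \<union> (\<Union>x\<in>P t. {(dG (fst x), G x)}) \<subseteq> J \<union> (\<Union>i\<in>{..<k}. coord_sys i (t i) \<union> (\<lambda>l. (dG i, G (i, l))) ` {..<t i})"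
      by auto
  qed
qed simp

definition leaves :: "((nat \<Rightarrow> nat) \<times> (nat \<times> nat \<Rightarrow> nat \<times> nat)) set" where
  "leaves = (SIGMA t:PiE {..<k} (\<lambda>i. {..n i}). {c \<in> PiE (pending t) factors. valid t c})"

lemma finite_leaf_choices: "finite P \<Longrightarrow> finite (PiE P factors)"
  by (intro finite_PiE finite_factors)

lemma finite_leaf_t: "finite (PiE {..<k} (\<lambda>i. {..n i}))"
  by (intro finite_PiE) auto

lemma card_leaves: "card leaves = (\<Sum>t\<in>PiE {..<k} (\<lambda>i. {..n i}). \<Sum>c\<in>PiE (pending t) factors. if valid t c then 1 else 0)"
proof -
  have fin: "finite (PiE (pending t) factors)" for t
    by (rule finite_leaf_choices[OF finite_pending])
  have "card {c \<in> PiE (pending t) factors. valid t c} =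
      (\<Sum>c\<in>PiE (pending t) factors. if valid t c then 1 else 0)" for t
    unfolding card_eq_sum using fin by (rule sum.inter_filter)
  then show ?thesis
    unfolding leaves_def using finite_leaf_t fin by (subst card_SigmaI) simp_all
qed

lemma corank_le_special: "corank_le (\<Union>i<k. special_sys i) (card leaves)"
proof -
  have "corank_le ({} \<union> (\<Union>i<k. special_sys i))
    (\<Sum>t\<in>PiE {..<k} (\<lambda>i. {..n i}). \<Sum>c\<in>PiE (pending t) factors. if valid t c then 1 else 0)"
  proof (rule corank_le_special_gen)
    fix t c assume t: "t \<in> PiE {..<k} (\<lambda>i. {..n i})" and c: "c \<in> PiE (pending t) factors"
    show "corank_le (label_sys (leaf_labels t (pending t) c)) (if valid t c then 1 else 0)"
    proof (cases "valid t c")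
      case True
      have "corank_le (label_sys (leaf_labels t (pending t) c)) 1"
      proof (rule corank_le_point)
        show "n j \<le> label_count (leaf_labels t (pending t) c) j" if "j < k" for j
          using that t True by (simp add: leaf_label_count[OF finite_pending c] valid_def PiE_iff)
        show "(j, Inl 0) \<notin> leaf_labels t (pending t) c" for j
          by (auto simp: leaf_labels_def factor_label_def)
      qed (intro leaf_labels finite_pending c)+
      with True show ?thesis by simp
    next
      case False
      then show ?thesis
        using corank_le_leaf[OF finite_pending c, of t] t by (auto simp: valid_def card_pending PiE_iff)
    qed
  qed (auto simp: finite_pending)
  then show ?thesis by (simp add: card_leaves)
qed

text \<open>In the case t, the pending pairs leave G at (i, t_i) unconstrained. Its vanishing adds
  one more linear form, for a total of \<Sum> t_i + 1, so that every choice is overfull.\<close>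

lemma corank_le_special_base:
  assumes "i < k"
  shows "corank_le ((\<lambda>l. (dG i, G (i, l))) ` {..n i} \<union> (\<Union>i<k. special_sys i)) 0"
proof -
  have "corank_le ((\<lambda>l. (dG i, G (i, l))) ` {..n i} \<union> (\<Union>i<k. special_sys i))
    (\<Sum>t\<in>PiE {..<k} (\<lambda>i. {..n i}). \<Sum>c\<in>PiE (insert (i, t i) (pending t)) factors. 0)"
  proof (rule corank_le_special_gen)
    fix t c assume t: "t \<in> PiE {..<k} (\<lambda>i. {..n i})" and c: "c \<in> PiE (insert (i, t i) (pending t)) factors"
    let ?P = "insert (i, t i) (pending t)"
    have P: "finite ?P" by (simp add: finite_pending)
    have card: "card ?P = Suc (\<Sum>i<k. t i)"
    proof -
      have "(i, t i) \<notin> pending t" by (simp add: pending_def)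
      then show ?thesis by (simp add: finite_pending card_pending)
    qed
    show "corank_le (label_sys (leaf_labels t ?P c)) 0"
    proof (rule corank_le_leaf[OF P c])
      show "\<exists>j<k. card {x \<in> ?P. fst (c x) = j} \<noteq> t j"
      proof (rule ccontr)
        assume "\<not> ?thesis"
        then have "(\<Sum>j<k. card {x \<in> ?P. fst (c x) = j}) = (\<Sum>j<k. t j)" by (intro sum.cong) auto
        with sum_fibres[OF P c] card show False by simp
      qed
    qed (use t card in \<open>auto simp: PiE_iff\<close>)
  qed (use assms finite_pending in \<open>auto simp: PiE_iff\<close>)
  then show ?thesis by simp
qed

end

section \<open>Systems depending polynomially on parameters\<close>

interpretation mpvs: vector_space "\<lambda>c (P :: ('v, complex) mpoly). cst c * P"
  by unfold_locales (auto simp: algebra_simps single_add mult_single simp flip: mult.assoc)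

interpretation mpvs_pair: vector_space_pair "\<lambda>c (P :: ('v, complex) mpoly). cst c * P" "\<lambda>c x. (c :: complex) * x"
  by unfold_locales (auto simp: algebra_simps)

text \<open>If P were outside the span, it could be added to a basis of the span and a functional
  defined to be 1 on P and 0 on that basis.\<close>

lemma in_span_if_functionals_vanish:
  fixes P :: "('v, complex) mpoly"
  assumes "\<And>\<phi>. clin \<phi> \<Longrightarrow> (\<And>b. b \<in> S \<Longrightarrow> \<phi> b = 0) \<Longrightarrow> \<phi> P = 0"
  shows "P \<in> mpvs.span S"
proof (rule ccontr)
  assume nP: "P \<notin> mpvs.span S"
  obtain B where B: "B \<subseteq> S" "mpvs.independent B" "S \<subseteq> mpvs.span B"
    using mpvs.maximal_independent_subset by blast
  have nB: "P \<notin> mpvs.span B" using nP mpvs.span_mono[OF B(1)] by blast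
  then have "mpvs.independent (insert P B)" using B by (simp add: mpvs.independent_insertI)
  then obtain g where g: "Vector_Spaces.linear (\<lambda>c P. cst c * P) (\<lambda>c x. c * x) g"
    "\<forall>x\<in>insert P B. g x = (if x = P then 1 else 0)"
    using mpvs_pair.linear_independent_extend[of "insert P B" "\<lambda>x. if x = P then 1 else 0"] by blast
  interpret g: Vector_Spaces.linear "\<lambda>c P. cst c * P" "\<lambda>c x. c * x" g by (rule g(1))
  have clin: "clin g" by (simp add: clin_def g.add g.scale)
  have zS: "g b = 0" if "b \<in> S" for b
  proof -
    have "P \<notin> B" using nB mpvs.span_base by blast
    then have zero: "\<forall>x\<in>B. g x = 0" using g(2) by auto
    have "b \<in> mpvs.span B" using that B(3) by blast
    then show ?thesis
      using mpvs_pair.linear_eq_0_on_span[OF g(1), of B b] zero by blast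
  qed
  have "g P = 0" by (rule assms[OF clin]) (rule zS)
  with g(2) show False by simp
qed

lemma span_image_explicit:
  fixes f :: "'i \<Rightarrow> ('v, complex) mpoly"
  assumes "finite A" "P \<in> mpvs.span (f ` A)"
  obtains u where "P = (\<Sum>i\<in>A. cst (u i) * f i)"
proof -
  define T where "T = {\<Sum>i\<in>A. cst (u i) * f i | u. True}"
  have "mpvs.subspace T"
  proof (rule mpvs.subspaceI)
    show "0 \<in> T" unfolding T_def by (intro CollectI exI[of _ "\<lambda>_. 0"]) simp
  next
    fix x y assume "x \<in> T" "y \<in> T"
    then obtain u w where "x = (\<Sum>i\<in>A. cst (u i) * f i)" "y = (\<Sum>i\<in>A. cst (w i) * f i)"
      by (auto simp: T_def)
    then have "x + y = (\<Sum>i\<in>A. cst (u i + w i) * f i)"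
      by (simp add: single_add algebra_simps sum.distrib)
    then show "x + y \<in> T" unfolding T_def by (intro CollectI exI conjI) auto
  next
    fix c x assume "x \<in> T"
    then obtain u where "x = (\<Sum>i\<in>A. cst (u i) * f i)" by (auto simp: T_def)
    then have "cst c * x = (\<Sum>i\<in>A. cst (c * u i) * f i)"
      by (simp add: sum_distrib_left mult_single mult.assoc[symmetric])
    then show "cst c * x \<in> T" unfolding T_def by (intro CollectI exI conjI) auto
  qed
  moreover have "f ` A \<subseteq> T"
  proof safe
    fix i assume i: "i \<in> A"
    have "(\<Sum>j\<in>A. cst (if j = i then 1 else 0) * f j) = (\<Sum>j\<in>A. if j = i then f i else 0)"
      by (intro sum.cong) auto
    then have "f i = (\<Sum>j\<in>A. cst (if j = i then 1 else 0) * f j)" using i assms(1) by simp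
    then show "f i \<in> T" unfolding T_def by (intro CollectI exI conjI) auto
  qed
  ultimately have "P \<in> T" using assms(2) mpvs.span_minimal by blast
  with that show ?thesis by (auto simp: T_def)
qed

text \<open>Here g is the determinant and K' the adjugate, over any commutative ring and for any
  finite index set. The last clause says that g survives a specialization which makes the matrix
  injective; this is how all open conditions on the corank arise.\<close>

lemma adjugate:
  fixes K :: "'m \<Rightarrow> 'm \<Rightarrow> 'r::comm_ring_1"
  assumes "finite M"
  shows "\<exists>g K'.
    (\<forall>\<mu>\<in>M. \<forall>\<nu>\<in>M. (\<Sum>\<rho>\<in>M. K' \<mu> \<rho> * K \<rho> \<nu>) = (if \<mu> = \<nu> then g else 0)) \<and>
    (\<forall>\<mu>\<in>M. \<forall>\<nu>\<in>M. (\<Sum>\<rho>\<in>M. K \<mu> \<rho> * K' \<rho> \<nu>) = (if \<mu> = \<nu> then g else 0)) \<and>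
    (\<forall>\<eta> :: 'r \<Rightarrow> complex. comm_ring_hom \<eta> \<longrightarrow>
       (\<forall>v. (\<forall>\<mu>\<in>M. (\<Sum>\<nu>\<in>M. \<eta> (K \<mu> \<nu>) * v \<nu>) = 0) \<longrightarrow> (\<forall>\<nu>\<in>M. v \<nu> = 0)) \<longrightarrow> \<eta> g \<noteq> 0)"
proof -
  define m where "m = card M"
  obtain e where e: "bij_betw e {..<m} M"
    using ex_bij_betw_nat_finite[OF assms] by (metis atLeast0LessThan m_def)
  define ie where "ie = inv_into {..<m} e"
  have ie: "ie \<mu> < m" "e (ie \<mu>) = \<mu>" if "\<mu> \<in> M" for \<mu>
    using bij_betw_inv_into_right[OF e that] bij_betwE[OF bij_betw_inv_into[OF e]] that
    by (auto simp: ie_def)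
  have ei: "ie (e i) = i" if "i < m" for i
    using bij_betw_inv_into_left[OF e] that by (simp add: ie_def)
  define A where "A = mat m m (\<lambda>(i, j). K (e i) (e j))"
  have A: "A \<in> carrier_mat m m" by (simp add: A_def)
  define K' where "K' \<mu> \<nu> = adj_mat A $$ (ie \<mu>, ie \<nu>)" for \<mu> \<nu>
  note adj = adj_mat[OF A]
  have sum_e: "(\<Sum>\<rho>\<in>M. f \<rho>) = (\<Sum>i<m. f (e i))" for f :: "'m \<Rightarrow> 'z::comm_monoid_add"
    by (rule sum.reindex_bij_betw[OF e, symmetric])
  show ?thesis
  proof (intro exI[of _ "det A"] exI[of _ K'] conjI ballI allI impI)
    fix \<mu> \<nu> assume M: "\<mu> \<in> M" "\<nu> \<in> M"
    have eq: "\<mu> = \<nu> \<longleftrightarrow> ie \<mu> = ie \<nu>" using ie M by metis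
    have "(\<Sum>\<rho>\<in>M. K' \<mu> \<rho> * K \<rho> \<nu>) = (adj_mat A * A) $$ (ie \<mu>, ie \<nu>)"
      using ie(1)[OF M(1)] ie(1)[OF M(2)] adj(1) A unfolding sum_e
      by (simp add: scalar_prod_def atLeast0LessThan K'_def ei)
        (intro sum.cong refl, simp add: A_def ie M)
    then show "(\<Sum>\<rho>\<in>M. K' \<mu> \<rho> * K \<rho> \<nu>) = (if \<mu> = \<nu> then det A else 0)"
      using ie(1)[OF M(1)] ie(1)[OF M(2)] by (simp add: adj eq)
  next
    fix \<mu> \<nu> assume M: "\<mu> \<in> M" "\<nu> \<in> M"
    have eq: "\<mu> = \<nu> \<longleftrightarrow> ie \<mu> = ie \<nu>" using ie M by metis
    have "(\<Sum>\<rho>\<in>M. K \<mu> \<rho> * K' \<rho> \<nu>) = (A * adj_mat A) $$ (ie \<mu>, ie \<nu>)"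
      using ie(1)[OF M(1)] ie(1)[OF M(2)] adj(1) A unfolding sum_e
      by (simp add: scalar_prod_def atLeast0LessThan K'_def ei)
        (intro sum.cong refl, simp add: A_def ie M)
    then show "(\<Sum>\<rho>\<in>M. K \<mu> \<rho> * K' \<rho> \<nu>) = (if \<mu> = \<nu> then det A else 0)"
      using ie(1)[OF M(1)] ie(1)[OF M(2)] by (simp add: adj eq)
  next
    fix \<eta> :: "'r \<Rightarrow> complex"
    assume \<eta>: "comm_ring_hom \<eta>"
      and ker: "\<forall>v. (\<forall>\<mu>\<in>M. (\<Sum>\<nu>\<in>M. \<eta> (K \<mu> \<nu>) * v \<nu>) = 0) \<longrightarrow> (\<forall>\<nu>\<in>M. v \<nu> = 0)"
    interpret comm_ring_hom \<eta> by (rule \<eta>)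
    show "\<eta> (det A) \<noteq> 0"
    proof
      assume "\<eta> (det A) = 0"
      then have "det (map_mat \<eta> A) = 0" by simp
      moreover have mA: "map_mat \<eta> A \<in> carrier_mat m m" using A by simp
      ultimately obtain v where v: "v \<in> carrier_vec m" "v \<noteq> 0\<^sub>v m" "map_mat \<eta> A *\<^sub>v v = 0\<^sub>v m"
        using det_0_iff_vec_prod_zero[OF mA] by blast
      have "v $ ie \<nu> = 0" if "\<nu> \<in> M" for \<nu>
      proof (rule ker[THEN spec, THEN mp, THEN bspec, of "\<lambda>\<nu>. v $ ie \<nu>", OF ballI that])
        fix \<mu> assume \<mu>: "\<mu> \<in> M"
        have "(map_mat \<eta> A *\<^sub>v v) $ ie \<mu> = (\<Sum>\<nu>\<in>M. \<eta> (K \<mu> \<nu>) * v $ ie \<nu>)"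
          using ie[OF \<mu>] v(1) A unfolding sum_e
          by (simp add: scalar_prod_def atLeast0LessThan ei) (intro sum.cong refl, simp add: A_def)
        with v(3) ie[OF \<mu>] show "(\<Sum>\<nu>\<in>M. \<eta> (K \<mu> \<nu>) * v $ ie \<nu>) = 0" by simp
      qed
      then have "v $ i = 0" if "i < m" for i
        using ei[OF that] bij_betwE[OF e] that by (metis lessThan_iff)
      then have "v = 0\<^sub>v m" using v(1) by (intro eq_vecI) auto
      with v(2) show False by simp
    qed
  qed
qed

text \<open>The value of a parameter polynomial along the line from \<open>\<theta>0\<close> to \<open>\<theta>\<close>, as a power series.\<close>

definition line_eval :: "('p \<Rightarrow> complex) \<Rightarrow> ('p \<Rightarrow> complex) \<Rightarrow> ('p, complex) mpoly \<Rightarrow> complex fps" where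
  "line_eval \<theta>0 \<theta> Q = fps_of_poly (hom_eval (\<lambda>c. [:c:]) (\<lambda>p. [:\<theta>0 p, \<theta> p - \<theta>0 p:]) Q)"

lemma comm_ring_hom_const_poly: "comm_ring_hom (\<lambda>c :: complex. [:c:])"
  by unfold_locales (auto simp: pCons_one)

lemma comm_ring_hom_line_eval: "comm_ring_hom (line_eval \<theta>0 \<theta>)"
proof -
  have "comm_ring_hom (hom_eval (\<lambda>c. [:c:]) (\<lambda>p. [:\<theta>0 p, \<theta> p - \<theta>0 p:] :: complex poly))"
    by (rule comm_ring_hom.comm_ring_hom_hom_eval[OF comm_ring_hom_const_poly])
  then interpret h: comm_ring_hom "hom_eval (\<lambda>c. [:c:]) (\<lambda>p. [:\<theta>0 p, \<theta> p - \<theta>0 p:] :: complex poly)" .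
  show ?thesis
    by unfold_locales (simp_all add: line_eval_def h.hom_add h.hom_mult fps_of_poly_add fps_of_poly_mult)
qed

lemma line_eval_cst: "line_eval \<theta>0 \<theta> (cst c) = fps_const c"
  by (simp add: line_eval_def comm_ring_hom.hom_eval_single[OF comm_ring_hom_const_poly] fps_of_poly_const)

text \<open>A power series cannot be evaluated at 1, but this one is a polynomial on the line, and
  its value there is the value of \<open>Q\<close> at \<theta>.\<close>

lemma line_eval_0:
  assumes "line_eval \<theta>0 \<theta> Q = 0"
  shows "mpoly_eval \<theta> Q = 0"
proof -
  let ?x = "\<lambda>p. [:\<theta>0 p, \<theta> p - \<theta>0 p:]"
  have "hom_eval (\<lambda>c. [:c:]) ?x Q = 0"
    using assms fps_of_poly_eq_iff[of "hom_eval (\<lambda>c. [:c:]) ?x Q" 0] by (simp add: line_eval_def)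
  moreover have "poly (hom_eval (\<lambda>c. [:c:]) ?x Q) 1 = mpoly_eval \<theta> Q"
    by (simp add: hom_eval_def mpoly_eval_alt mon_eval_def poly_sum poly_prod)
  ultimately show ?thesis by simp
qed

lemma line_eval_nth_0: "fps_nth (line_eval \<theta>0 \<theta> Q) 0 = mpoly_eval \<theta>0 Q"
proof -
  have "fps_nth (line_eval \<theta>0 \<theta> Q) 0 = poly (hom_eval (\<lambda>c. [:c:]) (\<lambda>p. [:\<theta>0 p, \<theta> p - \<theta>0 p:]) Q) 0"
    by (simp add: line_eval_def poly_0_coeff_0)
  also have "\<dots> = mpoly_eval \<theta>0 Q"
    by (simp add: hom_eval_def mpoly_eval_alt mon_eval_def poly_sum poly_prod)
  finally show ?thesis .
qed

lemma comm_ring_hom_fps_nth_0: "comm_ring_hom (\<lambda>f :: complex fps. fps_nth f 0)"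
  by unfold_locales auto

lemma comm_ring_hom_fps_const: "comm_ring_hom (fps_const :: complex \<Rightarrow> complex fps)"
  by unfold_locales (auto simp: fps_const_add[symmetric] fps_const_mult[symmetric] simp del: fps_const_add fps_const_mult)

lemma lookup_cst_mult: "lookup (cst c * P) \<nu> = c * lookup P \<nu>"
  by (simp add: mult_map_scale_conv_mult[symmetric] Poly_Mapping.map.rep_eq when_def)

lemma hom_cst_delta:
  assumes "comm_ring_hom \<eta>"
  shows "\<eta> (if b then x else 0) = (if b then \<eta> x else 0)"
proof -
  interpret comm_ring_hom \<eta> by fact
  show ?thesis by simp
qed

section \<open>Macaulay matrices over the parameter ring\<close>

locale param_system = multigrading k n for k n +
  fixes I :: "'e set" and dg :: "'e \<Rightarrow> nat \<Rightarrow> nat"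
    and Ec :: "'e \<Rightarrow> (nat \<times> nat \<Rightarrow>\<^sub>0 nat) \<Rightarrow> ('p, complex) mpoly"
  assumes finite_I: "finite I"
begin

definition Eqn :: "('p \<Rightarrow> complex) \<Rightarrow> 'e \<Rightarrow> (nat \<times> nat, complex) mpoly" where
  "Eqn \<theta> e = (\<Sum>\<kappa>\<in>Mon (dg e). single \<kappa> (mpoly_eval \<theta> (Ec e \<kappa>)))"

definition sys :: "('p \<Rightarrow> complex) \<Rightarrow> ((nat \<Rightarrow> nat) \<times> (nat \<times> nat, complex) mpoly) set" where
  "sys \<theta> = (\<lambda>e. (dg e, Eqn \<theta> e)) ` I"

definition mult_rows :: "(nat \<Rightarrow> nat) \<Rightarrow> ('e \<times> (nat \<times> nat \<Rightarrow>\<^sub>0 nat)) set" where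
  "mult_rows D = (SIGMA e:I. Mon (\<lambda>i. D i - dg e i))"

text \<open>The Macaulay matrix of the system in degree D: its rows are the monomial multiples of
  the equations, its columns the monomials of degree D, its entries polynomials in the
  parameters.\<close>

definition row_coeff :: "'e \<times> (nat \<times> nat \<Rightarrow>\<^sub>0 nat) \<Rightarrow> (nat \<times> nat \<Rightarrow>\<^sub>0 nat) \<Rightarrow> ('p, complex) mpoly" where
  "row_coeff = (\<lambda>(e, m) \<nu>. \<Sum>\<kappa>\<in>Mon (dg e). if \<kappa> + m = \<nu> then Ec e \<kappa> else 0)"

text \<open>This guards the truncated subtraction in \<open>mult_rows\<close>.\<close>

definition fits :: "(nat \<Rightarrow> nat) \<Rightarrow> bool" where
  "fits D \<longleftrightarrow> (\<forall>e\<in>I. \<forall>i<k. dg e i \<le> D i)"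

lemma finite_mult_rows: "finite (mult_rows D)"
  unfolding mult_rows_def using finite_I by (auto intro: finite_Mon)

lemma Eqn_in_Forms: "Eqn \<theta> e \<in> Forms (dg e)"
  unfolding Eqn_def by (intro Forms_sum Forms_single)

lemma Eqn_mult_single: "Eqn \<theta> e * single m 1 = (\<Sum>\<kappa>\<in>Mon (dg e). single (\<kappa> + m) (mpoly_eval \<theta> (Ec e \<kappa>)))"
  by (simp add: Eqn_def sum_distrib_right mult_single)

lemma mpoly_eval_Eqn: "mpoly_eval x (Eqn \<theta> e) = (\<Sum>\<kappa>\<in>Mon (dg e). mpoly_eval \<theta> (Ec e \<kappa>) * mon_eval x \<kappa>)"
  by (simp add: Eqn_def mpe.hom_sum mpoly_eval_single)

lemma clin_Eqn_mult:
  assumes "clin \<phi>"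
  shows "\<phi> (Eqn \<theta> e * single m 1) = (\<Sum>\<kappa>\<in>Mon (dg e). mpoly_eval \<theta> (Ec e \<kappa>) * \<phi> (single (\<kappa> + m) 1))"
proof -
  have "\<phi> (single \<mu> c) = c * \<phi> (single \<mu> 1)" for \<mu> c
    using clin_scale[OF assms, of c "single \<mu> 1"] by (simp add: mult_single)
  then show ?thesis
    unfolding Eqn_mult_single clin_sum[OF assms] by (intro sum.cong refl)
qed

lemma annihilates_rows:
  assumes D: "fits D" and \<phi>: "clin \<phi>"
  shows "annihilates \<phi> (sys \<theta>) D \<longleftrightarrow> (\<forall>(e, m)\<in>mult_rows D. \<phi> (Eqn \<theta> e * single m 1) = 0)"
proof
  assume ann: "annihilates \<phi> (sys \<theta>) D"
  show "\<forall>(e, m)\<in>mult_rows D. \<phi> (Eqn \<theta> e * single m 1) = 0"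
  proof clarify
    fix e m assume "(e, m) \<in> mult_rows D"
    then have em: "e \<in> I" "m \<in> Mon (\<lambda>i. D i - dg e i)" by (auto simp: mult_rows_def)
    show "\<phi> (Eqn \<theta> e * single m 1) = 0"
      by (rule annihilatesD[OF ann _ _ Forms_single[OF em(2)], of "dg e"])
        (use em D in \<open>auto simp: sys_def fits_def\<close>)
  qed
next
  assume rows: "\<forall>(e, m)\<in>mult_rows D. \<phi> (Eqn \<theta> e * single m 1) = 0"
  show "annihilates \<phi> (sys \<theta>) D"
    unfolding annihilates_def
  proof clarify
    fix g E D' and P :: "(nat \<times> nat, complex) mpoly"
    assume gE: "(g, E) \<in> sys \<theta>" and D': "\<forall>i<k. g i + D' i = D i" and P: "P \<in> Forms D'"
    from gE obtain e where e: "e \<in> I" "g = dg e" "E = Eqn \<theta> e" by (auto simp: sys_def)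
    have "P \<in> Forms (\<lambda>i. D i - dg e i)"
      using P Forms_cong[of D' "\<lambda>i. D i - dg e i"] D' e by (metis add_diff_cancel_left')
    from clin_zero_on_Forms[where \<phi> = "\<lambda>P. \<phi> (E * P)", OF clin_mult_left[OF \<phi>] _ this]
    show "\<phi> (E * P) = 0" using rows e by (auto simp: mult_rows_def)
  qed
qed

lemma sum_row_coeff:
  assumes \<eta>: "comm_ring_hom \<eta>" and D: "fits D" and e: "e \<in> I" and m: "m \<in> Mon (\<lambda>i. D i - dg e i)"
  shows "(\<Sum>\<nu>\<in>Mon D. \<eta> (row_coeff (e, m) \<nu>) * f \<nu>) = (\<Sum>\<kappa>\<in>Mon (dg e). \<eta> (Ec e \<kappa>) * f (\<kappa> + m))"
proof -
  interpret comm_ring_hom \<eta> by fact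
  have km: "\<kappa> + m \<in> Mon D" if "\<kappa> \<in> Mon (dg e)" for \<kappa>
    using Mon_add[OF that m] Mon_cong[of "\<lambda>i. dg e i + (D i - dg e i)" D] D e by (simp add: fits_def)
  have "(\<Sum>\<nu>\<in>Mon D. \<eta> (row_coeff (e, m) \<nu>) * f \<nu>) =
      (\<Sum>\<nu>\<in>Mon D. \<Sum>\<kappa>\<in>Mon (dg e). if \<nu> = \<kappa> + m then \<eta> (Ec e \<kappa>) * f \<nu> else 0)"
    unfolding row_coeff_def prod.case hom_sum sum_distrib_right hom_cst_delta[OF \<eta>]
    by (intro sum.cong refl) auto
  also have "\<dots> = (\<Sum>\<kappa>\<in>Mon (dg e). \<Sum>\<nu>\<in>Mon D. if \<nu> = \<kappa> + m then \<eta> (Ec e \<kappa>) * f \<nu> else 0)"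
    by (rule sum.swap)
  also have "\<dots> = (\<Sum>\<kappa>\<in>Mon (dg e). \<eta> (Ec e \<kappa>) * f (\<kappa> + m))"
    by (intro sum.cong refl) (simp add: sum.delta[OF finite_Mon] km)
  finally show ?thesis .
qed

text \<open>Up to the factor \<open>g\<close>, every monomial of degree \<open>D\<close> is a combination of the rows of the system and of \<open>bD\<close>,
  with coefficients polynomial in the parameters.\<close>

definition solves_identity where
  "solves_identity D N bD g U \<Phi> \<longleftrightarrow> (\<forall>\<nu>\<in>Mon D. \<forall>\<nu>'\<in>Mon D.
     (\<Sum>\<rho>\<in>mult_rows D. U \<nu> \<rho> * row_coeff \<rho> \<nu>') + (\<Sum>c<N. \<Phi> \<nu> c * cst (lookup (bD c) \<nu>')) =
     (if \<nu> = \<nu>' then g else 0))"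

text \<open>At \<theta>0 each monomial is a combination of the rows and \<open>bD\<close> with
  complex coefficients \<open>u\<close>. The same constants applied to the polynomial rows give a
  matrix \<open>K\<close> that is the identity at \<theta>0; its adjugate turns it into g times the
  identity, and g does not vanish at \<theta>0.\<close>

lemma solves_identity_exists:
  fixes \<theta>0 :: "'p \<Rightarrow> complex" and bD :: "nat \<Rightarrow> (nat \<times> nat, complex) mpoly"
  assumes D: "fits D"
    and sp: "\<And>\<phi> P. clin \<phi> \<Longrightarrow> annihilates \<phi> (sys \<theta>0) D \<Longrightarrow> (\<And>c. c < N \<Longrightarrow> \<phi> (bD c) = 0) \<Longrightarrow> P \<in> Forms D \<Longrightarrow> \<phi> P = 0"
  obtains g U \<Phi> where "mpoly_eval \<theta>0 g \<noteq> 0" "solves_identity D N bD g U \<Phi>"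
proof -
  define A where "A = mult_rows D <+> {..<N}"
  have finA: "finite A" by (simp add: A_def finite_mult_rows)
  define row where "row \<rho> = (case \<rho> of Inl (e, m) \<Rightarrow> Eqn \<theta>0 e * single m 1 | Inr c \<Rightarrow> bD c)" for \<rho>
  define rowP where "rowP \<rho> \<nu> = (case \<rho> of Inl em \<Rightarrow> row_coeff em \<nu> | Inr c \<Rightarrow> cst (lookup (bD c) \<nu>))" for \<rho> \<nu>
  have eval_rowP: "mpoly_eval \<theta>0 (rowP \<rho> \<nu>) = lookup (row \<rho>) \<nu>" for \<rho> \<nu>
  proof (cases \<rho>)
    case (Inl em)
    obtain e m where em: "em = (e, m)" by (cases em)
    show ?thesis
      unfolding rowP_def row_def Inl em sum.case prod.case Eqn_mult_single row_coeff_def mpe.hom_sum lookup_sum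
      by (intro sum.cong refl) (auto simp: lookup_single when_def)
  qed (simp add: rowP_def row_def)
  have "\<exists>u. single \<mu> 1 = (\<Sum>\<rho>\<in>A. cst (u \<rho>) * row \<rho>)" if \<mu>: "\<mu> \<in> Mon D" for \<mu>
  proof -
    have "single \<mu> 1 \<in> mpvs.span (row ` A)"
    proof (rule in_span_if_functionals_vanish)
      fix \<phi> :: "(nat \<times> nat, complex) mpoly \<Rightarrow> complex"
      assume \<phi>: "clin \<phi>" and zero: "\<And>b. b \<in> row ` A \<Longrightarrow> \<phi> b = 0"
      have zA: "\<phi> (row \<rho>) = 0" if "\<rho> \<in> A" for \<rho> using zero that by blast
      have "annihilates \<phi> (sys \<theta>0) D"
        unfolding annihilates_rows[OF D \<phi>]
      proof clarify
        fix e m assume "(e, m) \<in> mult_rows D"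
        then have "Inl (e, m) \<in> A" by (auto simp: A_def)
        from zA[OF this] show "\<phi> (Eqn \<theta>0 e * single m 1) = 0" by (simp add: row_def)
      qed
      moreover have "\<phi> (bD c) = 0" if "c < N" for c
        using zA[of "Inr c"] that by (auto simp: A_def row_def)
      ultimately show "\<phi> (single \<mu> 1) = 0"
        by (rule sp[OF \<phi> _ _ Forms_single[OF \<mu>]])
    qed
    then obtain u where "single \<mu> 1 = (\<Sum>\<rho>\<in>A. cst (u \<rho>) * row \<rho>)"
      by (rule span_image_explicit[OF finA])
    then show ?thesis by blast
  qed
  then have "\<forall>\<mu>\<in>Mon D. \<exists>u. single \<mu> 1 = (\<Sum>\<rho>\<in>A. cst (u \<rho>) * row \<rho>)" by blast
  from bchoice[OF this] obtain u where
    u: "\<And>\<mu>. \<mu> \<in> Mon D \<Longrightarrow> single \<mu> 1 = (\<Sum>\<rho>\<in>A. cst (u \<mu> \<rho>) * row \<rho>)"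
    by blast
  define K where "K \<mu> \<nu> = (\<Sum>\<rho>\<in>A. cst (u \<mu> \<rho>) * rowP \<rho> \<nu>)" for \<mu> \<nu>
  have evalK: "mpoly_eval \<theta>0 (K \<mu> \<nu>) = (if \<mu> = \<nu> then 1 else 0)" if "\<mu> \<in> Mon D" for \<mu> \<nu>
  proof -
    have "mpoly_eval \<theta>0 (K \<mu> \<nu>) = lookup (\<Sum>\<rho>\<in>A. cst (u \<mu> \<rho>) * row \<rho>) \<nu>"
      by (simp add: K_def mpe.hom_sum mpe.hom_mult eval_rowP lookup_sum lookup_cst_mult)
    also have "\<dots> = lookup (single \<mu> 1) \<nu>" by (simp only: u[OF that])
    finally show ?thesis by (simp add: lookup_single when_def)
  qed
  obtain g K' where gK:
    "\<forall>\<mu>\<in>Mon D. \<forall>\<nu>\<in>Mon D. (\<Sum>\<rho>\<in>Mon D. K' \<mu> \<rho> * K \<rho> \<nu>) = (if \<mu> = \<nu> then g else 0)"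
    "\<forall>\<eta> :: ('p, complex) mpoly \<Rightarrow> complex. comm_ring_hom \<eta> \<longrightarrow>
       (\<forall>v. (\<forall>\<mu>\<in>Mon D. (\<Sum>\<nu>\<in>Mon D. \<eta> (K \<mu> \<nu>) * v \<nu>) = 0) \<longrightarrow> (\<forall>\<nu>\<in>Mon D. v \<nu> = 0)) \<longrightarrow> \<eta> g \<noteq> 0"
    using adjugate[OF finite_Mon[of D], of K] by blast
  define V where "V \<nu> \<rho> = (\<Sum>\<mu>\<in>Mon D. K' \<nu> \<mu> * cst (u \<mu> \<rho>))" for \<nu> \<rho>
  show ?thesis
  proof (rule that[of g "\<lambda>\<nu> em. V \<nu> (Inl em)" "\<lambda>\<nu> c. V \<nu> (Inr c)"])
    show "mpoly_eval \<theta>0 g \<noteq> 0"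
    proof (rule gK(2)[THEN spec, THEN mp, THEN mp, OF mpe.comm_ring_hom_axioms], intro allI impI ballI)
      fix v \<nu> assume ker: "\<forall>\<mu>\<in>Mon D. (\<Sum>\<nu>\<in>Mon D. mpoly_eval \<theta>0 (K \<mu> \<nu>) * v \<nu>) = 0"
        and \<nu>: "\<nu> \<in> Mon D"
      have "(\<Sum>\<nu>'\<in>Mon D. mpoly_eval \<theta>0 (K \<nu> \<nu>') * v \<nu>') = (\<Sum>\<nu>'\<in>Mon D. if \<nu>' = \<nu> then v \<nu> else 0)"
        by (intro sum.cong refl) (auto simp: evalK[OF \<nu>])
      then show "v \<nu> = 0" using bspec[OF ker \<nu>] \<nu> finite_Mon by simp
    qed
    show "solves_identity D N bD g (\<lambda>\<nu> em. V \<nu> (Inl em)) (\<lambda>\<nu> c. V \<nu> (Inr c))"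
      unfolding solves_identity_def
    proof (intro ballI)
      fix \<nu> \<nu>' assume \<nu>: "\<nu> \<in> Mon D" "\<nu>' \<in> Mon D"
      have "(\<Sum>\<rho>\<in>mult_rows D. V \<nu> (Inl \<rho>) * row_coeff \<rho> \<nu>') + (\<Sum>c<N. V \<nu> (Inr c) * cst (lookup (bD c) \<nu>'))
        = (\<Sum>\<rho>\<in>A. V \<nu> \<rho> * rowP \<rho> \<nu>')"
        unfolding A_def by (subst sum.Plus) (auto simp: finite_mult_rows rowP_def)
      also have "\<dots> = (\<Sum>\<rho>\<in>A. \<Sum>\<mu>\<in>Mon D. K' \<nu> \<mu> * (cst (u \<mu> \<rho>) * rowP \<rho> \<nu>'))"
        by (simp add: V_def sum_distrib_right mult.assoc)
      also have "\<dots> = (\<Sum>\<mu>\<in>Mon D. K' \<nu> \<mu> * K \<mu> \<nu>')"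
        unfolding K_def sum_distrib_left by (rule sum.swap)
      also have "\<dots> = (if \<nu> = \<nu>' then g else 0)" by (rule gK(1)[THEN bspec, THEN bspec, OF \<nu>])
      finally show "(\<Sum>\<rho>\<in>mult_rows D. V \<nu> (Inl \<rho>) * row_coeff \<rho> \<nu>') + (\<Sum>c<N. V \<nu> (Inr c) * cst (lookup (bD c) \<nu>'))
        = (if \<nu> = \<nu>' then g else 0)" .
    qed
  qed
qed

text \<open>A vector killed by all rows is determined, up to the factor g, by its pairing with
  \<open>bD\<close>. The target of \<eta> stays arbitrary because complex functionals and power
  series solutions are both substituted for \<open>f\<close>.\<close>

lemma solves_identity_hom:
  assumes id: "solves_identity D N bD g U \<Phi>" and \<eta>: "comm_ring_hom \<eta>"
    and D: "fits D"
    and f: "\<And>e m. (e, m) \<in> mult_rows D \<Longrightarrow> (\<Sum>\<kappa>\<in>Mon (dg e). \<eta> (Ec e \<kappa>) * f (\<kappa> + m)) = 0"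
    and \<nu>: "\<nu> \<in> Mon D"
  shows "\<eta> g * f \<nu> = (\<Sum>c<N. \<eta> (\<Phi> \<nu> c) * (\<Sum>\<nu>'\<in>Mon D. \<eta> (cst (lookup (bD c) \<nu>')) * f \<nu>'))"
proof -
  interpret comm_ring_hom \<eta> by fact
  have rows: "(\<Sum>\<nu>'\<in>Mon D. \<eta> (row_coeff \<rho> \<nu>') * f \<nu>') = 0" if \<rho>: "\<rho> \<in> mult_rows D" for \<rho>
  proof -
    obtain e m where em: "\<rho> = (e, m)" by (cases \<rho>)
    with \<rho> have "e \<in> I" "m \<in> Mon (\<lambda>i. D i - dg e i)" by (auto simp: mult_rows_def)
    then show ?thesis using sum_row_coeff[OF \<eta> D, of e m f] f \<rho> em by auto
  qed
  have eq: "\<eta> (if \<nu> = \<nu>' then g else 0) = (\<Sum>\<rho>\<in>mult_rows D. \<eta> (U \<nu> \<rho>) * \<eta> (row_coeff \<rho> \<nu>')) +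
      (\<Sum>c<N. \<eta> (\<Phi> \<nu> c) * \<eta> (cst (lookup (bD c) \<nu>')))" if \<nu>': "\<nu>' \<in> Mon D" for \<nu>'
    using arg_cong[OF id[unfolded solves_identity_def, rule_format, OF \<nu> \<nu>'], of \<eta>]
    unfolding hom_add hom_sum hom_mult by (rule sym)
  have "\<eta> g * f \<nu> = (\<Sum>\<nu>'\<in>Mon D. if \<nu>' = \<nu> then \<eta> g * f \<nu> else 0)"
    using \<nu> finite_Mon by simp
  also have "\<dots> = (\<Sum>\<nu>'\<in>Mon D. \<eta> (if \<nu> = \<nu>' then g else 0) * f \<nu>')"
    by (intro sum.cong refl) (auto simp: hom_cst_delta[OF \<eta>])
  also have "\<dots> = (\<Sum>\<nu>'\<in>Mon D. ((\<Sum>\<rho>\<in>mult_rows D. \<eta> (U \<nu> \<rho>) * \<eta> (row_coeff \<rho> \<nu>')) +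
      (\<Sum>c<N. \<eta> (\<Phi> \<nu> c) * \<eta> (cst (lookup (bD c) \<nu>')))) * f \<nu>')"
    by (intro sum.cong refl arg_cong2[where f = times] eq)
  also have "\<dots> = (\<Sum>\<rho>\<in>mult_rows D. \<eta> (U \<nu> \<rho>) * (\<Sum>\<nu>'\<in>Mon D. \<eta> (row_coeff \<rho> \<nu>') * f \<nu>')) +
      (\<Sum>c<N. \<eta> (\<Phi> \<nu> c) * (\<Sum>\<nu>'\<in>Mon D. \<eta> (cst (lookup (bD c) \<nu>')) * f \<nu>'))"
    unfolding distrib_right sum.distrib sum_distrib_left sum_distrib_right
    by (intro arg_cong2[of _ _ _ _ "(+)"]; subst sum.swap; simp add: mult.assoc)
  also have "(\<Sum>\<rho>\<in>mult_rows D. \<eta> (U \<nu> \<rho>) * (\<Sum>\<nu>'\<in>Mon D. \<eta> (row_coeff \<rho> \<nu>') * f \<nu>')) = 0"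
    by (intro sum.neutral ballI) (simp add: rows)
  finally show ?thesis by simp
qed

lemma functional_rep:
  assumes id: "solves_identity D N bD g U \<Phi>" and D: "fits D"
    and bD: "\<forall>c<N. bD c \<in> Forms D"
    and \<phi>: "clin \<phi>" "annihilates \<phi> (sys \<theta>) D" and \<nu>: "\<nu> \<in> Mon D"
  shows "mpoly_eval \<theta> g * \<phi> (single \<nu> 1) = (\<Sum>c<N. mpoly_eval \<theta> (\<Phi> \<nu> c) * \<phi> (bD c))"
proof -
  have "mpoly_eval \<theta> g * \<phi> (single \<nu> 1) = (\<Sum>c<N. mpoly_eval \<theta> (\<Phi> \<nu> c) *
      (\<Sum>\<nu>'\<in>Mon D. mpoly_eval \<theta> (cst (lookup (bD c) \<nu>')) * \<phi> (single \<nu>' 1)))"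
  proof (rule solves_identity_hom[OF id mpe.comm_ring_hom_axioms D _ \<nu>])
    fix e m assume "(e, m) \<in> mult_rows D"
    then show "(\<Sum>\<kappa>\<in>Mon (dg e). mpoly_eval \<theta> (Ec e \<kappa>) * \<phi> (single (\<kappa> + m) 1)) = 0"
      using \<phi>(2) unfolding annihilates_rows[OF D \<phi>(1)] clin_Eqn_mult[OF \<phi>(1), symmetric] by blast
  qed
  also have "\<dots> = (\<Sum>c<N. mpoly_eval \<theta> (\<Phi> \<nu> c) * \<phi> (bD c))"
  proof (intro sum.cong refl arg_cong2[where f = times])
    fix c assume c: "c \<in> {..<N}"
    have "\<phi> (bD c) = (\<Sum>\<nu>'\<in>keys (bD c). lookup (bD c) \<nu>' * \<phi> (single \<nu>' 1))" by (rule clin_expand[OF \<phi>(1)])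
    also have "\<dots> = (\<Sum>\<nu>'\<in>Mon D. mpoly_eval \<theta> (cst (lookup (bD c) \<nu>')) * \<phi> (single \<nu>' 1))"
      using bD c by (intro sum.mono_neutral_cong_left finite_Mon) (auto simp: Forms_def in_keys_iff)
    finally show "(\<Sum>\<nu>'\<in>Mon D. mpoly_eval \<theta> (cst (lookup (bD c) \<nu>')) * \<phi> (single \<nu>' 1)) = \<phi> (bD c)" ..
  qed
  finally show ?thesis .
qed

end

section \<open>Solutions as eigenvectors of multiplication maps\<close>

text \<open>A common root with the derivative is a multiple root. The resultant makes simplicity of
  a spectrum an open condition on the parameters.\<close>

lemma resultant_pderiv_nonzero_iff:
  fixes p :: "complex poly"
  assumes "p \<noteq> 0"
  shows "resultant p (pderiv p) \<noteq> 0 \<longleftrightarrow> card {x. poly p x = 0} = degree p"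
proof -
  have "resultant p (pderiv p) \<noteq> 0 \<longleftrightarrow> degree (gcd p (pderiv p)) = 0"
    by (simp add: resultant_0_gcd)
  also have "\<dots> \<longleftrightarrow> (\<forall>x. \<not> (poly p x = 0 \<and> poly (pderiv p) x = 0))"
  proof
    assume d: "degree (gcd p (pderiv p)) = 0"
    show "\<forall>x. \<not> (poly p x = 0 \<and> poly (pderiv p) x = 0)"
    proof (intro allI notI)
      fix x assume "poly p x = 0 \<and> poly (pderiv p) x = 0"
      then have "[:- x, 1:] dvd gcd p (pderiv p)" by (simp add: poly_eq_0_iff_dvd)
      moreover have "gcd p (pderiv p) \<noteq> 0" using assms by simp
      ultimately have "degree [:- x, 1:] \<le> degree (gcd p (pderiv p))" by (rule dvd_imp_degree_le)
      with d show False by simp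
    qed
  next
    assume nr: "\<forall>x. \<not> (poly p x = 0 \<and> poly (pderiv p) x = 0)"
    show "degree (gcd p (pderiv p)) = 0"
    proof (rule ccontr)
      assume "degree (gcd p (pderiv p)) \<noteq> 0"
      then obtain x where "poly (gcd p (pderiv p)) x = 0"
        by (metis constant_degree fundamental_theorem_of_algebra)
      then have "[:- x, 1:] dvd gcd p (pderiv p)" by (simp add: poly_eq_0_iff_dvd)
      then have "poly p x = 0 \<and> poly (pderiv p) x = 0" by (simp add: poly_eq_0_iff_dvd)
      with nr show False by blast
    qed
  qed
  also have "\<dots> \<longleftrightarrow> card {x. poly p x = 0} = degree p"
    using rsquarefree_card_degree[OF assms] rsquarefree_roots[of p] by metis
  finally show ?thesis .
qed

lemma sum_mult_swap:
  fixes A :: "'c \<Rightarrow> 'r::comm_semiring_1"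
  shows "(\<Sum>c\<in>C. A c * (\<Sum>a\<in>S. u a * v a c)) = (\<Sum>a\<in>S. u a * (\<Sum>c\<in>C. A c * v a c))"
proof -
  have "(\<Sum>c\<in>C. A c * (\<Sum>a\<in>S. u a * v a c)) = (\<Sum>c\<in>C. \<Sum>a\<in>S. u a * (A c * v a c))"
    by (simp add: sum_distrib_left mult.left_commute)
  also have "\<dots> = (\<Sum>a\<in>S. \<Sum>c\<in>C. u a * (A c * v a c))" by (rule sum.swap)
  finally show ?thesis by (simp add: sum_distrib_left)
qed

text \<open>Applying to the relation the polynomial in \<open>A\<close> that vanishes at all
  eigenvalues except \<open>l a\<close> isolates one summand. Concluding about the product
  \<open>u a * v a c\<close> covers zero vectors \<open>v a\<close> too.\<close>

lemma distinct_eigenvalues_independent: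
  fixes A :: "nat \<Rightarrow> nat \<Rightarrow> complex" and v :: "nat \<Rightarrow> nat \<Rightarrow> complex"
  assumes inj: "inj_on l {..<N}"
    and eig: "\<And>a c. a < N \<Longrightarrow> c < N \<Longrightarrow> (\<Sum>c'<N. A c c' * v a c') = l a * v a c"
    and zero: "\<And>c. c < N \<Longrightarrow> (\<Sum>a<N. u a * v a c) = 0"
    and a: "a < N" and c: "c < N"
  shows "u a * v a c = 0"
proof -
  have pow: "(\<Sum>a<N. (u a * l a ^ j) * v a c) = 0" if "c < N" for j c
    using that
  proof (induction j arbitrary: c)
    case (Suc j)
    have "0 = (\<Sum>c'<N. A c c' * (\<Sum>a<N. (u a * l a ^ j) * v a c'))"
      using Suc.IH by simp
    also have "\<dots> = (\<Sum>a<N. (u a * l a ^ j) * (\<Sum>c'<N. A c c' * v a c'))"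
      by (rule sum_mult_swap)
    also have "\<dots> = (\<Sum>a<N. (u a * l a ^ Suc j) * v a c)"
      using Suc.prems by (intro sum.cong refl) (simp add: eig)
    finally show ?case by simp
  qed (use zero in simp)
  define q where "q = (\<Prod>b\<in>{..<N} - {a}. [:- l b, 1:])"
  have "(\<Sum>b<N. (u b * v b c) * l b ^ j) = 0" for j
    by (rule trans[OF sum.cong[OF refl] pow[OF c, of j]]) (simp only: mult_ac)
  then have "0 = (\<Sum>j\<le>degree q. coeff q j * (\<Sum>b<N. (u b * v b c) * l b ^ j))" by simp
  also have "\<dots> = (\<Sum>b<N. (u b * v b c) * poly q (l b))"
    unfolding poly_altdef by (rule sum_mult_swap)
  also have "\<dots> = (\<Sum>b<N. poly q (l b) * (u b * v b c))"
    by (rule sum.cong[OF refl mult.commute])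
  also have "\<dots> = (\<Sum>b<N. if b = a then poly q (l a) * (u a * v a c) else 0)"
  proof (intro sum.cong refl)
    fix b assume b: "b \<in> {..<N}"
    have "poly q (l b) = 0" if "b \<noteq> a"
    proof -
      have "b \<in> {..<N} - {a}" using b that by simp
      then have "(\<Prod>b'\<in>{..<N} - {a}. poly [:- l b', 1:] (l b)) = 0"
        by (intro prod_zero) (auto intro!: bexI[of _ b])
      then show ?thesis by (simp only: q_def poly_prod)
    qed
    then show "poly q (l b) * (u b * v b c) = (if b = a then poly q (l a) * (u a * v a c) else 0)" by simp
  qed
  also have "\<dots> = poly q (l a) * (u a * v a c)" using a by simp
  finally have "poly q (l a) * (u a * v a c) = 0" by simp
  moreover have "poly q (l a) \<noteq> 0"
  proof
    assume "poly q (l a) = 0"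
    then have "\<exists>b\<in>{..<N} - {a}. poly [:- l b, 1:] (l a) = 0"
      by (simp only: q_def poly_prod prod_zero_iff finite_Diff finite_lessThan)
    then obtain b where "b < N" "b \<noteq> a" "l a = l b" by auto
    with inj a show False by (auto simp: inj_on_def)
  qed
  ultimately show ?thesis by simp
qed

text \<open>The vectors \<open>v a\<close> form a basis, in which \<open>w\<close> is expanded by
  Cramer's rule with coefficients \<open>u a\<close>. The eigenvalue equation for \<open>w\<close>
  is a linear relation with coefficients \<open>(l a - \<mu>) * u a\<close>, so only a summand with
  \<open>l a = \<mu>\<close> can remain.\<close>

lemma simple_spectrum:
  fixes A :: "nat \<Rightarrow> nat \<Rightarrow> complex" and v :: "nat \<Rightarrow> nat \<Rightarrow> complex"
  assumes inj: "inj_on l {..<N}"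
    and eig: "\<And>a c. a < N \<Longrightarrow> c < N \<Longrightarrow> (\<Sum>c'<N. A c c' * v a c') = l a * v a c"
    and nz: "\<And>a. a < N \<Longrightarrow> \<exists>c<N. v a c \<noteq> 0"
    and w: "\<And>c. c < N \<Longrightarrow> (\<Sum>c'<N. A c c' * w c') = \<mu> * w c"
  shows "(\<exists>b<N. l b = \<mu> \<and> (\<exists>s. \<forall>c<N. w c = s * v b c)) \<or> (\<forall>c<N. w c = 0)"
proof -
  obtain g K' where g: "\<forall>\<mu>\<in>{..<N}. \<forall>\<nu>\<in>{..<N}. (\<Sum>\<rho>\<in>{..<N}. v \<rho> \<mu> * K' \<rho> \<nu>) = (if \<mu> = \<nu> then g else 0)"
    and gn: "\<forall>\<eta> :: complex \<Rightarrow> complex. comm_ring_hom \<eta> \<longrightarrow>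
       (\<forall>x. (\<forall>\<mu>\<in>{..<N}. (\<Sum>\<nu>\<in>{..<N}. \<eta> (v \<nu> \<mu>) * x \<nu>) = 0) \<longrightarrow> (\<forall>\<nu>\<in>{..<N}. x \<nu> = 0)) \<longrightarrow> \<eta> g \<noteq> 0"
    using adjugate[OF finite_lessThan[of N], of "\<lambda>c a. v a c"] by blast
  have g0: "g \<noteq> 0"
  proof (rule gn[THEN spec, THEN mp, THEN mp, OF comm_ring_hom_ident], intro allI impI ballI)
    fix x a assume z: "\<forall>\<mu>\<in>{..<N}. (\<Sum>\<nu>\<in>{..<N}. v \<nu> \<mu> * x \<nu>) = 0" and "a \<in> {..<N}"
    then have a: "a < N" by simp
    obtain c where c: "c < N" "v a c \<noteq> 0" using nz[OF a] by blast
    have "x a * v a c = 0"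
      by (rule distinct_eigenvalues_independent[where A = A and l = l and v = v and u = x and N = N])
        (use inj eig a c(1) z in \<open>auto simp: mult.commute\<close>)
    with c show "x a = 0" by simp
  qed
  define u where "u a = (\<Sum>c<N. K' a c * w c) / g" for a
  have wu: "w c = (\<Sum>a<N. u a * v a c)" if c: "c < N" for c
  proof -
    have "(\<Sum>a<N. u a * v a c) = (\<Sum>a<N. (v a c * (\<Sum>c'<N. w c' * K' a c')) / g)"
      by (intro sum.cong refl) (simp add: u_def mult.commute)
    also have "\<dots> = (\<Sum>a<N. v a c * (\<Sum>c'<N. w c' * K' a c')) / g"
      by (rule sum_divide_distrib[symmetric])
    also have "(\<Sum>a<N. v a c * (\<Sum>c'<N. w c' * K' a c')) = (\<Sum>c'<N. w c' * (\<Sum>a<N. v a c * K' a c'))"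
      by (rule sum_mult_swap)
    also have "\<dots> = (\<Sum>c'<N. if c' = c then g * w c else 0)"
      using g c by (intro sum.cong refl) auto
    finally show ?thesis using c g0 by simp
  qed
  have id: "(x - y) * z * t = z * (x * t) - y * (z * t)" for x y z t :: complex
    by (simp add: left_diff_distrib)
  have "(l a - \<mu>) * u a * v a c = 0" if a: "a < N" and c: "c < N" for a c
  proof (rule distinct_eigenvalues_independent[where A = A and l = l and v = v and u = "\<lambda>a. (l a - \<mu>) * u a" and N = N])
    fix c assume c: "c < N"
    have "(\<Sum>a<N. (l a - \<mu>) * u a * v a c) = (\<Sum>a<N. u a * (l a * v a c)) - \<mu> * (\<Sum>a<N. u a * v a c)"
    proof -
      have "(\<Sum>a<N. (l a - \<mu>) * u a * v a c) = (\<Sum>a<N. u a * (l a * v a c) - \<mu> * (u a * v a c))"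
        by (rule sum.cong[OF refl]) (rule id)
      also have "\<dots> = (\<Sum>a<N. u a * (l a * v a c)) - (\<Sum>a<N. \<mu> * (u a * v a c))"
        by (rule sum_subtractf)
      finally show ?thesis by (simp only: sum_distrib_left)
    qed
    also have "(\<Sum>a<N. u a * (l a * v a c)) = (\<Sum>a<N. u a * (\<Sum>c'<N. A c c' * v a c'))"
      using eig c by (intro sum.cong refl) auto
    also have "\<dots> = (\<Sum>c'<N. A c c' * (\<Sum>a<N. u a * v a c'))"
      by (rule sum_mult_swap[symmetric])
    also have "\<dots> = (\<Sum>c'<N. A c c' * w c')" by (intro sum.cong refl) (simp add: wu)
    also have "\<dots> - \<mu> * (\<Sum>a<N. u a * v a c) = 0" using w[OF c] wu[OF c] by simp
    finally show "(\<Sum>a<N. (l a - \<mu>) * u a * v a c) = 0" .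
  qed (use inj eig a c in auto)
  then have z: "u a * v a c = 0" if "a < N" "l a \<noteq> \<mu>" "c < N" for a c
    using that by auto
  show ?thesis
  proof (cases "\<exists>b<N. l b = \<mu>")
    case True
    then obtain b where b: "b < N" "l b = \<mu>" by blast
    have "w c = u b * v b c" if "c < N" for c
    proof -
      have "w c = (\<Sum>a<N. if a = b then u b * v b c else 0)"
        unfolding wu[OF that]
      proof (rule sum.cong[OF refl])
        fix a assume a: "a \<in> {..<N}"
        show "u a * v a c = (if a = b then u b * v b c else 0)"
        proof (cases "a = b")
          case False
          have "l a \<noteq> \<mu>"
          proof
            assume "l a = \<mu>"
            then have "l a = l b" by (simp only: b(2))
            then have "a = b" by (rule inj_onD[OF inj]) (use a b(1) in simp_all)
            with False show False by simp
          qed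
          then have "u a * v a c = 0" by (rule z[rotated]) (use a that in simp_all)
          with False show ?thesis by simp
        qed simp
      qed
      then show ?thesis using b by simp
    qed
    with b show ?thesis by blast
  next
    case False
    have "w c = 0" if "c < N" for c
      unfolding wu[OF that] by (rule sum.neutral) (use z that False in auto)
    then show ?thesis by blast
  qed
qed

section \<open>Normalized points and separating forms\<close>

context multigrading
begin

text \<open>The value 0 outside \<open>vars\<close> makes the representative of a point in the chart
  unique as a function.\<close>

definition normalized :: "(nat \<times> nat \<Rightarrow> complex) \<Rightarrow> bool" where
  "normalized x \<longleftrightarrow> (\<forall>j<k. x (j, 0) = 1) \<and> (\<forall>v. v \<notin> vars \<longrightarrow> x v = 0)"

text \<open>Raised to multidegree (1, ..., 1), variables of different groups all act between the
  same diagonal degrees, and can be added up in \<open>hform\<close>.\<close>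

definition Yform :: "nat \<times> nat \<Rightarrow> (nat \<times> nat, complex) mpoly" where
  "Yform v = mvar v * x0 (\<lambda>i. if i = fst v then 0 else 1)"

text \<open>The value at a normalized point is a polynomial in \<xi> whose coefficients are the
  coordinates of the point, so two points have the same value for only finitely many \<xi>.\<close>

definition hform :: "complex \<Rightarrow> (nat \<times> nat, complex) mpoly" where
  "hform \<xi> = (\<Sum>v\<in>vars. cst (\<xi> ^ prod_encode v) * Yform v)"

lemma mpoly_eval_x0: "mpoly_eval x (x0 D) = (\<Prod>i<k. x (i, 0) ^ D i)"
  by (simp add: x0_def mpoly_eval_single mon_eval_x0m)

lemma mpoly_eval_x0_normalized: "normalized x \<Longrightarrow> mpoly_eval x (x0 D) = 1"
  by (simp add: mpoly_eval_x0 normalized_def)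

lemma Yform_in_Forms: "v \<in> vars \<Longrightarrow> Yform v \<in> Forms (\<lambda>_. 1)"
proof -
  assume v: "v \<in> vars"
  obtain j l where jl: "v = (j, l)" by (cases v)
  have "Yform v \<in> Forms (\<lambda>i. udeg j i + (if i = j then 0 else 1))"
    unfolding Yform_def jl fst_conv by (intro Forms_mult Forms_mvar x0_in_Forms) (use v jl in simp)
  also have "\<dots> = Forms (\<lambda>_. 1)" by (rule Forms_cong) simp
  finally show ?thesis .
qed

lemma hform_in_Forms: "hform \<xi> \<in> Forms (\<lambda>_. 1)"
  unfolding hform_def by (intro Forms_sum Forms_cst Yform_in_Forms)

lemma mpoly_eval_Yform: "normalized x \<Longrightarrow> mpoly_eval x (Yform v) = x v"
  by (simp add: Yform_def mpe.hom_mult mpoly_eval_x0_normalized)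

lemma mpoly_eval_hform: "normalized x \<Longrightarrow> mpoly_eval x (hform \<xi>) = (\<Sum>v\<in>vars. \<xi> ^ prod_encode v * x v)"
  by (simp add: hform_def mpe.hom_sum mpe.hom_mult mpoly_eval_Yform)

lemma separating_hform:
  fixes N :: nat
  assumes "\<And>a. a < N \<Longrightarrow> normalized (p a)" and inj: "inj_on p {..<N}"
  obtains \<xi> where "inj_on (\<lambda>a. mpoly_eval (p a) (hform \<xi>)) {..<N}"
proof -
  define q where "q a b = (\<Sum>v\<in>vars. Polynomial.monom (p a v - p b v) (prod_encode v))" for a b
  define bad where "bad = (\<Union>(a, b)\<in>{(a, b). a < N \<and> b < N \<and> a \<noteq> b}. {\<xi>. poly (q a b) \<xi> = 0})"
  have q0: "q a b \<noteq> 0" if "a < N" "b < N" "a \<noteq> b" for a b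
  proof
    assume q: "q a b = 0"
    have "p a v = p b v" for v
    proof (cases "v \<in> vars")
      case True
      have "coeff (q a b) (prod_encode v) = (\<Sum>v'\<in>vars. if v' = v then p a v - p b v else 0)"
        unfolding q_def coeff_sum by (intro sum.cong refl) auto
      then show ?thesis using q True finite_vars by simp
    next
      case False
      with assms(1)[OF that(1)] assms(1)[OF that(2)] show ?thesis by (cases v) (simp add: normalized_def)
    qed
    then have "p a = p b" by blast
    with inj that show False by (auto simp: inj_on_def)
  qed
  have "finite bad"
    unfolding bad_def
  proof (rule finite_UN_I)
    show "finite {(a, b). a < N \<and> b < N \<and> a \<noteq> b}"
      by (rule finite_subset[of _ "{..<N} \<times> {..<N}"]) auto
  qed (use q0 poly_roots_finite in auto)
  then obtain \<xi> where \<xi>: "\<xi> \<notin> bad"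
    using ex_new_if_finite infinite_UNIV_char_0 by blast
  show ?thesis
  proof (rule that[of \<xi>], rule inj_onI, rule ccontr)
    fix a b assume ab: "a \<in> {..<N}" "b \<in> {..<N}" "mpoly_eval (p a) (hform \<xi>) = mpoly_eval (p b) (hform \<xi>)" "a \<noteq> b"
    then have "poly (q a b) \<xi> = 0"
      using assms(1) by (simp add: q_def poly_sum poly_monom mpoly_eval_hform algebra_simps sum_subtractf)
    then have "\<xi> \<in> bad" using ab by (auto simp: bad_def)
    with \<xi> show False by blast
  qed
qed

text \<open>Interpolation: the product of \<open>hform \<xi> - h b\<close> over b \<noteq> a,
  homogenized, vanishes at all the points but \<open>p a\<close>. Degree at least N leaves room for
  these N - 1 factors.\<close>

lemma evaluations_independent:
  fixes N :: nat
  assumes p: "\<And>a. a < N \<Longrightarrow> normalized (p a)" and inj: "inj_on p {..<N}"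
    and D: "\<And>i. i < k \<Longrightarrow> N \<le> D i"
    and zero: "\<And>P. P \<in> Forms D \<Longrightarrow> (\<Sum>a<N. u a * mpoly_eval (p a) P) = 0" and a: "a < N"
  shows "u a = 0"
proof -
  obtain \<xi> where \<xi>: "inj_on (\<lambda>a. mpoly_eval (p a) (hform \<xi>)) {..<N}"
    using separating_hform[OF p inj] by blast
  define h where "h a = mpoly_eval (p a) (hform \<xi>)" for a
  define P where "P = (\<Prod>b\<in>{..<N} - {a}. hform \<xi> - cst (h b) * x0 (\<lambda>_. 1)) * x0 (\<lambda>i. D i - (\<Sum>b\<in>{..<N} - {a}. 1))"
  have "P \<in> Forms (\<lambda>i. (\<Sum>b\<in>{..<N} - {a}. 1) + (D i - (\<Sum>b\<in>{..<N} - {a}. 1)))"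
    unfolding P_def
    by (intro Forms_mult x0_in_Forms Forms_prod Forms_diff hform_in_Forms Forms_cst) auto
  also have "\<dots> = Forms D"
    using D a by (intro Forms_cong) fastforce
  finally have "(\<Sum>c<N. u c * mpoly_eval (p c) P) = 0" by (rule zero)
  moreover have ev: "mpoly_eval (p c) P = (\<Prod>b\<in>{..<N} - {a}. h c - h b)" if "c < N" for c
    using p[OF that] by (simp add: P_def mpe.hom_mult mpe.hom_prod mpe.hom_minus mpoly_eval_x0_normalized h_def)
  moreover have "(\<Prod>b\<in>{..<N} - {a}. h c - h b) = 0" if "c < N" "c \<noteq> a" for c
    using that by (intro prod_zero) auto
  ultimately have "u a * (\<Prod>b\<in>{..<N} - {a}. h a - h b) = 0"
    using a by (simp add: sum.remove[of "{..<N}" a])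
  moreover have "(\<Prod>b\<in>{..<N} - {a}. h a - h b) \<noteq> 0"
    using \<xi> a by (auto simp: h_def inj_on_def prod_zero_iff)
  ultimately show ?thesis by simp
qed

end

section \<open>The dimension of the space of annihilating functionals\<close>

context param_system
begin

definition formal_solutions :: "('p \<Rightarrow> complex) \<Rightarrow> nat \<Rightarrow> (nat \<Rightarrow> nat \<times> nat \<Rightarrow> complex) \<Rightarrow> bool" where
  "formal_solutions \<theta>0 N p \<longleftrightarrow> (\<forall>\<theta>. \<forall>a<N. \<exists>x. (\<forall>v. fps_nth (x v) 0 = p a v) \<and>
     (\<forall>e\<in>I. (\<Sum>\<kappa>\<in>Mon (dg e). line_eval \<theta>0 \<theta> (Ec e \<kappa>) * mon_eval x \<kappa>) = 0))"

lemma fps_nth_0_mon_eval: "fps_nth (mon_eval x \<mu>) 0 = mon_eval (\<lambda>v. fps_nth (x v) 0) \<mu>" for x :: "_ \<Rightarrow> complex fps"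
proof -
  interpret h: comm_ring_hom "\<lambda>f :: complex fps. fps_nth f 0" by (rule comm_ring_hom_fps_nth_0)
  show ?thesis by (simp add: mon_eval_def h.hom_prod h.hom_power)
qed

lemma formal_solutions_special:
  assumes "formal_solutions \<theta>0 N p" "a < N" "e \<in> I"
  shows "mpoly_eval (p a) (Eqn \<theta>0 e) = 0"
proof -
  interpret h: comm_ring_hom "\<lambda>f :: complex fps. fps_nth f 0" by (rule comm_ring_hom_fps_nth_0)
  obtain x where x: "\<forall>v. fps_nth (x v) 0 = p a v"
    "(\<Sum>\<kappa>\<in>Mon (dg e). line_eval \<theta>0 \<theta>0 (Ec e \<kappa>) * mon_eval x \<kappa>) = 0"
    using assms unfolding formal_solutions_def by blast
  have "0 = fps_nth (\<Sum>\<kappa>\<in>Mon (dg e). line_eval \<theta>0 \<theta>0 (Ec e \<kappa>) * mon_eval x \<kappa>) 0"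
    by (simp add: x(2))
  also have "\<dots> = mpoly_eval (p a) (Eqn \<theta>0 e)"
    by (simp add: h.hom_sum h.hom_mult fps_nth_0_mon_eval line_eval_nth_0 mpoly_eval_Eqn x(1))
  finally show ?thesis by simp
qed

lemma annihilates_evaluation:
  assumes "\<And>e. e \<in> I \<Longrightarrow> mpoly_eval x (Eqn \<theta> e) = 0"
  shows "annihilates (mpoly_eval x) (sys \<theta>) D"
  unfolding annihilates_def sys_def using assms by (auto simp: mpe.hom_mult)

lemma annihilates_sum:
  "finite A \<Longrightarrow> (\<And>a. a \<in> A \<Longrightarrow> annihilates (\<phi> a) S D) \<Longrightarrow> annihilates (\<lambda>P. \<Sum>a\<in>A. u a * \<phi> a P) S D"
  unfolding annihilates_def by (fastforce intro: sum.neutral)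

lemma clin_sum_functional:
  assumes "\<And>a. a \<in> A \<Longrightarrow> clin (\<phi> a)"
  shows "clin (\<lambda>P. \<Sum>a\<in>A. u a * \<phi> a P)"
  unfolding clin_def
proof (intro conjI allI)
  fix P Q
  show "(\<Sum>a\<in>A. u a * \<phi> a (P + Q)) = (\<Sum>a\<in>A. u a * \<phi> a P) + (\<Sum>a\<in>A. u a * \<phi> a Q)"
    unfolding sum.distrib[symmetric]
    by (rule sum.cong[OF refl]) (simp add: clin_add[OF assms] distrib_left)
next
  fix c P
  show "(\<Sum>a\<in>A. u a * \<phi> a (cst c * P)) = c * (\<Sum>a\<in>A. u a * \<phi> a P)"
    unfolding sum_distrib_left
    by (rule sum.cong[OF refl]) (simp add: clin_scale[OF assms] mult.left_commute)
qed

text \<open>The lifted solutions show the claim along the generic point of the line from \<open>\<theta>0\<close> to \<open>\<theta>\<close>; since it is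
  polynomial, it then holds at \<open>\<theta>\<close>.\<close>

lemma functionals_exist:
  assumes id: "solves_identity D N bD g U \<Phi>" and D: "fits D" and bD: "\<forall>c<N. bD c \<in> Forms D"
    and sp: "\<And>\<phi> P. clin \<phi> \<Longrightarrow> annihilates \<phi> (sys \<theta>0) D \<Longrightarrow> (\<And>c. c < N \<Longrightarrow> \<phi> (bD c) = 0) \<Longrightarrow> P \<in> Forms D \<Longrightarrow> \<phi> P = 0"
    and p: "\<And>a. a < N \<Longrightarrow> normalized (p a)" "inj_on p {..<N}" "formal_solutions \<theta>0 N p"
    and DN: "\<And>i. i < k \<Longrightarrow> N \<le> D i"
    and \<psi>: "\<psi> = (\<lambda>a P. \<Sum>\<mu>\<in>Mon D. lookup P \<mu> * mpoly_eval \<theta> (\<Phi> \<mu> a))" and a: "a < N"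
  shows "clin (\<psi> a)" "annihilates (\<psi> a) (sys \<theta>) D" "\<And>c. c < N \<Longrightarrow> \<psi> a (bD c) = (if a = c then mpoly_eval \<theta> g else 0)"
proof -
  let ?\<omega> = "line_eval \<theta>0 \<theta>"
  interpret \<omega>: comm_ring_hom ?\<omega> by (rule comm_ring_hom_line_eval)
  have "\<forall>b\<in>{..<N}. \<exists>x. (\<forall>v. fps_nth (x v) 0 = p b v) \<and>
     (\<forall>e\<in>I. (\<Sum>\<kappa>\<in>Mon (dg e). ?\<omega> (Ec e \<kappa>) * mon_eval x \<kappa>) = 0)"
    using p(3) unfolding formal_solutions_def by blast
  from bchoice[OF this] obtain x where
    x: "\<And>b v. b < N \<Longrightarrow> fps_nth (x b v) 0 = p b v"
      "\<And>b e. b < N \<Longrightarrow> e \<in> I \<Longrightarrow> (\<Sum>\<kappa>\<in>Mon (dg e). ?\<omega> (Ec e \<kappa>) * mon_eval (x b) \<kappa>) = 0"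
    by blast
  define Z where "Z c b = (\<Sum>\<nu>\<in>Mon D. ?\<omega> (cst (lookup (bD c) \<nu>)) * mon_eval (x b) \<nu>)" for c b
  have rows0: "(\<Sum>\<kappa>\<in>Mon (dg e). ?\<omega> (Ec e \<kappa>) * mon_eval (x b) (\<kappa> + m)) = 0" if "b < N" "e \<in> I" for b e m
  proof -
    have "(\<Sum>\<kappa>\<in>Mon (dg e). ?\<omega> (Ec e \<kappa>) * mon_eval (x b) (\<kappa> + m)) =
        (\<Sum>\<kappa>\<in>Mon (dg e). ?\<omega> (Ec e \<kappa>) * mon_eval (x b) \<kappa>) * mon_eval (x b) m"
      by (simp add: sum_distrib_right mon_eval_add mult.assoc)
    with x(2)[OF that] show ?thesis by simp
  qed
  have rep: "?\<omega> g * mon_eval (x b) \<nu> = (\<Sum>c<N. ?\<omega> (\<Phi> \<nu> c) * Z c b)" if "b < N" "\<nu> \<in> Mon D" for b \<nu>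
    unfolding Z_def
    by (rule solves_identity_hom[OF id comm_ring_hom_line_eval D _ that(2)])
      (use rows0 that(1) in \<open>auto simp: mult_rows_def\<close>)
  interpret h: comm_ring_hom "\<lambda>f :: complex fps. fps_nth f 0" by (rule comm_ring_hom_fps_nth_0)
  have Z0: "fps_nth (Z c b) 0 = mpoly_eval (p b) (bD c)" if "c < N" "b < N" for c b
  proof -
    have "fps_nth (Z c b) 0 = (\<Sum>\<nu>\<in>Mon D. lookup (bD c) \<nu> * mon_eval (p b) \<nu>)"
      using x(1)[OF that(2)] by (simp add: Z_def h.hom_sum h.hom_mult line_eval_cst fps_nth_0_mon_eval)
    also have "\<dots> = mpoly_eval (p b) (bD c)"
      using bD that by (intro mpoly_eval_superset[symmetric] finite_Mon) (simp add: Forms_def)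
    finally show ?thesis .
  qed
  obtain gZ KZ where
    KZ: "\<forall>\<mu>\<in>{..<N}. \<forall>\<nu>\<in>{..<N}. (\<Sum>\<rho>\<in>{..<N}. Z \<mu> \<rho> * KZ \<rho> \<nu>) = (if \<mu> = \<nu> then gZ else 0)"
    and gZn: "\<forall>\<eta> :: complex fps \<Rightarrow> complex. comm_ring_hom \<eta> \<longrightarrow>
       (\<forall>v. (\<forall>\<mu>\<in>{..<N}. (\<Sum>\<nu>\<in>{..<N}. \<eta> (Z \<mu> \<nu>) * v \<nu>) = 0) \<longrightarrow> (\<forall>\<nu>\<in>{..<N}. v \<nu> = 0)) \<longrightarrow> \<eta> gZ \<noteq> 0"
    using adjugate[OF finite_lessThan[of N], of Z] by blast
  \<comment> \<open>A relation \<open>u\<close> between the columns of \<open>Z\<close> at the start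
    of the line is a combination of evaluations at the \<open>p b\<close> that kills every
    \<open>bD c\<close>, hence by \<open>sp\<close> all forms of degree D; the evaluations being
    independent, u = 0.\<close>
  have "fps_nth gZ 0 \<noteq> 0"
  proof (rule gZn[THEN spec, THEN mp, THEN mp, OF comm_ring_hom_fps_nth_0], intro allI impI ballI)
    fix u :: "nat \<Rightarrow> complex" and b assume u: "\<forall>\<mu>\<in>{..<N}. (\<Sum>\<nu>\<in>{..<N}. fps_nth (Z \<mu> \<nu>) 0 * u \<nu>) = 0" and b: "b \<in> {..<N}"
    define \<phi> where "\<phi> P = (\<Sum>a<N. u a * mpoly_eval (p a) P)" for P
    have "clin \<phi>" unfolding \<phi>_def by (intro clin_sum_functional clin_mpoly_eval)
    moreover have "annihilates \<phi> (sys \<theta>0) D"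
      unfolding \<phi>_def
      by (intro annihilates_sum annihilates_evaluation) (use formal_solutions_special[OF p(3)] in auto)
    moreover have "\<phi> (bD c) = 0" if "c < N" for c
    proof -
      have "\<phi> (bD c) = (\<Sum>\<nu>\<in>{..<N}. fps_nth (Z c \<nu>) 0 * u \<nu>)"
        unfolding \<phi>_def by (intro sum.cong refl) (simp add: Z0 that mult.commute)
      with u that show ?thesis by simp
    qed
    ultimately have "\<phi> P = 0" if "P \<in> Forms D" for P using sp that by blast
    then show "u b = 0"
      by (intro evaluations_independent[where N = N and p = p and D = D and u = u])
        (use p DN b in \<open>auto simp: \<phi>_def\<close>)
  qed
  then have gZ: "gZ \<noteq> 0" by auto
  \<comment> \<open>Since the determinant \<open>gZ\<close> is a nonzero power series, a relation
    between the rows of \<open>Z\<close> has coefficients that vanish along the line, and therefore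
    at its end \<theta>.\<close>
  have vanish: "mpoly_eval \<theta> (Q a) = 0"
    if Q: "\<And>b. b < N \<Longrightarrow> (\<Sum>a<N. ?\<omega> (Q a) * Z a b) = 0" and "a < N" for Q a
  proof -
    have "0 = (\<Sum>b<N. KZ b a * (\<Sum>a'<N. ?\<omega> (Q a') * Z a' b))"
      using Q by simp
    also have "\<dots> = (\<Sum>a'<N. ?\<omega> (Q a') * (\<Sum>b<N. KZ b a * Z a' b))"
      by (rule sum_mult_swap)
    also have "\<dots> = (\<Sum>a'<N. ?\<omega> (Q a') * (\<Sum>b<N. Z a' b * KZ b a))"
      by (simp add: mult.commute)
    also have "\<dots> = (\<Sum>a'<N. if a' = a then ?\<omega> (Q a) * gZ else 0)"
      using KZ \<open>a < N\<close> by (intro sum.cong refl) auto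
    also have "\<dots> = ?\<omega> (Q a) * gZ" using \<open>a < N\<close> by simp
    finally have "?\<omega> (Q a) = 0" using gZ by simp
    then show ?thesis by (rule line_eval_0)
  qed
  have lin: "clin (\<psi> a)"
    unfolding \<psi> clin_def
    by (intro conjI allI) (simp_all only: lookup_add lookup_cst_mult distrib_right sum.distrib sum_distrib_left mult.assoc)
  then show "clin (\<psi> a)" .
  have \<psi>_single: "\<psi> a (single \<mu> 1) = mpoly_eval \<theta> (\<Phi> \<mu> a)" if "\<mu> \<in> Mon D" for \<mu>
  proof -
    have "\<psi> a (single \<mu> 1) = (\<Sum>\<nu>\<in>Mon D. if \<nu> = \<mu> then mpoly_eval \<theta> (\<Phi> \<mu> a) else 0)"
      unfolding \<psi> by (intro sum.cong refl) (auto simp: lookup_single when_def)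
    then show ?thesis using that finite_Mon by simp
  qed
  show "annihilates (\<psi> a) (sys \<theta>) D"
    unfolding annihilates_rows[OF D lin]
  proof clarify
    fix e m assume "(e, m) \<in> mult_rows D"
    then have em: "e \<in> I" "m \<in> Mon (\<lambda>i. D i - dg e i)" by (auto simp: mult_rows_def)
    \<comment> \<open>By \<open>rep\<close>, contraction with \<open>Z\<close> turns \<Phi> at \<nu>
      into g times the monomial \<nu> of a lifted solution, which every row of the system
      kills.\<close>
    have "mpoly_eval \<theta> (\<Sum>\<nu>\<in>Mon D. row_coeff (e, m) \<nu> * \<Phi> \<nu> a) = 0"
    proof (rule vanish[of "\<lambda>a. \<Sum>\<nu>\<in>Mon D. row_coeff (e, m) \<nu> * \<Phi> \<nu> a", OF _ a])
      fix b assume b: "b < N"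
      have "(\<Sum>a<N. ?\<omega> (\<Sum>\<nu>\<in>Mon D. row_coeff (e, m) \<nu> * \<Phi> \<nu> a) * Z a b) =
          (\<Sum>a<N. Z a b * (\<Sum>\<nu>\<in>Mon D. ?\<omega> (row_coeff (e, m) \<nu>) * ?\<omega> (\<Phi> \<nu> a)))"
        by (simp add: \<omega>.hom_sum \<omega>.hom_mult mult.commute)
      also have "\<dots> = (\<Sum>\<nu>\<in>Mon D. ?\<omega> (row_coeff (e, m) \<nu>) * (\<Sum>a<N. Z a b * ?\<omega> (\<Phi> \<nu> a)))"
        by (rule sum_mult_swap)
      also have "\<dots> = (\<Sum>\<nu>\<in>Mon D. ?\<omega> (row_coeff (e, m) \<nu>) * (\<Sum>a<N. ?\<omega> (\<Phi> \<nu> a) * Z a b))"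
        by (simp add: mult.commute)
      also have "\<dots> = (\<Sum>\<nu>\<in>Mon D. ?\<omega> (row_coeff (e, m) \<nu>) * (?\<omega> g * mon_eval (x b) \<nu>))"
        by (intro sum.cong refl) (simp add: rep[OF b])
      also have "\<dots> = (\<Sum>\<kappa>\<in>Mon (dg e). ?\<omega> (Ec e \<kappa>) * (?\<omega> g * mon_eval (x b) (\<kappa> + m)))"
        by (rule sum_row_coeff[OF comm_ring_hom_line_eval D em])
      also have "\<dots> = ?\<omega> g * (\<Sum>\<kappa>\<in>Mon (dg e). ?\<omega> (Ec e \<kappa>) * mon_eval (x b) (\<kappa> + m))"
        by (simp add: sum_distrib_left mult.left_commute)
      also have "\<dots> = 0" using rows0[OF b em(1)] by simp
      finally show "(\<Sum>a<N. ?\<omega> (\<Sum>\<nu>\<in>Mon D. row_coeff (e, m) \<nu> * \<Phi> \<nu> a) * Z a b) = 0" .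
    qed
    then have "(\<Sum>\<nu>\<in>Mon D. mpoly_eval \<theta> (row_coeff (e, m) \<nu>) * mpoly_eval \<theta> (\<Phi> \<nu> a)) = 0"
      by (simp add: mpe.hom_sum mpe.hom_mult)
    then have z: "(\<Sum>\<kappa>\<in>Mon (dg e). mpoly_eval \<theta> (Ec e \<kappa>) * mpoly_eval \<theta> (\<Phi> (\<kappa> + m) a)) = 0"
      unfolding sum_row_coeff[OF mpe.comm_ring_hom_axioms D em] .
    have "\<kappa> + m \<in> Mon D" if "\<kappa> \<in> Mon (dg e)" for \<kappa>
      using Mon_add[OF that em(2)] Mon_cong[of "\<lambda>i. dg e i + (D i - dg e i)" D] D em(1) by (simp add: fits_def)
    then have "\<psi> a (Eqn \<theta> e * single m 1) = (\<Sum>\<kappa>\<in>Mon (dg e). mpoly_eval \<theta> (Ec e \<kappa>) * mpoly_eval \<theta> (\<Phi> (\<kappa> + m) a))"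
      unfolding clin_Eqn_mult[OF lin] by (intro sum.cong refl) (simp add: \<psi>_single)
    with z show "\<psi> a (Eqn \<theta> e * single m 1) = 0" by simp
  qed
  fix c assume c: "c < N"
  have "mpoly_eval \<theta> ((\<Sum>\<nu>\<in>Mon D. cst (lookup (bD c) \<nu>) * \<Phi> \<nu> a) - (if a = c then g else 0)) = 0"
  proof (rule vanish[of "\<lambda>a. (\<Sum>\<nu>\<in>Mon D. cst (lookup (bD c) \<nu>) * \<Phi> \<nu> a) - (if a = c then g else 0)", OF _ a])
    fix b assume b: "b < N"
    have "(\<Sum>a<N. ?\<omega> ((\<Sum>\<nu>\<in>Mon D. cst (lookup (bD c) \<nu>) * \<Phi> \<nu> a) - (if a = c then g else 0)) * Z a b) =
        (\<Sum>a<N. Z a b * (\<Sum>\<nu>\<in>Mon D. ?\<omega> (cst (lookup (bD c) \<nu>)) * ?\<omega> (\<Phi> \<nu> a))) -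
        (\<Sum>a<N. ?\<omega> (if a = c then g else 0) * Z a b)"
      by (simp add: \<omega>.hom_minus \<omega>.hom_sum \<omega>.hom_mult mult.commute right_diff_distrib sum_subtractf)
    also have "(\<Sum>a<N. Z a b * (\<Sum>\<nu>\<in>Mon D. ?\<omega> (cst (lookup (bD c) \<nu>)) * ?\<omega> (\<Phi> \<nu> a))) =
        (\<Sum>\<nu>\<in>Mon D. ?\<omega> (cst (lookup (bD c) \<nu>)) * (\<Sum>a<N. Z a b * ?\<omega> (\<Phi> \<nu> a)))"
      by (rule sum_mult_swap)
    also have "\<dots> = (\<Sum>\<nu>\<in>Mon D. ?\<omega> (cst (lookup (bD c) \<nu>)) * (\<Sum>a<N. ?\<omega> (\<Phi> \<nu> a) * Z a b))"
      by (simp add: mult.commute)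
    also have "\<dots> = (\<Sum>\<nu>\<in>Mon D. ?\<omega> (cst (lookup (bD c) \<nu>)) * (?\<omega> g * mon_eval (x b) \<nu>))"
      by (intro sum.cong refl) (simp add: rep[OF b])
    also have "\<dots> = ?\<omega> g * Z c b" by (simp add: Z_def sum_distrib_left mult.left_commute)
    also have "(\<Sum>a<N. ?\<omega> (if a = c then g else 0) * Z a b) = (\<Sum>a<N. if a = c then ?\<omega> g * Z c b else 0)"
      by (intro sum.cong refl) auto
    also have "\<dots> = ?\<omega> g * Z c b" using c by simp
    finally show "(\<Sum>a<N. ?\<omega> ((\<Sum>\<nu>\<in>Mon D. cst (lookup (bD c) \<nu>) * \<Phi> \<nu> a) - (if a = c then g else 0)) * Z a b) = 0"
      by simp
  qed
  then show "\<psi> a (bD c) = (if a = c then mpoly_eval \<theta> g else 0)"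
    by (simp add: \<psi> mpe.hom_minus mpe.hom_sum mpe.hom_mult split: if_splits)
qed

end

unbundle no fps_syntax

context multigrading
begin

definition x01 :: "(nat \<times> nat, complex) mpoly" where "x01 = x0 (\<lambda>_. 1)"

lemma x01_in_Forms: "x01 \<in> Forms (\<lambda>_. 1)"
  unfolding x01_def by (rule x0_in_Forms)

lemma mpoly_eval_x01: "normalized x \<Longrightarrow> mpoly_eval x x01 = 1"
  unfolding x01_def by (rule mpoly_eval_x0_normalized)

lemma mvar_x0: "j < k \<Longrightarrow> mvar (j, 0) = x0 (udeg j)"
proof -
  assume j: "j < k"
  have "x0m (udeg j) = (\<Sum>i<k. if i = j then single (j, 0) 1 else 0)"
    unfolding x0m_def by (rule sum.cong[OF refl]) auto
  with j show ?thesis by (simp add: x0_def mvar_def)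
qed

lemma x01_split:
  assumes "j < k"
  shows "x01 = mvar (j, 0) * x0 (\<lambda>i. if i = j then 0 else 1)"
proof -
  have "x01 = x0 (\<lambda>i. udeg j i + (if i = j then 0 else 1))"
    unfolding x01_def by (rule x0_cong) simp
  then show ?thesis by (simp only: x0_add mvar_x0[OF assms])
qed

lemma Yform_0: "j < k \<Longrightarrow> Yform (j, 0) = x01"
  by (simp only: Yform_def x01_split[of j] fst_conv)

lemma Forms_Suc: "P \<in> Forms (\<lambda>_. 1) \<Longrightarrow> Q \<in> Forms (\<lambda>_. a) \<Longrightarrow> P * Q \<in> Forms (\<lambda>_. Suc a)"
  using Forms_mult[of P "\<lambda>_. 1" Q "\<lambda>_. a"] by simp

text \<open>Transposed multiplication: forms of degree (1, ..., 1) act on functionals and lower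
  their degree by one. Eigenvectors are meant with respect to this action.\<close>

lemma annihilates_shift:
  assumes "annihilates \<phi> S (\<lambda>_. Suc a)" "Q \<in> Forms (\<lambda>_. 1)"
  shows "annihilates (\<lambda>P. \<phi> (Q * P)) S (\<lambda>_. a)"
  unfolding annihilates_def
proof clarify
  fix g E D' and P :: "(nat \<times> nat, complex) mpoly"
  assume E: "(g, E) \<in> S" and D': "\<forall>i<k. g i + D' i = a" and P: "P \<in> Forms D'"
  have "Q * P \<in> Forms (\<lambda>i. 1 + D' i)" using assms(2) P by (rule Forms_mult)
  then have "\<phi> (E * (Q * P)) = 0"
    by (rule annihilatesD[OF assms(1) E, rotated]) (use D' in auto)
  then show "\<phi> (Q * (E * P)) = 0" by (simp add: mult.left_commute)
qed

text \<open>Together with \<open>surj_at\<close> this says that the values on \<open>bD\<close> are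
  coordinates on the annihilating functionals, considered on \<open>Forms D\<close>, which thus have
  dimension N.\<close>

definition inj_at where
  "inj_at S D N bD \<longleftrightarrow> (\<forall>\<phi>. clin \<phi> \<longrightarrow> annihilates \<phi> S D \<longrightarrow> (\<forall>c<N. \<phi> (bD c) = 0) \<longrightarrow> (\<forall>P\<in>Forms D. \<phi> P = 0))"

definition surj_at where
  "surj_at S D N bD \<longleftrightarrow> (\<forall>z. \<exists>\<phi>. clin \<phi> \<and> annihilates \<phi> S D \<and> (\<forall>c<N. \<phi> (bD c) = z c))"

lemma inj_at_scaled:
  assumes inj: "inj_at S D N bD"
    and \<phi>: "clin \<phi>" "annihilates \<phi> S D" and \<phi>': "clin \<phi>'" "annihilates \<phi>' S D"
    and eq: "\<And>c. c < N \<Longrightarrow> \<phi> (bD c) = s * \<phi>' (bD c)" and P: "P \<in> Forms D"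
  shows "\<phi> P = s * \<phi>' P"
proof -
  define \<psi> where "\<psi> P = \<phi> P - s * \<phi>' P" for P
  have "clin \<psi>"
    unfolding clin_def \<psi>_def
    by (simp add: clin_add[OF \<phi>(1)] clin_add[OF \<phi>'(1)] clin_scale[OF \<phi>(1)] clin_scale[OF \<phi>'(1)]
        right_diff_distrib distrib_left mult.left_commute)
  moreover have "annihilates \<psi> S D"
    unfolding annihilates_def
  proof clarify
    fix g E D' and P :: "(nat \<times> nat, complex) mpoly"
    assume E: "(g, E) \<in> S" and D': "\<forall>i<k. g i + D' i = D i" and P: "P \<in> Forms D'"
    have "\<phi> (E * P) = 0" by (rule annihilatesD[OF \<phi>(2) E _ P]) (use D' in auto)
    moreover have "\<phi>' (E * P) = 0" by (rule annihilatesD[OF \<phi>'(2) E _ P]) (use D' in auto)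
    ultimately show "\<psi> (E * P) = 0" by (simp add: \<psi>_def)
  qed
  moreover have "\<forall>c<N. \<psi> (bD c) = 0" by (simp add: \<psi>_def eq)
  ultimately have "\<psi> P = 0" using inj P unfolding inj_at_def by blast
  then show ?thesis by (simp add: \<psi>_def)
qed

end

context param_system
begin

definition sols :: "('p \<Rightarrow> complex) \<Rightarrow> (nat \<times> nat \<Rightarrow> complex) set" where
  "sols \<theta> = {x. normalized x \<and> (\<forall>e\<in>I. mpoly_eval x (Eqn \<theta> e) = 0)}"

end

text \<open>\<open>T\<close> is the matrix of multiplication by \<open>hform \<xi>\<close>, acting on functionals in degree \<open>\<delta> + 1\<close>.\<close>

locale eigen_data = param_system k n I dg Ec
  for k :: nat and n :: "nat \<Rightarrow> nat" and I :: "'e set" and dg :: "'e \<Rightarrow> nat \<Rightarrow> nat"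
    and Ec :: "'e \<Rightarrow> (nat \<times> nat \<Rightarrow>\<^sub>0 nat) \<Rightarrow> ('p, complex) mpoly" +
  fixes \<theta> :: "'p \<Rightarrow> complex" and \<delta> N :: nat and b0 b1 b2 :: "nat \<Rightarrow> (nat \<times> nat, complex) mpoly"
    and \<xi> :: complex and T :: "nat \<Rightarrow> nat \<Rightarrow> complex"
  assumes fits: "fits (\<lambda>_. \<delta>)"
    and b0: "\<And>c. c < N \<Longrightarrow> b0 c \<in> Forms (\<lambda>_. \<delta>)"
    and b1: "\<And>c. b1 c = x01 * b0 c" and b2: "\<And>c. b2 c = x01 * b1 c"
    and inj0: "inj_at (sys \<theta>) (\<lambda>_. \<delta>) N b0" and inj1: "inj_at (sys \<theta>) (\<lambda>_. Suc \<delta>) N b1"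
    and surj1: "surj_at (sys \<theta>) (\<lambda>_. Suc \<delta>) N b1" and surj2: "surj_at (sys \<theta>) (\<lambda>_. Suc (Suc \<delta>)) N b2"
    and T: "\<And>\<phi> c. clin \<phi> \<Longrightarrow> annihilates \<phi> (sys \<theta>) (\<lambda>_. Suc \<delta>) \<Longrightarrow> c < N \<Longrightarrow>
      (\<Sum>c'<N. T c c' * \<phi> (b1 c')) = \<phi> (hform \<xi> * b0 c)"
begin

lemma point_eigenvector:
  assumes x: "x \<in> sols \<theta>"
  shows "c < N \<Longrightarrow> (\<Sum>c'<N. T c c' * mpoly_eval x (b1 c')) = mpoly_eval x (hform \<xi>) * mpoly_eval x (b1 c)"
    and "\<exists>c<N. mpoly_eval x (b1 c) \<noteq> 0"
proof -
  have nx: "normalized x" using x by (simp add: sols_def)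
  have ann: "annihilates (mpoly_eval x) (sys \<theta>) D" for D
    by (rule annihilates_evaluation) (use x in \<open>simp add: sols_def\<close>)
  show "c < N \<Longrightarrow> (\<Sum>c'<N. T c c' * mpoly_eval x (b1 c')) = mpoly_eval x (hform \<xi>) * mpoly_eval x (b1 c)"
    using T[OF clin_mpoly_eval ann, of c] by (simp add: b1 mpe.hom_mult mpoly_eval_x01[OF nx])
  show "\<exists>c<N. mpoly_eval x (b1 c) \<noteq> 0"
  proof (rule ccontr)
    assume "\<not> ?thesis"
    then have "\<forall>c<N. mpoly_eval x (b1 c) = 0" by blast
    then have "mpoly_eval x (x0 (\<lambda>_. Suc \<delta>)) = 0"
      using inj1 clin_mpoly_eval ann x0_in_Forms unfolding inj_at_def by blast
    then show False by (simp add: mpoly_eval_x0_normalized[OF nx])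
  qed
qed

text \<open>At a solution with x_j0 = 0 all the \<open>b1 c\<close> vanish, being multiples of
  \<open>x01\<close>, and so do all forms of degree \<delta> + 1. A monomial made of one nonzero
  coordinate per group contradicts this.\<close>

lemma solutions_affine:
  assumes x: "\<And>e. e \<in> I \<Longrightarrow> mpoly_eval x (Eqn \<theta> e) = 0" and nz: "\<And>j. j < k \<Longrightarrow> \<exists>l\<le>n j. x (j, l) \<noteq> 0"
    and j: "j < k"
  shows "x (j, 0) \<noteq> 0"
proof
  assume z: "x (j, 0) = 0"
  have ann: "annihilates (mpoly_eval x) (sys \<theta>) (\<lambda>_. Suc \<delta>)"
    by (rule annihilates_evaluation) (rule x)
  have "mpoly_eval x x01 = 0"
    using z j unfolding x01_def mpoly_eval_x0 by (intro prod_zero) auto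
  then have "\<forall>c<N. mpoly_eval x (b1 c) = 0" by (simp add: b1 mpe.hom_mult)
  then have zero: "mpoly_eval x P = 0" if "P \<in> Forms (\<lambda>_. Suc \<delta>)" for P
    using inj1 clin_mpoly_eval ann that unfolding inj_at_def by blast
  from nz obtain l where l: "\<And>j. j < k \<Longrightarrow> l j \<le> n j \<and> x (j, l j) \<noteq> 0" by metis
  define \<mu> where "\<mu> = (\<Sum>j<k. single (j, l j) (Suc \<delta>))"
  have "keys \<mu> \<subseteq> (\<Union>j\<in>{..<k}. keys (single (j, l j) (Suc \<delta>)))"
    unfolding \<mu>_def by (induction k) (use Poly_Mapping.keys_add in \<open>fastforce simp: lessThan_Suc\<close>)+
  then have "keys \<mu> \<subseteq> vars" using l by (auto simp: vars_def)
  moreover have "mdeg \<mu> i = Suc \<delta>" if "i < k" for i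
  proof -
    have "mdeg \<mu> i = (\<Sum>j<k. if j = i then Suc \<delta> else 0)"
      unfolding \<mu>_def mdeg_sum by (rule sum.cong[OF refl]) (use l in \<open>auto simp: mdeg_single\<close>)
    with that show ?thesis by simp
  qed
  ultimately have "\<mu> \<in> Mon (\<lambda>_. Suc \<delta>)" by (simp add: Mon_def)
  then have "mpoly_eval x (single \<mu> 1) = 0" by (intro zero Forms_single)
  then show False using l by (simp add: mpoly_eval_single \<mu>_def mon_eval_sum prod_zero_iff)
qed

end

locale eigen_basis = eigen_data +
  fixes l :: "nat \<Rightarrow> complex" and v :: "nat \<Rightarrow> nat \<Rightarrow> complex"
  assumes l_inj: "inj_on l {..<N}"
    and eig: "\<And>a c. a < N \<Longrightarrow> c < N \<Longrightarrow> (\<Sum>c'<N. T c c' * v a c') = l a * v a c"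
    and nz: "\<And>a. a < N \<Longrightarrow> \<exists>c<N. v a c \<noteq> 0"
begin

text \<open>The eigenvector is realized by a functional \<phi> in degree \<delta> + 1 and by \<chi>
  one degree higher, with \<chi>(x01 P) = \<phi>(P). As multiplications commute, \<chi>(Y P) is
  again an eigenvector for \<open>l a\<close>, for each coordinate form Y. The spectrum being
  simple, it is a multiple of \<phi>, and the factors are the coordinates of the solution.\<close>

lemma eigen_point:
  assumes a: "a < N"
  shows "\<exists>x\<in>sols \<theta>. mpoly_eval x (hform \<xi>) = l a"
proof -
  obtain \<phi> where \<phi>: "clin \<phi>" "annihilates \<phi> (sys \<theta>) (\<lambda>_. Suc \<delta>)" "\<And>c. c < N \<Longrightarrow> \<phi> (b1 c) = v a c"
    using surj1 unfolding surj_at_def by blast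
  obtain \<chi> where \<chi>: "clin \<chi>" "annihilates \<chi> (sys \<theta>) (\<lambda>_. Suc (Suc \<delta>))" "\<And>c. c < N \<Longrightarrow> \<chi> (b2 c) = v a c"
    using surj2 unfolding surj_at_def by blast
  note h = hform_in_Forms[of \<xi>] and x1 = x01_in_Forms
  have b1F: "b1 c \<in> Forms (\<lambda>_. Suc \<delta>)" if "c < N" for c
    unfolding b1 by (rule Forms_Suc[OF x1 b0[OF that]])
  have A: "\<chi> (x01 * P) = \<phi> P" if "P \<in> Forms (\<lambda>_. Suc \<delta>)" for P
  proof -
    have "\<chi> (x01 * P) = 1 * \<phi> P"
      by (rule inj_at_scaled[OF inj1 clin_mult_left[OF \<chi>(1)] annihilates_shift[OF \<chi>(2) x1] \<phi>(1,2) _ that])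
        (simp add: b2[symmetric] \<chi>(3) \<phi>(3))
    then show ?thesis by simp
  qed
  have B: "\<phi> (hform \<xi> * P) = l a * \<phi> (x01 * P)" if "P \<in> Forms (\<lambda>_. \<delta>)" for P
    by (rule inj_at_scaled[OF inj0 clin_mult_left[OF \<phi>(1)] annihilates_shift[OF \<phi>(2) h]
          clin_mult_left[OF \<phi>(1)] annihilates_shift[OF \<phi>(2) x1] _ that])
      (simp add: T[OF \<phi>(1,2), symmetric] b1[symmetric] \<phi>(3) eig a)
  have C: "\<chi> (hform \<xi> * P) = l a * \<chi> (x01 * P)" if "P \<in> Forms (\<lambda>_. Suc \<delta>)" for P
  proof (rule inj_at_scaled[OF inj1 clin_mult_left[OF \<chi>(1)] annihilates_shift[OF \<chi>(2) h]
          clin_mult_left[OF \<chi>(1)] annihilates_shift[OF \<chi>(2) x1] _ that])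
    fix c assume c: "c < N"
    have "\<chi> (hform \<xi> * b1 c) = \<chi> (x01 * (hform \<xi> * b0 c))" by (simp add: b1 mult.left_commute)
    also have "\<dots> = \<phi> (hform \<xi> * b0 c)" by (rule A[OF Forms_Suc[OF h b0[OF c]]])
    also have "\<dots> = l a * \<phi> (b1 c)" by (simp add: B[OF b0[OF c]] b1)
    also have "\<dots> = l a * \<chi> (x01 * b1 c)" by (simp add: A[OF b1F[OF c]])
    finally show "\<chi> (hform \<xi> * b1 c) = l a * \<chi> (x01 * b1 c)" .
  qed
  have "\<exists>s. \<forall>P\<in>Forms (\<lambda>_. Suc \<delta>). \<chi> (Yform y * P) = s * \<phi> P" if y: "y \<in> vars" for y
  proof -
    note Y = Yform_in_Forms[OF y]
    note w = clin_mult_left[OF \<chi>(1), of "Yform y"] annihilates_shift[OF \<chi>(2) Y]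
    have "(\<Sum>c'<N. T c c' * \<chi> (Yform y * b1 c')) = l a * \<chi> (Yform y * b1 c)" if c: "c < N" for c
    proof -
      have "(\<Sum>c'<N. T c c' * \<chi> (Yform y * b1 c')) = \<chi> (Yform y * (hform \<xi> * b0 c))"
        by (rule T[OF w c])
      also have "\<dots> = \<chi> (hform \<xi> * (Yform y * b0 c))" by (simp add: mult.left_commute)
      also have "\<dots> = l a * \<chi> (x01 * (Yform y * b0 c))" by (rule C[OF Forms_Suc[OF Y b0[OF c]]])
      also have "\<dots> = l a * \<chi> (Yform y * b1 c)" by (simp add: b1 mult.left_commute)
      finally show ?thesis .
    qed
    then have "(\<exists>b<N. l b = l a \<and> (\<exists>s. \<forall>c<N. \<chi> (Yform y * b1 c) = s * v b c)) \<or> (\<forall>c<N. \<chi> (Yform y * b1 c) = 0)"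
      by (intro simple_spectrum[where A = T and l = l and v = v] l_inj eig nz) auto
    then obtain s where s: "\<And>c. c < N \<Longrightarrow> \<chi> (Yform y * b1 c) = s * v a c"
    proof
      assume "\<exists>b<N. l b = l a \<and> (\<exists>s. \<forall>c<N. \<chi> (Yform y * b1 c) = s * v b c)"
      then obtain b s where bs: "b < N" "l b = l a" "\<forall>c<N. \<chi> (Yform y * b1 c) = s * v b c" by blast
      then have "b = a" using inj_onD[OF l_inj, of b a] a by auto
      with bs that show thesis by blast
    next
      assume "\<forall>c<N. \<chi> (Yform y * b1 c) = 0"
      then show thesis using that[of 0] by simp
    qed
    have "\<chi> (Yform y * P) = s * \<phi> P" if "P \<in> Forms (\<lambda>_. Suc \<delta>)" for P
      by (rule inj_at_scaled[OF inj1 w \<phi>(1,2) _ that]) (simp add: s \<phi>(3))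
    then show ?thesis by blast
  qed
  then have "\<forall>y\<in>vars. \<exists>s. \<forall>P\<in>Forms (\<lambda>_. Suc \<delta>). \<chi> (Yform y * P) = s * \<phi> P" by blast
  from bchoice[OF this] obtain s where
    s: "\<And>y P. y \<in> vars \<Longrightarrow> P \<in> Forms (\<lambda>_. Suc \<delta>) \<Longrightarrow> \<chi> (Yform y * P) = s y * \<phi> P" by blast
  \<comment> \<open>The value 1 at index 0 agrees with \<open>Yform (j, 0) = x01\<close>.\<close>
  define x where "x y = (if y \<notin> vars then 0 else if snd y = 0 then 1 else s y)" for y
  have nx: "normalized x" by (auto simp: normalized_def x_def vars_def)
  have E: "\<phi> (Yform y * P) = x y * \<phi> (x01 * P)" if y: "y \<in> vars" and P: "P \<in> Forms (\<lambda>_. \<delta>)" for y P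
  proof (cases "snd y = 0")
    case True
    then have "Yform y = x01" using y Yform_0[of "fst y"] by (cases y) (auto simp: vars_def)
    then show ?thesis using True y by (simp add: x_def)
  next
    case False
    have "\<phi> (Yform y * P) = \<chi> (x01 * (Yform y * P))"
      by (rule A[OF Forms_Suc[OF Yform_in_Forms[OF y] P], symmetric])
    also have "\<dots> = \<chi> (Yform y * (x01 * P))" by (simp add: mult.left_commute)
    also have "\<dots> = s y * \<phi> (x01 * P)" by (rule s[OF y Forms_Suc[OF x1 P]])
    finally show ?thesis using False y by (simp add: x_def)
  qed
  define c0 where "c0 = \<phi> (x01 * x0 (\<lambda>_. \<delta>))"
  have F: "\<phi> (x01 * single \<mu> 1) = mon_eval x \<mu> * c0" if "\<mu> \<in> Mon (\<lambda>_. \<delta>)" for \<mu>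
    using that
  proof (induction rule: Mon_shift_induct)
    case base
    show ?case using nx by (simp add: mon_eval_x0m normalized_def c0_def x0_def)
  next
    case (shift j l' \<mu>')
    have jk: "j < k" using shift by (simp add: vars_def)
    have split: "single (single (j, i) 1 + \<mu>') (1 :: complex) = mvar (j, i) * single \<mu>' 1" for i
      by (simp add: mvar_def mult_single)
    \<comment> \<open>\<open>x01\<close> lends its factor x_j0, which trades places with x_jl' and
      so completes the coordinate form.\<close>
    have "x01 * single (single (j, l') 1 + \<mu>') 1 = Yform (j, l') * (single (single (j, 0) 1 + \<mu>') 1)"
      unfolding x01_split[OF jk] Yform_def split fst_conv by (simp only: mult_ac)
    then have "\<phi> (x01 * single (single (j, l') 1 + \<mu>') 1) = x (j, l') * \<phi> (x01 * single (single (j, 0) 1 + \<mu>') 1)"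
      using E[OF shift(1) Forms_single[OF shift(6)], of 1] by (simp only:)
    also have "\<dots> = mon_eval x (single (j, l') 1 + \<mu>') * c0"
      using shift(7) nx jk by (simp add: mon_eval_add normalized_def)
    finally show ?case .
  qed
  have Gq: "\<phi> (x01 * P) = mpoly_eval x P * c0" if P: "P \<in> Forms (\<lambda>_. \<delta>)" for P
  proof -
    have "\<phi> (x01 * P) = (\<Sum>\<mu>\<in>keys P. lookup P \<mu> * \<phi> (x01 * single \<mu> 1))"
      by (rule clin_expand[OF clin_mult_left[OF \<phi>(1)]])
    also have "\<dots> = (\<Sum>\<mu>\<in>keys P. (lookup P \<mu> * mon_eval x \<mu>) * c0)"
      by (rule sum.cong[OF refl]) (use P F in \<open>auto simp: Forms_def\<close>)
    also have "\<dots> = mpoly_eval x P * c0" by (simp add: mpoly_eval_alt sum_distrib_right)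
    finally show ?thesis .
  qed
  have c0: "c0 \<noteq> 0"
  proof
    assume z: "c0 = 0"
    obtain c where c: "c < N" "v a c \<noteq> 0" using nz[OF a] by blast
    have "v a c = \<phi> (x01 * b0 c)" using \<phi>(3)[OF c(1)] by (simp add: b1)
    with Gq[OF b0[OF c(1)]] z c show False by simp
  qed
  have "mpoly_eval x (Eqn \<theta> e) = 0" if e: "e \<in> I" for e
  proof -
    let ?P = "Eqn \<theta> e * x0 (\<lambda>i. \<delta> - dg e i)"
    have "?P \<in> Forms (\<lambda>i. dg e i + (\<delta> - dg e i))"
      by (intro Forms_mult Eqn_in_Forms x0_in_Forms)
    also have "\<dots> = Forms (\<lambda>_. \<delta>)" by (rule Forms_cong) (use fits e in \<open>simp add: fits_def\<close>)
    finally have "\<phi> (x01 * ?P) = mpoly_eval x ?P * c0" by (rule Gq)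
    moreover have "x01 * ?P = Eqn \<theta> e * (x01 * x0 (\<lambda>i. \<delta> - dg e i))" by (simp add: mult.left_commute)
    moreover have "\<phi> (Eqn \<theta> e * (x01 * x0 (\<lambda>i. \<delta> - dg e i))) = 0"
      by (rule annihilatesD[OF \<phi>(2) _ _ Forms_mult[OF x1 x0_in_Forms], of "dg e"])
        (use e fits in \<open>auto simp: sys_def fits_def\<close>)
    ultimately show ?thesis using c0 by (simp add: mpe.hom_mult mpoly_eval_x0_normalized[OF nx] mpoly_eval_x01[OF nx])
  qed
  then have "x \<in> sols \<theta>" using nx by (simp add: sols_def)
  moreover have "mpoly_eval x (hform \<xi>) = l a"
  proof -
    let ?P = "x0 (\<lambda>_. \<delta>) :: (nat \<times> nat, complex) mpoly"
    have "l a * c0 = \<phi> (hform \<xi> * ?P)" using B[OF x0_in_Forms] by (simp add: c0_def)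
    also have "\<dots> = (\<Sum>y\<in>vars. \<xi> ^ prod_encode y * \<phi> (Yform y * ?P))"
      by (simp add: hform_def sum_distrib_right clin_sum[OF \<phi>(1)] mult.assoc clin_scale[OF \<phi>(1)])
    also have "\<dots> = (\<Sum>y\<in>vars. (\<xi> ^ prod_encode y * x y) * c0)"
      by (rule sum.cong[OF refl]) (simp add: E x0_in_Forms c0_def)
    also have "\<dots> = mpoly_eval x (hform \<xi>) * c0"
      by (simp add: mpoly_eval_hform[OF nx] sum_distrib_right)
    finally show ?thesis using c0 by simp
  qed
  ultimately show ?thesis by blast
qed

text \<open>Surjectivity is \<open>eigen_point\<close>. Two solutions with the same value of
  \<open>hform\<close> belong to the same eigenvector, so their evaluations are proportional in
  degree \<delta> + 1; the value 1 at \<open>x0\<close> fixes the factor and the coordinate forms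
  recover the points.\<close>

lemma solutions_bij: "bij_betw (\<lambda>x. mpoly_eval x (hform \<xi>)) (sols \<theta>) (l ` {..<N})"
proof -
  have sp: "\<exists>b<N. l b = mpoly_eval x (hform \<xi>) \<and> (\<exists>s. \<forall>c<N. mpoly_eval x (b1 c) = s * v b c)" if x: "x \<in> sols \<theta>" for x
  proof -
    have "(\<exists>b<N. l b = mpoly_eval x (hform \<xi>) \<and> (\<exists>s. \<forall>c<N. mpoly_eval x (b1 c) = s * v b c)) \<or> (\<forall>c<N. mpoly_eval x (b1 c) = 0)"
      by (intro simple_spectrum[where A = T and l = l and v = v] l_inj eig nz point_eigenvector(1)[OF x])
    then show ?thesis using point_eigenvector(2)[OF x] by blast
  qed
  have "inj_on (\<lambda>x. mpoly_eval x (hform \<xi>)) (sols \<theta>)"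
  proof (rule inj_onI)
    fix x y assume x: "x \<in> sols \<theta>" and y: "y \<in> sols \<theta>" and eq: "mpoly_eval x (hform \<xi>) = mpoly_eval y (hform \<xi>)"
    obtain b s where b: "b < N" "l b = mpoly_eval x (hform \<xi>)" "\<forall>c<N. mpoly_eval x (b1 c) = s * v b c"
      using sp[OF x] by blast
    obtain b' s' where b': "b' < N" "l b' = mpoly_eval y (hform \<xi>)" "\<forall>c<N. mpoly_eval y (b1 c) = s' * v b' c"
      using sp[OF y] by blast
    have bb: "b' = b" using inj_onD[OF l_inj, of b b'] b b' eq by auto
    have s': "s' \<noteq> 0" using point_eigenvector(2)[OF y] b' by auto
    have nx: "normalized x" "normalized y" using x y by (auto simp: sols_def)
    have ann: "annihilates (mpoly_eval z) (sys \<theta>) D" if "z \<in> sols \<theta>" for z D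
      by (rule annihilates_evaluation) (use that in \<open>simp add: sols_def\<close>)
    have ev: "mpoly_eval x P = s / s' * mpoly_eval y P" if "P \<in> Forms (\<lambda>_. Suc \<delta>)" for P
      by (rule inj_at_scaled[OF inj1 clin_mpoly_eval ann[OF x] clin_mpoly_eval ann[OF y] _ that])
        (use b b' bb s' in simp)
    have one: "s / s' = 1"
      using ev[OF x0_in_Forms] by (simp add: mpoly_eval_x0_normalized[OF nx(1)] mpoly_eval_x0_normalized[OF nx(2)])
    show "x = y"
    proof
      fix z show "x z = y z"
      proof (cases "z \<in> vars")
        case True
        then show ?thesis
          using ev[OF Forms_Suc[OF Yform_in_Forms[OF True] x0_in_Forms]] unfolding one
          by (simp add: mpe.hom_mult mpoly_eval_x0_normalized[OF nx(1)] mpoly_eval_x0_normalized[OF nx(2)]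
              mpoly_eval_Yform[OF nx(1)] mpoly_eval_Yform[OF nx(2)])
      next
        case False
        then show ?thesis using nx by (cases z) (simp add: normalized_def)
      qed
    qed
  qed
  moreover have "(\<lambda>x. mpoly_eval x (hform \<xi>)) ` sols \<theta> = l ` {..<N}"
  proof (intro equalityI subsetI)
    fix z assume "z \<in> (\<lambda>x. mpoly_eval x (hform \<xi>)) ` sols \<theta>"
    then obtain x where x: "x \<in> sols \<theta>" "z = mpoly_eval x (hform \<xi>)" by blast
    obtain b where "b < N" "l b = z" using sp[OF x(1)] x(2) by blast
    then show "z \<in> l ` {..<N}" by blast
  next
    fix z assume "z \<in> l ` {..<N}"
    then obtain a where a: "a < N" "z = l a" by auto
    obtain x where "x \<in> sols \<theta>" "mpoly_eval x (hform \<xi>) = l a" using eigen_point[OF a(1)] by blast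
    then show "z \<in> (\<lambda>x. mpoly_eval x (hform \<xi>)) ` sols \<theta>" using a(2) by (intro image_eqI[of _ _ x]) simp_all
  qed
  ultimately show ?thesis by (simp add: bij_betw_def)
qed

end

section \<open>The generic number of solutions\<close>

context param_system
begin

lemma inj_at_generic:
  assumes "solves_identity D N bD g U \<Phi>" "fits D" "\<forall>c<N. bD c \<in> Forms D" "mpoly_eval \<theta> g \<noteq> 0"
  shows "inj_at (sys \<theta>) D N bD"
  unfolding inj_at_def
proof (intro allI impI ballI)
  fix \<phi> and P :: "(nat \<times> nat, complex) mpoly"
  assume \<phi>: "clin \<phi>" "annihilates \<phi> (sys \<theta>) D" "\<forall>c<N. \<phi> (bD c) = 0" and P: "P \<in> Forms D"
  show "\<phi> P = 0"
    by (rule clin_zero_on_Forms[OF \<phi>(1) _ P])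
      (use functional_rep[OF assms(1-3) \<phi>(1,2)] \<phi>(3) assms(4) in simp)
qed

lemma mpoly_eval_of_nat: "mpoly_eval x (of_nat m) = of_nat m"
  by (induction m) (simp_all add: mpe.hom_add)

text \<open>The open condition consists of the determinants in degrees \<delta>, \<delta> + 1,
  \<delta> + 2 and of the discriminant \<open>r\<close> of the multiplication matrix. Off its zero
  set there are N eigenvectors with distinct eigenvalues, hence N solutions.\<close>

lemma generic_count:
  assumes B: "spanned (sys \<theta>0) B \<Gamma>" "length B = N" "\<forall>(\<gamma>, b)\<in>set B. b \<in> Forms \<gamma>"
    and p: "\<And>a. a < N \<Longrightarrow> normalized (p a)" "inj_on p {..<N}" "formal_solutions \<theta>0 N p"
  shows "\<exists>g. mpoly_eval \<theta>0 g \<noteq> 0 \<and> (\<forall>\<theta>. mpoly_eval \<theta> g \<noteq> 0 \<longrightarrow>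
    finite (sols \<theta>) \<and> card (sols \<theta>) = N \<and>
    (\<forall>x. (\<forall>e\<in>I. mpoly_eval x (Eqn \<theta> e) = 0) \<longrightarrow> (\<forall>j<k. \<exists>l\<le>n j. x (j, l) \<noteq> 0) \<longrightarrow> (\<forall>j<k. x (j, 0) \<noteq> 0)))"
proof -
  define \<gamma> where "\<gamma> c = fst (B ! c)" for c
  define \<beta> where "\<beta> c = snd (B ! c)" for c
  have set_B: "(\<gamma> c, \<beta> c) \<in> set B" if "c < N" for c
    using that B(2) by (auto simp: \<gamma>_def \<beta>_def)
  have B_set: "\<exists>c<N. g = \<gamma> c \<and> b = \<beta> c" if "(g, b) \<in> set B" for g b
    using that B(2) by (metis \<beta>_def \<gamma>_def fst_conv snd_conv in_set_conv_nth)
  \<comment> \<open>Each summand serves one purpose: spanning by \<open>B\<close>, independence of N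
    evaluations, and domination of the degrees of the equations and of \<open>B\<close>.\<close>
  define \<delta> where "\<delta> = \<Gamma> + N + (\<Sum>e\<in>I. \<Sum>i<k. dg e i) + (\<Sum>c<N. \<Sum>i<k. \<gamma> c i)"
  have dg_le: "dg e i \<le> \<delta>" if "e \<in> I" "i < k" for e i
  proof -
    have "dg e i \<le> (\<Sum>i<k. dg e i)" by (rule member_le_sum) (use that in auto)
    also have "\<dots> \<le> (\<Sum>e\<in>I. \<Sum>i<k. dg e i)" by (rule member_le_sum) (use that finite_I in auto)
    finally show ?thesis by (simp add: \<delta>_def)
  qed
  have \<gamma>_le: "\<gamma> c i \<le> \<delta>" if "c < N" "i < k" for c i
  proof -
    have "\<gamma> c i \<le> (\<Sum>i<k. \<gamma> c i)" by (rule member_le_sum) (use that in auto)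
    also have "\<dots> \<le> (\<Sum>c<N. \<Sum>i<k. \<gamma> c i)" by (rule member_le_sum) (use that in auto)
    finally show ?thesis by (simp add: \<delta>_def)
  qed
  have fits: "fits (\<lambda>_. \<delta> + m)" for m
    using dg_le by (auto simp: fits_def intro: trans_le_add1)
  define bD where "bD m c = \<beta> c * x0 (\<lambda>i. \<delta> + m - \<gamma> c i)" for m c
  have bD_Forms: "\<forall>c<N. bD m c \<in> Forms (\<lambda>_. \<delta> + m)" for m
  proof (intro allI impI)
    fix c assume c: "c < N"
    have "bD m c \<in> Forms (\<lambda>i. \<gamma> c i + (\<delta> + m - \<gamma> c i))"
      unfolding bD_def using B(3) set_B[OF c] by (intro Forms_mult x0_in_Forms) auto
    also have "\<dots> = Forms (\<lambda>_. \<delta> + m)"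
      by (rule Forms_cong) (use \<gamma>_le[OF c] in \<open>simp add: trans_le_add1\<close>)
    finally show "bD m c \<in> Forms (\<lambda>_. \<delta> + m)" .
  qed
  have bD_Suc: "bD (Suc m) c = x01 * bD m c" if c: "c < N" for m c
  proof -
    have "x0 (\<lambda>i. \<delta> + Suc m - \<gamma> c i) = x0 (\<lambda>i. 1 + (\<delta> + m - \<gamma> c i))"
      by (rule x0_cong) (use \<gamma>_le[OF c] in \<open>simp add: Suc_diff_le trans_le_add1\<close>)
    also have "\<dots> = x01 * x0 (\<lambda>i. \<delta> + m - \<gamma> c i)" unfolding x01_def by (rule x0_add)
    finally show ?thesis by (simp only: bD_def mult.left_commute)
  qed
  have sp: "\<phi> P = 0" if \<phi>: "clin \<phi>" "annihilates \<phi> (sys \<theta>0) (\<lambda>_. \<delta> + m)" "\<And>c. c < N \<Longrightarrow> \<phi> (bD m c) = 0"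
    and P: "P \<in> Forms (\<lambda>_. \<delta> + m)" for \<phi> P m
  proof (rule spannedD[OF B(1) _ \<phi>(1,2) _ P])
    show "\<Gamma> \<le> \<delta> + m" by (simp add: \<delta>_def)
    fix g b assume "(g, b) \<in> set B"
    then obtain c where "c < N" "g = \<gamma> c" "b = \<beta> c" using B_set by blast
    with \<phi>(3)[of c] show "\<phi> (b * x0 (\<lambda>i. \<delta> + m - g i)) = 0" by (simp add: bD_def)
  qed
  have "\<exists>g U \<Phi>. mpoly_eval \<theta>0 g \<noteq> 0 \<and> solves_identity (\<lambda>_. \<delta> + m) N (bD m) g U \<Phi>" for m
  proof -
    obtain g' U' \<Phi>' where "mpoly_eval \<theta>0 g' \<noteq> 0" "solves_identity (\<lambda>_. \<delta> + m) N (bD m) g' U' \<Phi>'"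
    proof (rule solves_identity_exists[where ?\<theta>0.0 = \<theta>0 and D = "\<lambda>_. \<delta> + m" and N = N and bD = "bD m", OF fits])
      fix \<phi> and P :: "(nat \<times> nat, complex) mpoly"
      assume "clin \<phi>" "annihilates \<phi> (sys \<theta>0) (\<lambda>_. \<delta> + m)" "\<And>c. c < N \<Longrightarrow> \<phi> (bD m c) = 0" "P \<in> Forms (\<lambda>_. \<delta> + m)"
      then show "\<phi> P = 0" by (rule sp)
    qed blast
    then show ?thesis by blast
  qed
  then obtain g U \<Phi> where g0: "\<And>m. mpoly_eval \<theta>0 (g m) \<noteq> 0"
    and id: "\<And>m. solves_identity (\<lambda>_. \<delta> + m) N (bD m) (g m) (U m) (\<Phi> m)"
    by metis
  obtain \<xi> :: complex where \<xi>: "inj_on (\<lambda>a. mpoly_eval (p a) (hform \<xi>)) {..<N}"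
    by (rule separating_hform[where N = N and p = p]) (use p in auto)
  define hb where "hb c = hform \<xi> * bD 0 c" for c
  have hb: "hb c \<in> Forms (\<lambda>_. \<delta> + 1)" if "c < N" for c
    using Forms_Suc[OF hform_in_Forms, of "bD 0 c" \<delta> \<xi>] bD_Forms[of 0] that by (simp add: hb_def)
  \<comment> \<open>Since \<Phi> expresses g times a monomial, these entries are those of the
    multiplication matrix times \<open>g 1\<close>, and remain polynomial in the parameters.\<close>
  define Tm where "Tm = mat N N (\<lambda>(c, a). \<Sum>\<mu>\<in>Mon (\<lambda>_. \<delta> + 1). cst (lookup (hb c) \<mu>) * \<Phi> 1 \<mu> a)"
  have Tm: "Tm \<in> carrier_mat N N" by (simp add: Tm_def)
  define dchi where "dchi = (\<Sum>i<N. Polynomial.monom (of_nat (Suc i) * coeff (char_poly Tm) (Suc i)) i)"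
  \<comment> \<open>The Sylvester matrix has the fixed sizes N and N - 1, so it commutes with
    specialization; as characteristic polynomials are monic, these are always the actual
    degrees.\<close>
  define r where "r = det (sylvester_mat_sub N (N - 1) (char_poly Tm) dchi)"
  define TC where "TC \<theta> = map_mat (mpoly_eval \<theta>) Tm" for \<theta>
  have TC: "TC \<theta> \<in> carrier_mat N N" for \<theta> using Tm by (simp add: TC_def)
  define chi where "chi \<theta> = char_poly (TC \<theta>)" for \<theta>
  have chi_deg: "degree (chi \<theta>) = N" "chi \<theta> \<noteq> 0" for \<theta>
    using degree_monic_char_poly[OF TC[of \<theta>]] by (auto simp: chi_def)
  have chi_hom: "chi \<theta> = map_poly (mpoly_eval \<theta>) (char_poly Tm)" for \<theta>
    unfolding chi_def TC_def by (rule comm_ring_hom.char_poly_hom[OF mpe.comm_ring_hom_axioms Tm])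
  have r_eval: "mpoly_eval \<theta> r = resultant (chi \<theta>) (pderiv (chi \<theta>))" for \<theta>
  proof -
    have "map_poly (mpoly_eval \<theta>) dchi = pderiv (chi \<theta>)"
    proof (rule poly_eqI)
      fix i
      have "coeff (map_poly (mpoly_eval \<theta>) dchi) i = mpoly_eval \<theta> (\<Sum>j<N. if j = i then of_nat (Suc i) * coeff (char_poly Tm) (Suc i) else 0)"
        by (simp add: coeff_map_poly dchi_def coeff_sum if_distrib cong: if_cong)
      also have "\<dots> = (if i < N then of_nat (Suc i) * coeff (chi \<theta>) (Suc i) else 0)"
        by (simp add: chi_hom coeff_map_poly mpe.hom_mult mpoly_eval_of_nat del: of_nat_Suc)
      also have "\<dots> = coeff (pderiv (chi \<theta>)) i"
        using coeff_eq_0[of "chi \<theta>" "Suc i"] chi_deg(1)[of \<theta>] by (auto simp: coeff_pderiv)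
      finally show "coeff (map_poly (mpoly_eval \<theta>) dchi) i = coeff (pderiv (chi \<theta>)) i" .
    qed
    moreover have "degree (pderiv (chi \<theta>)) = N - 1"
      by (simp add: degree_pderiv chi_deg)
    moreover have "mpoly_eval \<theta> r = det (map_mat (mpoly_eval \<theta>) (sylvester_mat_sub N (N - 1) (char_poly Tm) dchi))"
      by (simp add: r_def)
    ultimately show ?thesis
      by (simp add: sylvester_mat_sub_map chi_hom[symmetric] resultant_sub resultant_sub_def chi_deg)
  qed
  define T where "T \<theta> c a = TC \<theta> $$ (c, a) / mpoly_eval \<theta> (g 1)" for \<theta> c a
  have data: "eigen_data k n I dg Ec \<theta> \<delta> N (bD 0) (\<lambda>c. x01 * bD 0 c) (\<lambda>c. x01 * (x01 * bD 0 c)) \<xi> (T \<theta>)"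
    if g: "mpoly_eval \<theta> (g 0) \<noteq> 0" "mpoly_eval \<theta> (g 1) \<noteq> 0" "mpoly_eval \<theta> (g 2) \<noteq> 0" for \<theta>
  proof -
    have b1: "bD 1 c = x01 * bD 0 c" "bD 2 c = x01 * (x01 * bD 0 c)" if "c < N" for c
      using bD_Suc[OF that, of 0] bD_Suc[OF that, of 1] by (simp_all add: numeral_2_eq_2)
    have inj: "inj_at (sys \<theta>) (\<lambda>_. \<delta> + m) N (bD m)" if "mpoly_eval \<theta> (g m) \<noteq> 0" for m
      by (rule inj_at_generic[OF id fits bD_Forms that])
    have surj: "surj_at (sys \<theta>) (\<lambda>_. \<delta> + m) N (bD m)" if gm: "mpoly_eval \<theta> (g m) \<noteq> 0" for m
      unfolding surj_at_def
    proof
      fix z :: "nat \<Rightarrow> complex"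
      define \<psi> where "\<psi> = (\<lambda>a P. \<Sum>\<mu>\<in>Mon (\<lambda>_. \<delta> + m). lookup P \<mu> * mpoly_eval \<theta> (\<Phi> m \<mu> a))"
      have \<psi>: "clin (\<psi> a)" "annihilates (\<psi> a) (sys \<theta>) (\<lambda>_. \<delta> + m)"
        "\<And>c. c < N \<Longrightarrow> \<psi> a (bD m c) = (if a = c then mpoly_eval \<theta> (g m) else 0)" if "a < N" for a
        by (rule functionals_exist[where p = p and ?\<theta>0.0 = \<theta>0, OF id fits bD_Forms _ _ p(2,3) _ \<psi>_def that];
            (use sp p(1) \<delta>_def in auto))+
      define \<phi> where "\<phi> P = (\<Sum>a<N. (z a / mpoly_eval \<theta> (g m)) * \<psi> a P)" for P
      have "clin \<phi>" unfolding \<phi>_def by (rule clin_sum_functional) (use \<psi> in auto)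
      moreover have "annihilates \<phi> (sys \<theta>) (\<lambda>_. \<delta> + m)"
        unfolding \<phi>_def by (rule annihilates_sum) (use \<psi> in auto)
      moreover have "\<phi> (bD m c) = z c" if c: "c < N" for c
      proof -
        have "\<phi> (bD m c) = (\<Sum>a<N. if a = c then z c else 0)"
          unfolding \<phi>_def by (rule sum.cong[OF refl]) (use \<psi>(3)[OF _ c] gm in auto)
        with c show ?thesis by simp
      qed
      ultimately show "\<exists>\<phi>. clin \<phi> \<and> annihilates \<phi> (sys \<theta>) (\<lambda>_. \<delta> + m) \<and> (\<forall>c<N. \<phi> (bD m c) = z c)"
        by blast
    qed
    have T: "(\<Sum>c'<N. T \<theta> c c' * \<phi> (x01 * bD 0 c')) = \<phi> (hform \<xi> * bD 0 c)"
      if \<phi>: "clin \<phi>" "annihilates \<phi> (sys \<theta>) (\<lambda>_. Suc \<delta>)" and c: "c < N" for \<phi> c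
    proof -
      have ann: "annihilates \<phi> (sys \<theta>) (\<lambda>_. \<delta> + 1)" using \<phi>(2) by simp
      have TCe: "TC \<theta> $$ (c, c') = (\<Sum>\<mu>\<in>Mon (\<lambda>_. \<delta> + 1). lookup (hb c) \<mu> * mpoly_eval \<theta> (\<Phi> 1 \<mu> c'))" if "c' < N" for c'
        using c that by (simp add: TC_def Tm_def mpe.hom_sum mpe.hom_mult)
      have "(\<Sum>c'<N. T \<theta> c c' * \<phi> (x01 * bD 0 c')) = (\<Sum>c'<N. \<phi> (bD 1 c') / mpoly_eval \<theta> (g 1) *
          (\<Sum>\<mu>\<in>Mon (\<lambda>_. \<delta> + 1). lookup (hb c) \<mu> * mpoly_eval \<theta> (\<Phi> 1 \<mu> c')))"
        by (rule sum.cong[OF refl]) (simp add: T_def TCe b1 del: One_nat_def)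
      also have "\<dots> = (\<Sum>\<mu>\<in>Mon (\<lambda>_. \<delta> + 1). lookup (hb c) \<mu> *
          (\<Sum>c'<N. \<phi> (bD 1 c') / mpoly_eval \<theta> (g 1) * mpoly_eval \<theta> (\<Phi> 1 \<mu> c')))"
        by (rule sum_mult_swap)
      also have "\<dots> = (\<Sum>\<mu>\<in>Mon (\<lambda>_. \<delta> + 1). lookup (hb c) \<mu> * \<phi> (single \<mu> 1))"
      proof (rule sum.cong[OF refl])
        fix \<mu> assume \<mu>: "\<mu> \<in> Mon (\<lambda>_. \<delta> + 1)"
        have "mpoly_eval \<theta> (g 1) * \<phi> (single \<mu> 1) = (\<Sum>c'<N. mpoly_eval \<theta> (\<Phi> 1 \<mu> c') * \<phi> (bD 1 c'))"
          by (rule functional_rep[OF id fits bD_Forms \<phi>(1) ann \<mu>])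
        then have "\<phi> (single \<mu> 1) = (\<Sum>c'<N. mpoly_eval \<theta> (\<Phi> 1 \<mu> c') * \<phi> (bD 1 c')) / mpoly_eval \<theta> (g 1)"
          using g(2) by (simp add: field_simps)
        also have "\<dots> = (\<Sum>c'<N. \<phi> (bD 1 c') / mpoly_eval \<theta> (g 1) * mpoly_eval \<theta> (\<Phi> 1 \<mu> c'))"
          unfolding sum_divide_distrib by (rule sum.cong[OF refl]) simp
        finally show "lookup (hb c) \<mu> * (\<Sum>c'<N. \<phi> (bD 1 c') / mpoly_eval \<theta> (g 1) * mpoly_eval \<theta> (\<Phi> 1 \<mu> c')) =
            lookup (hb c) \<mu> * \<phi> (single \<mu> 1)" by simp
      qed
      also have "\<dots> = \<phi> (hb c)"
        unfolding clin_expand[OF \<phi>(1), of "hb c"]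
        by (rule sum.mono_neutral_right[OF finite_Mon]) (use hb[OF c] in \<open>auto simp: Forms_def in_keys_iff\<close>)
      finally show ?thesis by (simp add: hb_def)
    qed
    have cong: "inj_at S D N b \<longleftrightarrow> inj_at S D N b'" "surj_at S D N b \<longleftrightarrow> surj_at S D N b'"
      if "\<forall>c<N. b c = b' c" for S D b b'
      using that by (simp_all add: inj_at_def surj_at_def)
    have b1': "\<forall>c<N. bD 1 c = x01 * bD 0 c" and b2': "\<forall>c<N. bD 2 c = x01 * (x01 * bD 0 c)"
      using b1 by blast+
    have "inj_at (sys \<theta>) (\<lambda>_. Suc \<delta>) N (\<lambda>c. x01 * bD 0 c)" "surj_at (sys \<theta>) (\<lambda>_. Suc \<delta>) N (\<lambda>c. x01 * bD 0 c)"
      using inj[OF g(2)] surj[OF g(2)] unfolding cong(1)[OF b1'] cong(2)[OF b1'] by simp_all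
    moreover have "surj_at (sys \<theta>) (\<lambda>_. Suc (Suc \<delta>)) N (\<lambda>c. x01 * (x01 * bD 0 c))"
      using surj[OF g(3)] unfolding cong(2)[OF b2'] by simp
    ultimately show ?thesis
      using inj[OF g(1)] fits[of 0] bD_Forms[of 0] T by unfold_locales auto
  qed
  have eig: "\<exists>l v. eigen_basis k n I dg Ec \<theta> \<delta> N (bD 0) (\<lambda>c. x01 * bD 0 c) (\<lambda>c. x01 * (x01 * bD 0 c)) \<xi> (T \<theta>) l v"
    if g: "mpoly_eval \<theta> (g 0) \<noteq> 0" "mpoly_eval \<theta> (g 1) \<noteq> 0" "mpoly_eval \<theta> (g 2) \<noteq> 0" and r: "mpoly_eval \<theta> r \<noteq> 0" for \<theta>
  proof -
    let ?R = "{z. poly (chi \<theta>) z = 0}"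
    have "card ?R = N"
      using r resultant_pderiv_nonzero_iff[OF chi_deg(2), of \<theta>] by (simp add: r_eval chi_deg)
    then obtain l where l: "bij_betw l {..<N} ?R"
      using ex_bij_betw_nat_finite[OF poly_roots_finite[OF chi_deg(2)[of \<theta>]]] by (metis atLeast0LessThan)
    have "\<exists>w. w \<in> carrier_vec N \<and> w \<noteq> 0\<^sub>v N \<and> TC \<theta> *\<^sub>v w = l a \<cdot>\<^sub>v w" if "a \<in> {..<N}" for a
    proof -
      have "poly (char_poly (TC \<theta>)) (l a) = 0" using l that by (auto simp: bij_betw_def chi_def)
      then have "eigenvalue (TC \<theta>) (l a)" using eigenvalue_root_char_poly[OF TC] by blast
      then show ?thesis using TC[of \<theta>] by (auto simp: eigenvalue_def eigenvector_def)
    qed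
    then have "\<forall>a\<in>{..<N}. \<exists>w. w \<in> carrier_vec N \<and> w \<noteq> 0\<^sub>v N \<and> TC \<theta> *\<^sub>v w = l a \<cdot>\<^sub>v w" by blast
    from bchoice[OF this] obtain w where
      w: "\<And>a. a < N \<Longrightarrow> w a \<in> carrier_vec N \<and> w a \<noteq> 0\<^sub>v N \<and> TC \<theta> *\<^sub>v w a = l a \<cdot>\<^sub>v w a" by auto
    have wdim: "dim_vec (w a) = N" and weig: "TC \<theta> *\<^sub>v w a = l a \<cdot>\<^sub>v w a" if "a < N" for a
      using w[OF that] by (auto dest: carrier_vecD)
    interpret eigen_data k n I dg Ec \<theta> \<delta> N "bD 0" "\<lambda>c. x01 * bD 0 c" "\<lambda>c. x01 * (x01 * bD 0 c)" \<xi> "T \<theta>"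
      by (rule data[OF g])
    have "eigen_basis k n I dg Ec \<theta> \<delta> N (bD 0) (\<lambda>c. x01 * bD 0 c) (\<lambda>c. x01 * (x01 * bD 0 c)) \<xi> (T \<theta>)
        (\<lambda>a. l a / mpoly_eval \<theta> (g 1)) (\<lambda>a c. w a $ c)"
    proof unfold_locales
      show "inj_on (\<lambda>a. l a / mpoly_eval \<theta> (g 1)) {..<N}"
        using l g(2) by (auto simp: bij_betw_def inj_on_def)
    next
      fix a c assume ac: "a < N" "c < N"
      have "(\<Sum>c'<N. TC \<theta> $$ (c, c') * w a $ c') = (TC \<theta> *\<^sub>v w a) $ c"
        using ac conjunct1[OF w[OF ac(1)]] TC[of \<theta>] by (simp add: scalar_prod_def atLeast0LessThan)
      also have "\<dots> = l a * w a $ c" using ac(2) index_smult_vec(1)[of c "w a" "l a"] unfolding wdim[OF ac(1)] weig[OF ac(1)] by blast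
      finally have "(\<Sum>c'<N. TC \<theta> $$ (c, c') * w a $ c') / mpoly_eval \<theta> (g 1) = l a * w a $ c / mpoly_eval \<theta> (g 1)" by simp
      then show "(\<Sum>c'<N. T \<theta> c c' * w a $ c') = l a / mpoly_eval \<theta> (g 1) * w a $ c"
        by (simp add: T_def sum_divide_distrib)
    next
      fix a assume a: "a < N"
      show "\<exists>c<N. w a $ c \<noteq> 0"
      proof (rule ccontr)
        assume "\<not> ?thesis"
        then have "w a = 0\<^sub>v N" by (intro eq_vecI) (auto simp: wdim[OF a])
        with w[OF a] show False by blast
      qed
    qed
    then show ?thesis by blast
  qed
  \<comment> \<open>At \<theta>0 the N given points are solutions on which
    \<open>hform \<xi>\<close> takes distinct values, so the characteristic polynomial has N
    different roots.\<close>
  have r0: "mpoly_eval \<theta>0 r \<noteq> 0"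
  proof -
    interpret eigen_data k n I dg Ec \<theta>0 \<delta> N "bD 0" "\<lambda>c. x01 * bD 0 c" "\<lambda>c. x01 * (x01 * bD 0 c)" \<xi> "T \<theta>0"
      by (rule data[OF g0 g0 g0])
    let ?G = "mpoly_eval \<theta>0 (g 1)"
    have root: "poly (chi \<theta>0) (?G * mpoly_eval (p a) (hform \<xi>)) = 0" if a: "a < N" for a
    proof -
      have pa: "p a \<in> sols \<theta>0"
        using p(1)[OF a] formal_solutions_special[OF p(3) a] by (simp add: sols_def)
      define w where "w = vec N (\<lambda>c. mpoly_eval (p a) (x01 * bD 0 c))"
      have "w \<noteq> 0\<^sub>v N"
      proof
        assume "w = 0\<^sub>v N"
        then have "w $ c = 0" if "c < N" for c using that by simp
        then show False using point_eigenvector(2)[OF pa] by (auto simp: w_def)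
      qed
      moreover have "TC \<theta>0 *\<^sub>v w = (?G * mpoly_eval (p a) (hform \<xi>)) \<cdot>\<^sub>v w"
      proof (rule eq_vecI)
        fix c assume "c < dim_vec ((?G * mpoly_eval (p a) (hform \<xi>)) \<cdot>\<^sub>v w)"
        then have c: "c < N" by (simp add: w_def)
        have "(TC \<theta>0 *\<^sub>v w) $ c = (\<Sum>c'<N. ?G * (T \<theta>0 c c' * mpoly_eval (p a) (x01 * bD 0 c')))"
          using c TC[of \<theta>0] g0[of 1] by (simp add: scalar_prod_def atLeast0LessThan w_def T_def)
        also have "\<dots> = ?G * (\<Sum>c'<N. T \<theta>0 c c' * mpoly_eval (p a) (x01 * bD 0 c'))"
          by (rule sum_distrib_left[symmetric])
        also have "\<dots> = ?G * (mpoly_eval (p a) (hform \<xi>) * mpoly_eval (p a) (x01 * bD 0 c))"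
          by (simp only: point_eigenvector(1)[OF pa c])
        also have "\<dots> = ((?G * mpoly_eval (p a) (hform \<xi>)) \<cdot>\<^sub>v w) $ c"
        proof -
          have "w $ c = mpoly_eval (p a) (x01 * bD 0 c)" "c < dim_vec w" using c by (simp_all add: w_def)
          then show ?thesis by (simp only: index_smult_vec(1) mult.assoc)
        qed
        finally show "(TC \<theta>0 *\<^sub>v w) $ c = ((?G * mpoly_eval (p a) (hform \<xi>)) \<cdot>\<^sub>v w) $ c" .
      qed (use TC[of \<theta>0] in \<open>simp add: w_def\<close>)
      ultimately have "eigenvalue (TC \<theta>0) (?G * mpoly_eval (p a) (hform \<xi>))"
        using TC[of \<theta>0] unfolding eigenvalue_def eigenvector_def
        by (intro exI[of _ w] conjI) (simp_all add: w_def)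
      then show ?thesis using eigenvalue_root_char_poly[OF TC] by (simp add: chi_def)
    qed
    have inj: "inj_on (\<lambda>a. ?G * mpoly_eval (p a) (hform \<xi>)) {..<N}"
      using \<xi> g0[of 1] by (auto simp: inj_on_def)
    have fin: "finite {z. poly (chi \<theta>0) z = 0}" by (rule poly_roots_finite[OF chi_deg(2)])
    have "N = card ((\<lambda>a. ?G * mpoly_eval (p a) (hform \<xi>)) ` {..<N})"
      using card_image[OF inj] by simp
    also have "\<dots> \<le> card {z. poly (chi \<theta>0) z = 0}"
      by (rule card_mono[OF fin]) (use root in auto)
    finally have "card {z. poly (chi \<theta>0) z = 0} = degree (chi \<theta>0)"
      using poly_roots_degree[OF chi_deg(2), of \<theta>0] chi_deg(1)[of \<theta>0] by simp
    then show ?thesis using resultant_pderiv_nonzero_iff[OF chi_deg(2), of \<theta>0] by (simp add: r_eval)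
  qed
  show ?thesis
  proof (intro exI[of _ "g 0 * g 1 * g 2 * r"] conjI allI impI)
    show "mpoly_eval \<theta>0 (g 0 * g 1 * g 2 * r) \<noteq> 0"
      using g0 r0 by (simp add: mpe.hom_mult)
  next
    fix \<theta> assume "mpoly_eval \<theta> (g 0 * g 1 * g 2 * r) \<noteq> 0"
    then have g: "mpoly_eval \<theta> (g 0) \<noteq> 0" "mpoly_eval \<theta> (g 1) \<noteq> 0" "mpoly_eval \<theta> (g 2) \<noteq> 0" "mpoly_eval \<theta> r \<noteq> 0"
      by (auto simp: mpe.hom_mult)
    obtain l v where "eigen_basis k n I dg Ec \<theta> \<delta> N (bD 0) (\<lambda>c. x01 * bD 0 c) (\<lambda>c. x01 * (x01 * bD 0 c)) \<xi> (T \<theta>) l v"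
      using eig[OF g] by blast
    then interpret eigen_basis k n I dg Ec \<theta> \<delta> N "bD 0" "\<lambda>c. x01 * bD 0 c" "\<lambda>c. x01 * (x01 * bD 0 c)" \<xi> "T \<theta>" l v .
    have card: "card (l ` {..<N}) = N" using card_image[OF l_inj] by simp
    show "finite (sols \<theta>)" using bij_betw_finite[OF solutions_bij] by simp
    show "card (sols \<theta>) = N" using bij_betw_same_card[OF solutions_bij] card by simp
    fix x j assume "\<forall>e\<in>I. mpoly_eval x (Eqn \<theta> e) = 0" "\<forall>j<k. \<exists>l\<le>n j. x (j, l) \<noteq> 0" "j < k"
    then show "x (j, 0) \<noteq> 0" by (intro solutions_affine) auto
  qed
qed

end

section \<open>Fixed points of contractions on power series\<close>

definition fcong :: "nat \<Rightarrow> complex fps \<Rightarrow> complex fps \<Rightarrow> bool" where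
  "fcong m f g \<longleftrightarrow> fps_X ^ m dvd f - g"

lemma fcong_iff: "fcong m f g \<longleftrightarrow> (\<forall>i<m. fps_nth f i = fps_nth g i)"
proof -
  have "fps_X ^ m dvd h \<longleftrightarrow> (\<forall>i<m. fps_nth h i = 0)" for h :: "complex fps"
  proof
    assume "fps_X ^ m dvd h"
    then obtain g where "h = fps_X ^ m * g" by (auto simp: dvd_def)
    then show "\<forall>i<m. fps_nth h i = 0" by (simp add: fps_X_power_mult_nth)
  next
    assume z: "\<forall>i<m. fps_nth h i = 0"
    have "h = fps_X ^ m * Abs_fps (\<lambda>i. fps_nth h (i + m))"
      by (rule fps_ext) (use z in \<open>simp add: fps_X_power_mult_nth\<close>)
    then show "fps_X ^ m dvd h" by (rule dvdI)
  qed
  then show ?thesis by (simp add: fcong_def)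
qed

lemma fcong_refl [simp]: "fcong m f f"
  by (simp add: fcong_def)

lemma fcong_add: "fcong m f g \<Longrightarrow> fcong m f' g' \<Longrightarrow> fcong m (f + f') (g + g')"
  by (simp add: fcong_iff)

lemma fcong_diff: "fcong m f g \<Longrightarrow> fcong m f' g' \<Longrightarrow> fcong m (f - f') (g - g')"
  by (simp add: fcong_iff)

lemma fcong_mult: "fcong m f g \<Longrightarrow> fcong m f' g' \<Longrightarrow> fcong m (f * f') (g * g')"
proof -
  assume "fcong m f g" "fcong m f' g'"
  then have "fps_X ^ m dvd f * (f' - g') + (f - g) * g'" by (simp add: fcong_def)
  then show ?thesis by (simp add: fcong_def algebra_simps)
qed

lemma fcong_sum: "(\<And>i. i \<in> A \<Longrightarrow> fcong m (f i) (g i)) \<Longrightarrow> fcong m (\<Sum>i\<in>A. f i) (\<Sum>i\<in>A. g i)"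
  by (induction A rule: infinite_finite_induct) (auto intro: fcong_add)

lemma fcong_prod: "(\<And>i. i \<in> A \<Longrightarrow> fcong m (f i) (g i)) \<Longrightarrow> fcong m (\<Prod>i\<in>A. f i) (\<Prod>i\<in>A. g i)"
  by (induction A rule: infinite_finite_induct) (auto intro: fcong_mult)

lemma fcong_power: "fcong m f g \<Longrightarrow> fcong m (f ^ a) (g ^ a)"
  by (induction a) (auto intro: fcong_mult)

lemma fcong_mon_eval: "(\<And>v. fcong m (x v) (y v)) \<Longrightarrow> fcong m (mon_eval x \<mu>) (mon_eval y \<mu>)"
  unfolding mon_eval_def by (intro fcong_prod fcong_power)

lemma fcong_hom_eval: "(\<And>v. fcong m (x v) (y v)) \<Longrightarrow> fcong m (hom_eval fps_const x P) (hom_eval fps_const y P)"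
  unfolding hom_eval_def by (intro fcong_sum fcong_mult fcong_mon_eval fcong_refl)

lemma fcong_inverse:
  assumes "fcong m f g" "fps_nth f 0 \<noteq> 0" "fps_nth g 0 \<noteq> 0"
  shows "fcong m (inverse f) (inverse g)"
proof -
  have "inverse f * f = 1" "inverse g * g = 1"
    using assms(2,3) by (simp_all add: inverse_mult_eq_1)
  then have "inverse f - inverse g = inverse f * (inverse g * g) - inverse f * f * inverse g"
    by simp
  also have "\<dots> = - (inverse f * inverse g) * (f - g)" by (simp add: algebra_simps)
  finally show ?thesis using assms(1) by (simp add: fcong_def)
qed

lemma fcong_fps_X: "fcong m f g \<Longrightarrow> fcong (Suc m) (fps_X * f) (fps_X * g)"
  by (auto simp: fcong_iff fps_X_mult_nth)

text \<open>Banach's fixed point theorem for the X-adic metric, by iteration from 0. Contraction is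
  required only between families without constant term, where the denominators of the intended map
  are units.\<close>

lemma fps_contraction_fixpoint:
  fixes \<Phi> :: "('q \<Rightarrow> complex fps) \<Rightarrow> 'q \<Rightarrow> complex fps"
  assumes zero: "\<And>y q. fps_nth (\<Phi> y q) 0 = 0"
    and contr: "\<And>m y y' q. (\<And>q. fps_nth (y q) 0 = 0) \<Longrightarrow> (\<And>q. fps_nth (y' q) 0 = 0) \<Longrightarrow>
      (\<And>q. fcong m (y q) (y' q)) \<Longrightarrow> fcong (Suc m) (\<Phi> y q) (\<Phi> y' q)"
  shows "\<exists>y. (\<forall>q. fps_nth (y q) 0 = 0) \<and> \<Phi> y = y"
proof -
  define s where "s m = (\<Phi> ^^ m) (\<lambda>_. 0)" for m
  have s_Suc: "s (Suc m) = \<Phi> (s m)" for m by (simp add: s_def)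
  have s0: "fps_nth (s m q) 0 = 0" for m q
    by (cases m) (simp_all add: s_def zero)
  have step: "fcong m (s (Suc m) q) (s m q)" for m q
  proof (induction m arbitrary: q)
    case (Suc m)
    show ?case unfolding s_Suc[of "Suc m"] by (subst (2) s_Suc) (intro contr s0 Suc)
  qed (simp add: fcong_iff)
  \<comment> \<open>The i-th coefficient is stable from the iterate i + 1 on.\<close>
  define y where "y q = Abs_fps (\<lambda>i. fps_nth (s (Suc i) q) i)" for q
  have tail: "fps_nth (s (Suc i + d) q) i = fps_nth (s (Suc i) q) i" for i d q
  proof (induction d)
    case (Suc d)
    have "fps_nth (s (Suc (Suc i + d)) q) i = fps_nth (s (Suc i + d) q) i"
      using step[of "Suc i + d" q] by (simp add: fcong_iff)
    with Suc show ?case by simp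
  qed simp
  have lim: "fcong m (y q) (s m q)" for m q
    unfolding fcong_iff
  proof (intro allI impI)
    fix i assume "i < m"
    then obtain d where "m = Suc i + d" by (metis Suc_leI le_Suc_ex)
    then show "fps_nth (y q) i = fps_nth (s m q) i" using tail[of i d q] by (simp add: y_def)
  qed
  have y0: "fps_nth (y q) 0 = 0" for q using lim[of 1 q] s0[of 1 q] by (simp add: fcong_iff)
  have "\<Phi> y q = y q" for q
  proof (rule fps_ext)
    fix i
    have "fcong (Suc (Suc i)) (\<Phi> y q) (s (Suc (Suc i)) q)"
      unfolding s_Suc[of "Suc i"] by (intro contr y0 s0 lim)
    with lim[of "Suc (Suc i)" q] show "fps_nth (\<Phi> y q) i = fps_nth (y q) i"
      by (simp add: fcong_iff)
  qed
  with y0 show ?thesis by blast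
qed

section \<open>The leaf points\<close>

context multigraded_map
begin

lemma eval_label_form: "mpoly_eval x (label_form a) = (\<Sum>l\<le>n (fst a). label_vec (snd a) l * x (fst a, l))"
  using mpoly_eval_label_form[of x "fst a" "snd a"] by simp

end

locale leaf = multigraded_map k n d for k n d +
  fixes t :: "nat \<Rightarrow> nat" and c :: "nat \<times> nat \<Rightarrow> nat \<times> nat"
  assumes leaf: "(t, c) \<in> leaves"
begin

definition branches :: "(nat \<times> nat) set" where
  "branches = {(i, m). i < k \<and> m \<le> n i \<and> m \<noteq> t i}"

text \<open>There are as many branches as the dimension \<Sum> n_i of the product, and the forms of
  their labels serve as local coordinates at the leaf point.\<close>

definition branch_label :: "nat \<times> nat \<Rightarrow> nat \<times> label" where
  "branch_label q = (if t (fst q) < snd q then (fst q, Inl (snd q)) else factor_label q (c q))"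

lemma t_le: "i < k \<Longrightarrow> t i \<le> n i"
  using leaf by (auto simp: leaves_def PiE_iff)

lemma c_factors: "i < k \<Longrightarrow> m < t i \<Longrightarrow> c (i, m) \<in> factors (i, m)"
  using leaf by (auto simp: leaves_def PiE_iff pending_def)

lemma c_PiE: "c \<in> PiE (pending t) factors"
  using leaf by (auto simp: leaves_def)

lemma branch_label_image: "branch_label ` branches = leaf_labels t (pending t) c"
proof (intro equalityI subsetI)
  fix a assume "a \<in> branch_label ` branches"
  then obtain i m where im: "a = branch_label (i, m)" "i < k" "m \<le> n i" "m \<noteq> t i" by (auto simp: branches_def)
  show "a \<in> leaf_labels t (pending t) c"
  proof (cases "t i < m")
    case True
    with im show ?thesis by (auto simp: branch_label_def leaf_labels_def)
  next
    case False
    with im have "(i, m) \<in> pending t" by (auto simp: pending_def)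
    then show ?thesis using im False by (auto simp: branch_label_def leaf_labels_def)
  qed
next
  fix a assume "a \<in> leaf_labels t (pending t) c"
  then consider i m where "i < k" "t i < m" "m \<le> n i" "a = (i, Inl m)"
    | i m where "i < k" "m < t i" "a = factor_label (i, m) (c (i, m))"
    by (auto simp: leaf_labels_def pending_def)
  then show "a \<in> branch_label ` branches"
  proof cases
    case (1 i m)
    then show ?thesis by (intro image_eqI[of _ _ "(i, m)"]) (auto simp: branch_label_def branches_def)
  next
    case (2 i m)
    then show ?thesis using t_le[of i] by (intro image_eqI[of _ _ "(i, m)"]) (auto simp: branch_label_def branches_def)
  qed
qed

lemma inj_branch_label: "inj_on branch_label branches"
proof (rule inj_onI)
  fix q q' assume "q \<in> branches" "q' \<in> branches" and eq: "branch_label q = branch_label q'"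
  then show "q = q'"
    by (cases q; cases q') (auto simp: branch_label_def factor_label_def tau_inject split: if_splits)
qed

lemma finite_branches: "finite branches"
  by (rule finite_subset[OF _ finite_vars]) (auto simp: branches_def vars_def)

lemma branch_label_in: "q \<in> branches \<Longrightarrow> branch_label q \<in> label_set"
  using leaf_labels_subset[OF finite_pending c_PiE, of t] branch_label_image by blast

definition labels_at :: "nat \<Rightarrow> label set" where
  "labels_at j = {a. (j, a) \<in> branch_label ` branches}"

lemma labels_at: 
  assumes "j < k"
  shows "labels_at j \<subseteq> labels (n j)" "finite (labels_at j)" "card (labels_at j) = n j" "Inl 0 \<notin> labels_at j"
proof -
  show "labels_at j \<subseteq> labels (n j)"
  proof
    fix a assume "a \<in> labels_at j"
    then obtain q where q: "q \<in> branches" "branch_label q = (j, a)" by (force simp: labels_at_def)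
    then show "a \<in> labels (n j)" using branch_label_in[OF q(1)] by (simp add: label_set_def)
  qed
  have "labels_at j \<subseteq> snd ` branch_label ` branches"
  proof
    fix a assume "a \<in> labels_at j"
    then have "(j, a) \<in> branch_label ` branches" by (simp add: labels_at_def)
    then show "a \<in> snd ` branch_label ` branches" by (rule image_eqI[rotated]) simp
  qed
  then show "finite (labels_at j)" using finite_branches finite_subset by blast
  have "card (labels_at j) = label_count (leaf_labels t (pending t) c) j"
    by (simp add: labels_at_def label_count_def branch_label_image)
  also have "\<dots> = n j"
    using leaf_label_count[OF finite_pending c_PiE assms] leaf t_le[OF assms] assms
    by (auto simp: leaves_def valid_def)
  finally show "card (labels_at j) = n j" .
  show "Inl 0 \<notin> labels_at j"
    by (auto simp: labels_at_def branch_label_image leaf_labels_def factor_label_def)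
qed

text \<open>By validity of the leaf, the forms vanishing in group j together with x_j0 are n_j + 1
  forms in general position; this is a basis dual to them, chosen among the solutions that
  \<open>labels_dual_basis\<close> provides.\<close>

definition dual :: "nat \<Rightarrow> label \<Rightarrow> nat \<Rightarrow> complex" where
  "dual j = (SOME M. \<forall>a\<in>insert (Inl 0) (labels_at j). \<forall>b\<in>insert (Inl 0) (labels_at j).
     (\<Sum>l\<le>n j. label_vec a l * M b l) = (if a = b then 1 else 0))"

lemma dual:
  assumes "j < k" "a \<in> insert (Inl 0) (labels_at j)" "b \<in> insert (Inl 0) (labels_at j)"
  shows "(\<Sum>l\<le>n j. label_vec a l * dual j b l) = (if a = b then 1 else 0)"
proof -
  have "\<exists>M. \<forall>a\<in>insert (Inl 0) (labels_at j). \<forall>b\<in>insert (Inl 0) (labels_at j).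
     (\<Sum>l\<le>n j. label_vec a l * M b l) = (if a = b then 1 else 0)"
  proof -
    have Z: "insert (Inl 0) (labels_at j) \<subseteq> labels (n j)" "finite (insert (Inl 0) (labels_at j))"
      "card (insert (Inl 0) (labels_at j)) = Suc (n j)"
      using labels_at[OF assms(1)] by (auto simp: labels_def)
    show ?thesis by (rule labels_dual_basis[OF Z]) blast
  qed
  from someI_ex[OF this, folded dual_def] show ?thesis using assms by blast
qed

definition point :: "nat \<times> nat \<Rightarrow> complex" where
  "point v = (if v \<in> vars then dual (fst v) (Inl 0) (snd v) else 0)"

text \<open>Moving in this direction changes the branch form \<open>q\<close> only and keeps every
  x_j0 fixed.\<close>

definition direction :: "nat \<times> nat \<Rightarrow> nat \<times> nat \<Rightarrow> complex" where
  "direction q v = (if v \<in> vars \<and> fst v = fst (branch_label q) then dual (fst v) (snd (branch_label q)) (snd v) else 0)"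

lemma sum_Inl_0: "(\<Sum>l\<le>m. label_vec (Inl 0) l * f l) = f 0"
proof -
  have "(\<Sum>l\<le>m. label_vec (Inl 0) l * f l) = (\<Sum>l\<le>m. if l = 0 then f 0 else 0)"
    by (rule sum.cong[OF refl]) auto
  then show ?thesis by simp
qed

lemma normalized_point: "normalized point"
  unfolding normalized_def
proof (intro conjI allI impI)
  fix j assume j: "j < k"
  then show "point (j, 0) = 1"
    using dual[OF j, of "Inl 0" "Inl 0"] unfolding sum_Inl_0 by (simp add: point_def vars_def)
qed (simp add: point_def)

lemma label_point: "j < k \<Longrightarrow> mpoly_eval point (label_form (j, a)) = (\<Sum>l\<le>n j. label_vec a l * dual j (Inl 0) l)"
  by (simp add: eval_label_form point_def vars_def)

lemma branch_label_fst: "q \<in> branches \<Longrightarrow> fst (branch_label q) < k"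
  using branch_label_in[of q] by (cases "branch_label q") (simp add: label_set_def)

lemma branch_label_snd: "q \<in> branches \<Longrightarrow> snd (branch_label q) \<in> labels_at (fst (branch_label q))"
  by (auto simp: labels_at_def)

lemma point_branch:
  assumes q: "q \<in> branches"
  shows "mpoly_eval point (label_form (branch_label q)) = 0"
proof -
  have "snd (branch_label q) \<noteq> Inl 0"
    using branch_label_snd[OF q] labels_at(4)[OF branch_label_fst[OF q]] by metis
  then show ?thesis
    using label_point[OF branch_label_fst[OF q], of "snd (branch_label q)"]
      dual[OF branch_label_fst[OF q], of "snd (branch_label q)" "Inl 0"] branch_label_snd[OF q] by simp
qed

lemma direction_branch:
  assumes q: "q \<in> branches" "q' \<in> branches"
  shows "mpoly_eval (direction q) (label_form (branch_label q')) = (if q = q' then 1 else 0)"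
proof (cases "fst (branch_label q) = fst (branch_label q')")
  case True
  have "mpoly_eval (direction q) (label_form (branch_label q')) =
      (\<Sum>l\<le>n (fst (branch_label q')). label_vec (snd (branch_label q')) l * dual (fst (branch_label q')) (snd (branch_label q)) l)"
    unfolding eval_label_form
    by (rule sum.cong[OF refl]) (use True branch_label_fst[OF q(2)] in \<open>simp add: direction_def vars_def\<close>)
  also have "\<dots> = (if snd (branch_label q') = snd (branch_label q) then 1 else 0)"
    by (rule dual[OF branch_label_fst[OF q(2)]]) (use branch_label_snd[OF q(1)] branch_label_snd[OF q(2)] True in auto)
  also have "snd (branch_label q') = snd (branch_label q) \<longleftrightarrow> q = q'"
    using inj_onD[OF inj_branch_label, of q q'] q True by (metis prod_eqI)
  finally show ?thesis .
next
  case False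
  then have "q \<noteq> q'" by auto
  with False show ?thesis by (simp add: eval_label_form direction_def)
qed

text \<open>One more vanishing label would make n_j + 1 of them in general position and force the
  coordinates in group j to be 0, against x_j0 = 1.\<close>

lemma point_other:
  assumes a: "(j, a) \<in> label_set" "(j, a) \<notin> branch_label ` branches"
  shows "mpoly_eval point (label_form (j, a)) \<noteq> 0"
proof
  assume z: "mpoly_eval point (label_form (j, a)) = 0"
  have j: "j < k" and al: "a \<in> labels (n j)" using a by (auto simp: label_set_def)
  have nin: "a \<notin> labels_at j" using a(2) by (simp add: labels_at_def)
  have "dual j (Inl 0) 0 = 0"
  proof (rule labels_general_position[of "insert a (labels_at j)" "n j" "dual j (Inl 0)"])
    show "(\<Sum>l\<le>n j. label_vec b l * dual j (Inl 0) l) = 0" if "b \<in> insert a (labels_at j)" for b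
    proof (cases "b = a")
      case True
      then show ?thesis using z label_point[OF j] by simp
    next
      case False
      with that have b: "b \<in> labels_at j" by simp
      with labels_at(4)[OF j] have "b \<noteq> Inl 0" by metis
      with b show ?thesis using dual[OF j, of b "Inl 0"] by simp
    qed
  qed (use labels_at[OF j] al nin in auto)
  with normalized_point j show False by (simp add: normalized_def point_def vars_def)
qed

lemma point_t:
  assumes "i < k"
  shows "point (i, t i) \<noteq> 0"
proof -
  have "(i, Inl (t i)) \<in> label_set" using assms t_le by (simp add: label_set_def labels_def)
  moreover have "(i, Inl (t i)) \<notin> branch_label ` branches"
    unfolding branch_label_image by (auto simp: leaf_labels_def factor_label_def)
  ultimately have "mpoly_eval point (label_form (i, Inl (t i))) \<noteq> 0" by (rule point_other)
  then show ?thesis using t_le[OF assms] by (simp add: label_form_Inl)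
qed

lemma point_above_t: "i < k \<Longrightarrow> t i < m \<Longrightarrow> m \<le> n i \<Longrightarrow> point (i, m) = 0"
  using point_branch[of "(i, m)"] by (simp add: branches_def branch_label_def label_form_Inl)

lemma factor_point:
  assumes "i < k" "m < t i" "y \<in> factors (i, m)"
  shows "mpoly_eval point (label_form (factor_label (i, m) y)) = 0 \<longleftrightarrow> y = c (i, m)"
proof
  assume z: "mpoly_eval point (label_form (factor_label (i, m) y)) = 0"
  have "factor_label (i, m) y \<in> branch_label ` branches"
    using point_other[of "fst (factor_label (i, m) y)" "snd (factor_label (i, m) y)"] factor_label_in[OF assms(3)] z by auto
  then show "y = c (i, m)"
    unfolding branch_label_image by (auto simp: leaf_labels_def factor_label_def tau_inject prod_eq_iff)
next
  assume "y = c (i, m)"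
  then show "mpoly_eval point (label_form (factor_label (i, m) y)) = 0"
    using point_branch[of "(i, m)"] assms t_le[of i] by (simp add: branches_def branch_label_def)
qed

lemma G_t_point: "i < k \<Longrightarrow> mpoly_eval point (G (i, t i)) \<noteq> 0"
proof -
  assume i: "i < k"
  have "mpoly_eval point (label_form (factor_label (i, t i) y)) \<noteq> 0" if y: "y \<in> factors (i, t i)" for y
  proof -
    have "factor_label (i, t i) y \<notin> branch_label ` branches"
      unfolding branch_label_image by (auto simp: leaf_labels_def factor_label_def tau_inject pending_def)
    then show ?thesis
      using point_other[of "fst (factor_label (i, t i) y)" "snd (factor_label (i, t i) y)"] factor_label_in[OF y] by simp
  qed
  then show ?thesis by (simp add: G_def mpe.hom_prod prod_zero_iff finite_factors)
qed

end

text \<open>A leaf is read off from its point: t_i is the last nonzero coordinate of group i, and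
  c(i, m) is the only factor of G_im that vanishes.\<close>

lemma (in multigraded_map) leaf_points_inj:
  assumes 1: "(t, c) \<in> leaves" and 2: "(t', c') \<in> leaves"
    and eq: "leaf.point k n t c = leaf.point k n t' c'"
  shows "(t, c) = (t', c')"
proof -
  interpret l1: leaf k n d t c by unfold_locales (rule 1)
  interpret l2: leaf k n d t' c' by unfold_locales (rule 2)
  have tt: "t i = t' i" if i: "i < k" for i
  proof (rule ccontr)
    assume "t i \<noteq> t' i"
    then consider "t i < t' i" | "t' i < t i" by linarith
    then show False
    proof cases
      case 1
      then show ?thesis using l1.point_above_t[OF i 1 l2.t_le[OF i]] l2.point_t[OF i] eq by simp
    next
      case 2
      then show ?thesis using l2.point_above_t[OF i 2 l1.t_le[OF i]] l1.point_t[OF i] eq by simp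
    qed
  qed
  have t: "t = t'"
    by (rule PiE_ext[of _ "{..<k}" "\<lambda>i. {..n i}"]) (use 1 2 tt in \<open>auto simp: leaves_def\<close>)
  have "c = c'"
  proof (rule PiE_ext[OF l1.c_PiE])
    show "c' \<in> PiE (pending t) factors" using l2.c_PiE t by simp
    fix q assume "q \<in> pending t"
    then obtain i m where q: "q = (i, m)" "i < k" "m < t i" by (auto simp: pending_def)
    show "c q = c' q"
      using l1.factor_point[OF q(2,3) l1.c_factors[OF q(2,3)]]
        l2.factor_point[OF q(2) _ l1.c_factors[OF q(2,3)]] q t eq by simp
  qed
  with t show ?thesis by simp
qed

section \<open>The fixed point equations with parameters\<close>

text \<open>The parameters are the coefficients of the defining polynomials together with a degeneration
  parameter \<open>None\<close>. The equation \<open>(i, l, Some l')\<close> is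
  \<open>F\<^sub>i\<^sub>l x\<^sub>i\<^sub>l\<^sub>' = s\<^bsup>l'-l\<^esup> F\<^sub>i\<^sub>l\<^sub>' x\<^sub>i\<^sub>l\<close>, where \<open>s\<close> is the degeneration parameter,
  and \<open>(i, l, None)\<close> is \<open>F\<^sub>i\<^sub>l = 0\<close>.\<close>

type_synonym param = "(nat \<times> nat \<times> (nat \<times> nat \<Rightarrow>\<^sub>0 nat)) option"

lemma prod_mvar_power: "(\<Prod>x\<in>A. mvar x ^ f x) = (single (\<Sum>x\<in>A. single x (f x)) 1 :: ('v, 'a::comm_ring_1) mpoly)"
proof -
  have pow: "mvar v ^ a = (single (single v a) 1 :: ('v, 'a) mpoly)" for v a
    by (induction a) (simp_all add: mvar_def mult_single single_add[symmetric])
  show ?thesis by (induction A rule: infinite_finite_induct) (simp_all add: pow mult_single)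
qed

lemma mon_eval_mvar: "mon_eval mvar \<kappa> = (single \<kappa> 1 :: ('v, 'a::comm_ring_1) mpoly)"
proof -
  have "(\<Sum>v\<in>keys \<kappa>. single v (lookup \<kappa> v)) = \<kappa>"
    by (rule mpoly_sum_single[symmetric])
  then show ?thesis by (simp only: mon_eval_def prod_mvar_power)
qed

lemma comm_ring_hom_cst_eval: "comm_ring_hom (\<lambda>Q. cst (mpoly_eval \<theta> Q))"
  by unfold_locales (simp_all add: mpe.hom_add mpe.hom_mult single_add mult_single)

context multigraded_map
begin

definition eqs :: "(nat \<times> nat \<times> nat option) set" where
  "eqs = {(i, l, Some l') | i l l'. i < k \<and> l < l' \<and> l' \<le> n i}"

definition base_eqs :: "nat \<Rightarrow> (nat \<times> nat \<times> nat option) set" where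
  "base_eqs i = (\<lambda>l. (i, l, None)) ` {..n i}"

fun eq_deg :: "nat \<times> nat \<times> nat option \<Rightarrow> nat \<Rightarrow> nat" where
  "eq_deg (i, l, Some l') = (\<lambda>j. dG i j + udeg i j)"
| "eq_deg (i, l, None) = dG i"

text \<open>The coefficient of \<kappa> in the product of F_il with the variable v.\<close>

definition shifted :: "nat \<Rightarrow> nat \<Rightarrow> nat \<times> nat \<Rightarrow> (nat \<times> nat \<Rightarrow>\<^sub>0 nat) \<Rightarrow> (param, complex) mpoly" where
  "shifted i l v \<kappa> = (\<Sum>\<mu>\<in>Mon (dG i). if \<mu> + single v 1 = \<kappa> then mvar (Some (i, l, \<mu>)) else 0)"

fun eq_coeff :: "nat \<times> nat \<times> nat option \<Rightarrow> (nat \<times> nat \<Rightarrow>\<^sub>0 nat) \<Rightarrow> (param, complex) mpoly" where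
  "eq_coeff (i, l, Some l') \<kappa> = shifted i l (i, l') \<kappa> - mvar None ^ (l' - l) * shifted i l' (i, l) \<kappa>"
| "eq_coeff (i, l, None) \<kappa> = mvar (Some (i, l, \<kappa>))"

definition Fev :: "((param, complex) mpoly \<Rightarrow> 'b::comm_ring_1) \<Rightarrow> (nat \<times> nat \<Rightarrow> 'b) \<Rightarrow> nat \<Rightarrow> nat \<Rightarrow> 'b" where
  "Fev \<eta> x i l = (\<Sum>\<mu>\<in>Mon (dG i). \<eta> (mvar (Some (i, l, \<mu>))) * mon_eval x \<mu>)"

lemma finite_eqs: "finite eqs"
proof (rule finite_subset)
  show "eqs \<subseteq> (\<lambda>((i, l), l'). (i, l, Some l')) ` ((SIGMA i:{..<k}. {..n i}) \<times> (\<Union>i<k. {..n i}))"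
    by (force simp: eqs_def)
qed auto

lemma shifted_sum:
  assumes \<eta>: "comm_ring_hom \<eta>" and v: "(i, l') \<in> vars"
  shows "(\<Sum>\<kappa>\<in>Mon (\<lambda>j. dG i j + udeg i j). \<eta> (shifted i l (i, l') \<kappa>) * mon_eval x \<kappa>) = Fev \<eta> x i l * x (i, l')"
proof -
  interpret comm_ring_hom \<eta> by fact
  let ?D = "\<lambda>j. dG i j + udeg i j"
  have in_D: "\<mu> + single (i, l') 1 \<in> Mon ?D" if "\<mu> \<in> Mon (dG i)" for \<mu>
    using that v by (intro Mon_add Mon_var)
  have "(\<Sum>\<kappa>\<in>Mon ?D. \<eta> (shifted i l (i, l') \<kappa>) * mon_eval x \<kappa>) =
      (\<Sum>\<kappa>\<in>Mon ?D. \<Sum>\<mu>\<in>Mon (dG i). if \<kappa> = \<mu> + single (i, l') 1 then \<eta> (mvar (Some (i, l, \<mu>))) * mon_eval x \<kappa> else 0)"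
    unfolding shifted_def hom_sum sum_distrib_right hom_cst_delta[OF \<eta>]
    by (intro sum.cong refl) auto
  also have "\<dots> = (\<Sum>\<mu>\<in>Mon (dG i). \<Sum>\<kappa>\<in>Mon ?D. if \<kappa> = \<mu> + single (i, l') 1 then \<eta> (mvar (Some (i, l, \<mu>))) * mon_eval x \<kappa> else 0)"
    by (rule sum.swap)
  also have "\<dots> = (\<Sum>\<mu>\<in>Mon (dG i). \<eta> (mvar (Some (i, l, \<mu>))) * mon_eval x \<mu> * x (i, l'))"
  proof (rule sum.cong[OF refl])
    fix \<mu> assume "\<mu> \<in> Mon (dG i)"
    then show "(\<Sum>\<kappa>\<in>Mon ?D. if \<kappa> = \<mu> + single (i, l') 1 then \<eta> (mvar (Some (i, l, \<mu>))) * mon_eval x \<kappa> else 0) =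
        \<eta> (mvar (Some (i, l, \<mu>))) * mon_eval x \<mu> * x (i, l')"
      using in_D by (subst sum.delta[OF finite_Mon]) (simp add: mon_eval_add mult.assoc)
  qed
  finally show ?thesis by (simp add: Fev_def sum_distrib_right)
qed

lemma eq_coeff_sum:
  assumes \<eta>: "comm_ring_hom \<eta>" and v: "(i, l) \<in> vars" "(i, l') \<in> vars"
  shows "(\<Sum>\<kappa>\<in>Mon (eq_deg (i, l, Some l')). \<eta> (eq_coeff (i, l, Some l') \<kappa>) * mon_eval x \<kappa>) =
    Fev \<eta> x i l * x (i, l') - \<eta> (mvar None) ^ (l' - l) * (Fev \<eta> x i l' * x (i, l))"
proof -
  interpret comm_ring_hom \<eta> by fact
  let ?D = "\<lambda>j. dG i j + udeg i j"
  have "(\<Sum>\<kappa>\<in>Mon (eq_deg (i, l, Some l')). \<eta> (eq_coeff (i, l, Some l') \<kappa>) * mon_eval x \<kappa>) =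
      (\<Sum>\<kappa>\<in>Mon ?D. \<eta> (shifted i l (i, l') \<kappa>) * mon_eval x \<kappa> -
        \<eta> (mvar None) ^ (l' - l) * (\<eta> (shifted i l' (i, l) \<kappa>) * mon_eval x \<kappa>))"
    by (simp add: hom_minus hom_mult hom_power left_diff_distrib mult.assoc)
  also have "\<dots> = (\<Sum>\<kappa>\<in>Mon ?D. \<eta> (shifted i l (i, l') \<kappa>) * mon_eval x \<kappa>) -
      \<eta> (mvar None) ^ (l' - l) * (\<Sum>\<kappa>\<in>Mon ?D. \<eta> (shifted i l' (i, l) \<kappa>) * mon_eval x \<kappa>)"
    by (simp only: sum_subtractf sum_distrib_left)
  finally show ?thesis by (simp only: shifted_sum[OF \<eta> v(1)] shifted_sum[OF \<eta> v(2)])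
qed

sublocale main: param_system k n eqs eq_deg eq_coeff
  by unfold_locales (rule finite_eqs)

definition Fpoly :: "(param \<Rightarrow> complex) \<Rightarrow> nat \<Rightarrow> nat \<Rightarrow> (nat \<times> nat, complex) mpoly" where
  "Fpoly \<theta> i l = (\<Sum>\<mu>\<in>Mon (dG i). single \<mu> (\<theta> (Some (i, l, \<mu>))))"

text \<open>Evaluation at the variables themselves turns \<open>eq_coeff_sum\<close> into an
  identity of polynomials.\<close>

lemma Eqn_Some:
  assumes "(i, l) \<in> vars" "(i, l') \<in> vars"
  shows "main.Eqn \<theta> (i, l, Some l') =
    Fpoly \<theta> i l * mvar (i, l') - cst (\<theta> None) ^ (l' - l) * (Fpoly \<theta> i l' * mvar (i, l))"
proof -
  let ?\<eta> = "\<lambda>Q. cst (mpoly_eval \<theta> Q) :: (nat \<times> nat, complex) mpoly"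
  have "Fev ?\<eta> mvar i l = Fpoly \<theta> i l" for l
    by (simp add: Fev_def Fpoly_def mon_eval_mvar mult_single)
  moreover have "main.Eqn \<theta> (i, l, Some l') =
      (\<Sum>\<kappa>\<in>Mon (eq_deg (i, l, Some l')). ?\<eta> (eq_coeff (i, l, Some l') \<kappa>) * mon_eval mvar \<kappa>)"
    unfolding main.Eqn_def mon_eval_mvar by (rule sum.cong[OF refl]) (simp add: mult_single)
  ultimately show ?thesis
    using eq_coeff_sum[OF comm_ring_hom_cst_eval assms, of \<theta> mvar] by simp
qed

lemma Eqn_None: "main.Eqn \<theta> (i, l, None) = Fpoly \<theta> i l"
  by (simp add: main.Eqn_def Fpoly_def)

definition special_par :: "param \<Rightarrow> complex" where
  "special_par = (\<lambda>None \<Rightarrow> 0 | Some (i, l, \<mu>) \<Rightarrow> lookup (G (i, l)) \<mu>)"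

lemma special_par_simps [simp]:
  "special_par None = 0" "special_par (Some (i, l, \<mu>)) = lookup (G (i, l)) \<mu>"
  by (simp_all add: special_par_def)

lemma Fpoly_special: "Fpoly special_par i l = G (i, l)"
proof -
  have "(\<Sum>\<mu>\<in>keys (G (i, l)). single \<mu> (lookup (G (i, l)) \<mu>)) = Fpoly special_par i l"
    unfolding Fpoly_def using G_in_Forms[of "(i, l)"]
    by (intro sum.mono_neutral_cong_left finite_Mon) (auto simp: Forms_def in_keys_iff)
  then show ?thesis using mpoly_sum_single[of "G (i, l)"] by simp
qed

lemma sys_special: "main.sys special_par = (\<Union>i<k. special_sys i)"
proof -
  have eqn: "(eq_deg e, main.Eqn special_par e) = (\<lambda>j. dG i j + udeg i j, G (i, l) * mvar (i, l'))"
    if "e = (i, l, Some l')" "i < k" "l < l'" "l' \<le> n i" for e i l l'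
    using that Eqn_Some[of i l l' special_par] zero_power[where 'a = "(nat \<times> nat, complex) mpoly" and n = "l' - l"]
    by (simp add: vars_def Fpoly_special)
  show ?thesis
  proof (intro equalityI subsetI)
    fix z assume "z \<in> main.sys special_par"
    then obtain i l l' where z: "i < k" "l < l'" "l' \<le> n i"
      "z = (eq_deg (i, l, Some l'), main.Eqn special_par (i, l, Some l'))"
      unfolding main.sys_def by (auto simp: eqs_def simp del: eq_deg.simps)
    then show "z \<in> (\<Union>i<k. special_sys i)"
      unfolding z(4) eqn[OF refl z(1-3)] by (auto simp: special_sys_def)
  next
    fix z assume "z \<in> (\<Union>i<k. special_sys i)"
    then obtain i l l' where z: "i < k" "l < l'" "l' \<le> n i" "z = (\<lambda>j. dG i j + udeg i j, G (i, l) * mvar (i, l'))"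
      by (auto simp: special_sys_def)
    then show "z \<in> main.sys special_par"
      unfolding z(4) eqn[OF refl z(1-3), symmetric] main.sys_def by (intro imageI) (auto simp: eqs_def)
  qed
qed

end

section \<open>Lifting the leaf points to power series solutions\<close>

context leaf
begin

text \<open>In these coordinates \<open>y q\<close> is precisely the value of the branch form
  \<open>q\<close>, as \<open>label_fps_lift\<close> shows.\<close>

definition lift :: "(nat \<times> nat \<Rightarrow> complex fps) \<Rightarrow> nat \<times> nat \<Rightarrow> complex fps" where
  "lift y v = fps_const (point v) + (\<Sum>q\<in>branches. fps_const (direction q v) * y q)"

abbreviation label_fps :: "nat \<times> label \<Rightarrow> (nat \<times> nat \<Rightarrow> complex fps) \<Rightarrow> complex fps" where
  "label_fps a x \<equiv> hom_eval fps_const x (label_form a)"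

lemma label_fps_alt: "label_fps a x = (\<Sum>l\<le>n (fst a). fps_const (label_vec (snd a) l) * x (fst a, l))"
proof -
  interpret h: comm_ring_hom "hom_eval fps_const x :: (nat \<times> nat, complex) mpoly \<Rightarrow> complex fps"
    by (rule comm_ring_hom.comm_ring_hom_hom_eval[OF comm_ring_hom_fps_const])
  show ?thesis
    by (simp add: label_form_def case_prod_unfold h.hom_sum h.hom_mult
        comm_ring_hom.hom_eval_single[OF comm_ring_hom_fps_const] comm_ring_hom.hom_eval_mvar[OF comm_ring_hom_fps_const])
qed

lemma label_fps_lift:
  assumes q: "q \<in> branches"
  shows "label_fps (branch_label q) (lift y) = y q"
proof -
  interpret h: comm_ring_hom "fps_const :: complex \<Rightarrow> complex fps" by (rule comm_ring_hom_fps_const)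
  let ?a = "branch_label q"
  have "label_fps ?a (lift y) = (\<Sum>l\<le>n (fst ?a). fps_const (label_vec (snd ?a) l) * fps_const (point (fst ?a, l))) +
      (\<Sum>l\<le>n (fst ?a). fps_const (label_vec (snd ?a) l) * (\<Sum>q'\<in>branches. y q' * fps_const (direction q' (fst ?a, l))))"
    unfolding label_fps_alt lift_def by (simp only: distrib_left sum.distrib mult.commute[of "y _"])
  also have "(\<Sum>l\<le>n (fst ?a). fps_const (label_vec (snd ?a) l) * (\<Sum>q'\<in>branches. y q' * fps_const (direction q' (fst ?a, l)))) =
      (\<Sum>q'\<in>branches. y q' * (\<Sum>l\<le>n (fst ?a). fps_const (label_vec (snd ?a) l) * fps_const (direction q' (fst ?a, l))))"
    by (rule sum_mult_swap)
  also have "\<dots> = (\<Sum>q'\<in>branches. y q' * fps_const (mpoly_eval (direction q') (label_form ?a)))"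
    by (simp only: eval_label_form h.hom_sum h.hom_mult)
  also have "\<dots> = (\<Sum>q'\<in>branches. if q' = q then y q else 0)"
    by (rule sum.cong[OF refl]) (simp add: direction_branch q)
  also have "\<dots> = y q" using q finite_branches by simp
  also have "(\<Sum>l\<le>n (fst ?a). fps_const (label_vec (snd ?a) l) * fps_const (point (fst ?a, l))) =
      fps_const (mpoly_eval point (label_form ?a))"
    by (simp only: eval_label_form h.hom_sum h.hom_mult)
  finally show ?thesis by (simp add: point_branch[OF q])
qed

lemma lift_nth_0:
  assumes "\<And>q. fps_nth (y q) 0 = 0"
  shows "fps_nth (lift y v) 0 = point v"
proof -
  interpret h: comm_ring_hom "\<lambda>f :: complex fps. fps_nth f 0" by (rule comm_ring_hom_fps_nth_0)
  show ?thesis by (simp add: lift_def h.hom_sum h.hom_add h.hom_mult assms)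
qed

lemma fcong_lift: "(\<And>q. fcong m (y q) (y' q)) \<Longrightarrow> fcong m (lift y v) (lift y' v)"
  unfolding lift_def by (intro fcong_add fcong_sum fcong_mult fcong_refl)

lemma hom_eval_nth_0:
  fixes P :: "(nat \<times> nat, complex) mpoly"
  shows "fps_nth (hom_eval fps_const x P) 0 = mpoly_eval (\<lambda>v. fps_nth (x v) 0) P"
  by (simp add: hom_eval_def mpoly_eval_alt fps_sum_nth main.fps_nth_0_mon_eval)

definition cofactor_poly :: "nat \<times> nat \<Rightarrow> (nat \<times> nat, complex) mpoly" where
  "cofactor_poly q = (\<Prod>y\<in>factors q - {c q}. label_form (factor_label q y))"

lemma G_cofactor:
  assumes "i < k" "m < t i"
  shows "G (i, m) = label_form (branch_label (i, m)) * cofactor_poly (i, m)"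
proof -
  have "branch_label (i, m) = factor_label (i, m) (c (i, m))" using assms by (simp add: branch_label_def)
  then show ?thesis
    unfolding G_def cofactor_poly_def using c_factors[OF assms] finite_factors by (simp add: prod.remove)
qed

lemma cofactor_point: "i < k \<Longrightarrow> m < t i \<Longrightarrow> mpoly_eval point (cofactor_poly (i, m)) \<noteq> 0"
  using factor_point by (simp add: cofactor_poly_def mpe.hom_prod prod_zero_iff finite_factors)

text \<open>Only the equations between an index m and the pivot t_i are solved, one for each branch.
  Each reads \<open>y q\<close> times a unit equals X times a series, which is a contraction. The
  other equations follow by cancelling x and F at the pivot, both nonzero there.\<close>

lemma formal_solution_exists:
  "\<exists>x. (\<forall>v. fps_nth (x v) 0 = point v) \<and>
    (\<forall>e\<in>eqs. (\<Sum>\<kappa>\<in>Mon (eq_deg e). line_eval special_par \<theta> (eq_coeff e \<kappa>) * mon_eval x \<kappa>) = 0)"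
proof -
  let ?\<eta> = "line_eval special_par \<theta> :: (param, complex) mpoly \<Rightarrow> complex fps"
  define S where "S = ?\<eta> (mvar None)"
  define F where "F i l x = Fev ?\<eta> x i l" for i l x
  \<comment> \<open>The first order change of F_il along the line: F = G + X H.\<close>
  define H where "H i l x = (\<Sum>\<mu>\<in>Mon (dG i). fps_const (\<theta> (Some (i, l, \<mu>)) - special_par (Some (i, l, \<mu>))) * mon_eval x \<mu>)" for i l x
  have lin: "?\<eta> (mvar p) = fps_const (special_par p) + fps_X * fps_const (\<theta> p - special_par p)" for p
    by (simp add: line_eval_def comm_ring_hom.hom_eval_mvar[OF comm_ring_hom_const_poly] fps_of_poly_pCons mult.commute)
  have S: "S = fps_X * fps_const (\<theta> None)" unfolding S_def lin by simp
  have F: "F i l x = hom_eval fps_const x (G (i, l)) + fps_X * H i l x" for i l x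
  proof -
    have "hom_eval fps_const x (G (i, l)) = (\<Sum>\<mu>\<in>Mon (dG i). fps_const (lookup (G (i, l)) \<mu>) * mon_eval x \<mu>)"
      by (rule comm_ring_hom.hom_eval_superset[OF comm_ring_hom_fps_const finite_Mon])
        (use G_in_Forms[of "(i, l)"] in \<open>simp add: Forms_def\<close>)
    then show ?thesis
      by (simp add: F_def Fev_def H_def lin distrib_right sum.distrib sum_distrib_left mult.assoc)
  qed
  have F_cong: "fcong m (F i l x) (F i l x')" if "\<And>v. fcong m (x v) (x' v)" for m i l x x'
    unfolding F_def Fev_def using that by (intro fcong_sum fcong_mult fcong_refl fcong_mon_eval)
  have H_cong: "fcong m (H i l x) (H i l x')" if "\<And>v. fcong m (x v) (x' v)" for m i l x x'
    unfolding H_def using that by (intro fcong_sum fcong_mult fcong_refl fcong_mon_eval)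
  have F0: "fps_nth (F i l x) 0 = mpoly_eval (\<lambda>v. fps_nth (x v) 0) (G (i, l))" for i l x
    by (simp add: F hom_eval_nth_0)
  \<comment> \<open>The pivot equation solved for \<open>y (i, m)\<close>, with one factor X drawn
    out; hence the exponents of \<open>S\<close>, itself a multiple of X, are lowered by 1. For m <
    t_i the form G_im is y times the cofactor, and the X H part of F_im moves to the right.\<close>
  define num where "num q x = (case q of (i, m) \<Rightarrow>
    if t i < m then fps_const (\<theta> None) * S ^ (m - t i - 1) * (F i m x * x (i, t i))
    else fps_const (\<theta> None) * S ^ (t i - m - 1) * (F i (t i) x * x (i, m)) - H i m x * x (i, t i))" for q x
  define den where "den q x = (case q of (i, m) \<Rightarrow>
    if t i < m then F i (t i) x else hom_eval fps_const x (cofactor_poly (i, m)) * x (i, t i))" for q x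
  define \<Phi> where "\<Phi> y q = (if q \<in> branches then fps_X * (num q (lift y) * inverse (den q (lift y))) else 0)" for y q
  have den0: "fps_nth (den q (lift y)) 0 \<noteq> 0" if q: "q \<in> branches" and y: "\<And>q. fps_nth (y q) 0 = 0" for q y
  proof -
    obtain i m where im: "q = (i, m)" "i < k" "m \<le> n i" "m \<noteq> t i" using q by (auto simp: branches_def)
    show ?thesis
      using im G_t_point[OF im(2)] cofactor_point[OF im(2), of m] point_t[OF im(2)]
      by (simp add: den_def F0 hom_eval_nth_0 lift_nth_0[OF y])
  qed
  have "\<exists>y. (\<forall>q. fps_nth (y q) 0 = 0) \<and> \<Phi> y = y"
  proof (rule fps_contraction_fixpoint)
    show "fps_nth (\<Phi> y q) 0 = 0" for y q by (simp add: \<Phi>_def)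
  next
    fix m q and y y' :: "nat \<times> nat \<Rightarrow> complex fps"
    assume y: "\<And>q. fps_nth (y q) 0 = 0" "\<And>q. fps_nth (y' q) 0 = 0" and c: "\<And>q. fcong m (y q) (y' q)"
    have cl: "fcong m (lift y v) (lift y' v)" for v by (rule fcong_lift[OF c])
    show "fcong (Suc m) (\<Phi> y q) (\<Phi> y' q)"
    proof (cases "q \<in> branches")
      case True
      obtain i l where q: "q = (i, l)" by (cases q)
      have "fcong m (num q (lift y)) (num q (lift y'))"
        unfolding num_def q prod.case
        by (auto intro!: fcong_mult fcong_diff F_cong H_cong cl)
      moreover have "fcong m (den q (lift y)) (den q (lift y'))"
        unfolding den_def q prod.case
        by (auto intro!: fcong_mult F_cong fcong_hom_eval cl)
      ultimately show ?thesis
        unfolding \<Phi>_def using True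
        by (simp add: fcong_fps_X fcong_mult fcong_inverse den0[OF True y(1)] den0[OF True y(2)])
    qed (simp add: \<Phi>_def)
  qed
  then obtain y where y0: "\<And>q. fps_nth (y q) 0 = 0" and fix_y: "\<Phi> y = y" by blast
  define x where "x = lift y"
  have y_eq: "y q * den q x = fps_X * num q x" if q: "q \<in> branches" for q
  proof -
    have "y q = fps_X * (num q x * inverse (den q x))"
      using fun_cong[OF fix_y, of q] q by (simp add: \<Phi>_def x_def)
    moreover have "inverse (den q x) * den q x = 1"
      using den0[OF q y0] by (simp add: x_def inverse_mult_eq_1)
    ultimately show ?thesis by (simp add: mult.assoc)
  qed
  have Sp: "S ^ a = fps_X * (fps_const (\<theta> None) * S ^ (a - 1))" if "0 < a" for a
    using that by (cases a) (simp_all add: S mult.assoc)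
  have above: "x (i, m) * F i (t i) x = S ^ (m - t i) * (F i m x * x (i, t i))" if "i < k" "m \<le> n i" "t i < m" for i m
  proof -
    have q: "(i, m) \<in> branches" using that by (simp add: branches_def)
    have "y (i, m) = x (i, m)"
    proof -
      have "label_fps (branch_label (i, m)) x = x (i, m)"
        using that by (simp add: branch_label_def label_form_Inl comm_ring_hom.hom_eval_mvar[OF comm_ring_hom_fps_const])
      then show ?thesis using label_fps_lift[OF q, of y] by (simp add: x_def)
    qed
    with y_eq[OF q] that Sp[of "m - t i"] show ?thesis by (simp add: num_def den_def mult.assoc)
  qed
  have below: "F i m x * x (i, t i) = S ^ (t i - m) * (F i (t i) x * x (i, m))" if "i < k" "m < t i" for i m
  proof -
    have q: "(i, m) \<in> branches" using that t_le[of i] by (simp add: branches_def)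
    interpret h: comm_ring_hom "hom_eval fps_const x :: (nat \<times> nat, complex) mpoly \<Rightarrow> complex fps"
      by (rule comm_ring_hom.comm_ring_hom_hom_eval[OF comm_ring_hom_fps_const])
    have "hom_eval fps_const x (G (i, m)) = y (i, m) * hom_eval fps_const x (cofactor_poly (i, m))"
      unfolding G_cofactor[OF that] h.hom_mult using label_fps_lift[OF q, of y] by (simp add: x_def)
    then have "F i m x * x (i, t i) = y (i, m) * den (i, m) x + fps_X * (H i m x * x (i, t i))"
      using that by (simp add: F den_def distrib_right mult.assoc)
    also have "\<dots> = fps_X * (fps_const (\<theta> None) * S ^ (t i - m - 1) * (F i (t i) x * x (i, m)))"
      using that by (simp add: y_eq[OF q] num_def right_diff_distrib)
    finally show ?thesis using that Sp[of "t i - m"] by (simp add: mult.assoc)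
  qed
  have eq: "F i l x * x (i, l') = S ^ (l' - l) * (F i l' x * x (i, l))" if i: "i < k" and l: "l < l'" "l' \<le> n i" for i l l'
  proof -
    have x0: "x (i, t i) \<noteq> 0"
      using point_t[OF i] lift_nth_0[of y "(i, t i)"] y0 by (auto simp: x_def)
    have F0': "F i (t i) x \<noteq> 0"
      using F0[of i "t i" x] G_t_point[OF i] lift_nth_0[of y] y0 by (auto simp: x_def)
    have below': "F i m x * x (i, t i) = S ^ (t i - m) * (F i (t i) x * x (i, m))" if "m \<le> t i" for m
      using below[OF i, of m] that by (cases "m = t i") auto
    have above': "x (i, m) * F i (t i) x = S ^ (m - t i) * (F i m x * x (i, t i))" if "t i \<le> m" "m \<le> n i" for m
      using above[OF i, of m] that by (cases "m = t i") (auto simp: mult.commute)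
    \<comment> \<open>Below the pivot the equation is multiplied by the pivot coordinate, above it
      by the pivot form, and across it by both.\<close>
    consider "l' \<le> t i" | "l \<le> t i" "t i \<le> l'" | "t i \<le> l" by linarith
    then show ?thesis
    proof cases
      case 1
      have "(F i l x * x (i, l')) * x (i, t i) = (F i l x * x (i, t i)) * x (i, l')" by (simp only: mult_ac)
      also have "\<dots> = (S ^ (t i - l) * (F i (t i) x * x (i, l))) * x (i, l')" using 1 l by (simp only: below')
      also have "S ^ (t i - l) = S ^ (l' - l) * S ^ (t i - l')" using 1 l by (simp flip: power_add)
      also have "S ^ (l' - l) * S ^ (t i - l') * (F i (t i) x * x (i, l)) * x (i, l') =
          S ^ (l' - l) * x (i, l) * (S ^ (t i - l') * (F i (t i) x * x (i, l')))" by (simp only: mult_ac)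
      also have "\<dots> = S ^ (l' - l) * x (i, l) * (F i l' x * x (i, t i))" using 1 by (simp only: below')
      finally have "(F i l x * x (i, l')) * x (i, t i) = (S ^ (l' - l) * (F i l' x * x (i, l))) * x (i, t i)"
        by (simp only: mult_ac)
      with x0 show ?thesis by simp
    next
      case 2
      have "(F i l x * x (i, l')) * (x (i, t i) * F i (t i) x) = (F i l x * x (i, t i)) * (x (i, l') * F i (t i) x)"
        by (simp only: mult_ac)
      also have "\<dots> = (S ^ (t i - l) * (F i (t i) x * x (i, l))) * (S ^ (l' - t i) * (F i l' x * x (i, t i)))"
        using 2 l by (simp only: below' above')
      also have "\<dots> = (S ^ (t i - l) * S ^ (l' - t i)) * (F i l' x * x (i, l)) * (x (i, t i) * F i (t i) x)"
        by (simp only: mult_ac)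
      also have "S ^ (t i - l) * S ^ (l' - t i) = S ^ (l' - l)" using 2 by (simp flip: power_add)
      finally show ?thesis using x0 F0' by simp
    next
      case 3
      have "(F i l x * x (i, l')) * F i (t i) x = F i l x * (x (i, l') * F i (t i) x)" by (simp only: mult_ac)
      also have "\<dots> = F i l x * (S ^ (l' - t i) * (F i l' x * x (i, t i)))" using 3 l by (simp only: above')
      also have "S ^ (l' - t i) = S ^ (l' - l) * S ^ (l - t i)" using 3 l by (simp flip: power_add)
      also have "F i l x * (S ^ (l' - l) * S ^ (l - t i) * (F i l' x * x (i, t i))) =
          S ^ (l' - l) * F i l' x * (S ^ (l - t i) * (F i l x * x (i, t i)))" by (simp only: mult_ac)
      also have "\<dots> = S ^ (l' - l) * F i l' x * (x (i, l) * F i (t i) x)" using 3 l by (simp only: above')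
      finally have "(F i l x * x (i, l')) * F i (t i) x = (S ^ (l' - l) * (F i l' x * x (i, l))) * F i (t i) x"
        by (simp only: mult_ac)
      with F0' show ?thesis by simp
    qed
  qed
  have "(\<Sum>\<kappa>\<in>Mon (eq_deg e). ?\<eta> (eq_coeff e \<kappa>) * mon_eval x \<kappa>) = 0" if e: "e \<in> eqs" for e
  proof -
    obtain i l l' where e: "e = (i, l, Some l')" "i < k" "l < l'" "l' \<le> n i" using e by (auto simp: eqs_def)
    then have v: "(i, l) \<in> vars" "(i, l') \<in> vars" by (auto simp: vars_def)
    show ?thesis
      unfolding e(1) eq_coeff_sum[OF comm_ring_hom_line_eval v] using eq[OF e(2-4)] by (simp add: F_def S_def)
  qed
  moreover have "fps_nth (x v) 0 = point v" for v unfolding x_def by (rule lift_nth_0[OF y0])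
  ultimately show ?thesis by blast
qed

end

section \<open>Fixed points of generic maps\<close>

context param_system
begin

text \<open>Corank 0 persists for generic parameters, whereas evaluation at a normalized zero would
  annihilate the system without killing \<open>x0 D\<close>.\<close>

lemma no_common_zero_generic:
  assumes "spanned (sys \<theta>0) [] \<Gamma>"
  shows "\<exists>g. mpoly_eval \<theta>0 g \<noteq> 0 \<and> (\<forall>\<theta>. mpoly_eval \<theta> g \<noteq> 0 \<longrightarrow>
    (\<forall>x. normalized x \<longrightarrow> (\<exists>e\<in>I. mpoly_eval x (Eqn \<theta> e) \<noteq> 0)))"
proof -
  define D where "D = (\<lambda>_::nat. \<Gamma> + (\<Sum>e\<in>I. \<Sum>i<k. dg e i))"
  have dg_le: "dg e i \<le> D i" if "e \<in> I" "i < k" for e i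
  proof -
    have "dg e i \<le> (\<Sum>i<k. dg e i)" by (rule member_le_sum) (use that in auto)
    also have "\<dots> \<le> (\<Sum>e\<in>I. \<Sum>i<k. dg e i)" by (rule member_le_sum) (use that finite_I in auto)
    finally show ?thesis by (simp add: D_def)
  qed
  then have fits: "fits D" by (auto simp: fits_def)
  have sp: "\<phi> P = 0" if "clin \<phi>" "annihilates \<phi> (sys \<theta>0) D" "P \<in> Forms D" for \<phi> P
    by (rule spannedD[OF assms _ that(1,2) _ that(3)]) (auto simp: D_def)
  obtain g U \<Phi> where g: "mpoly_eval \<theta>0 g \<noteq> 0" "solves_identity D (0::nat) (\<lambda>_. 0) g U \<Phi>"
    by (rule solves_identity_exists[where ?\<theta>0.0 = \<theta>0 and N = "0::nat" and bD = "\<lambda>_. 0", OF fits]) (use sp in auto)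
  have "\<exists>e\<in>I. mpoly_eval x (Eqn \<theta> e) \<noteq> 0" if "mpoly_eval \<theta> g \<noteq> 0" "normalized x" for \<theta> x
  proof (rule ccontr)
    assume "\<not> ?thesis"
    then have ann: "annihilates (mpoly_eval x) (sys \<theta>) D" by (intro annihilates_evaluation) auto
    have "inj_at (sys \<theta>) D (0::nat) (\<lambda>_. 0)" by (rule inj_at_generic[OF g(2) fits _ that(1)]) simp
    then have "mpoly_eval x (x0 D) = 0"
      using ann clin_mpoly_eval x0_in_Forms unfolding inj_at_def by blast
    then show False using mpoly_eval_x0_normalized[OF that(2)] by simp
  qed
  with g(1) show ?thesis by blast
qed

end

lemma mon_eval_hom: "comm_ring_hom h \<Longrightarrow> h (mon_eval x \<mu>) = mon_eval (\<lambda>v. h (x v)) \<mu>"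
proof -
  assume "comm_ring_hom h"
  then interpret comm_ring_hom h .
  show ?thesis by (simp add: mon_eval_def hom_prod hom_power)
qed

lemma mpoly_eval_substitution:
  "mpoly_eval y (hom_eval cst x P) = mpoly_eval (\<lambda>v. mpoly_eval y (x v)) P"
  by (simp add: hom_eval_def mpoly_eval_alt[of _ P] mpe.hom_sum mpe.hom_mult mon_eval_hom[OF mpe.comm_ring_hom_axioms])

lemma comm_ring_hom_poly: "comm_ring_hom (\<lambda>p. poly p a)"
  by unfold_locales auto

text \<open>In the single parameter v this is a nonzero polynomial, with finitely many roots. It
  serves to leave s = 0 within the open set.\<close>

lemma mpoly_eval_upd_nonzero:
  fixes g :: "('v, complex) mpoly"
  assumes "mpoly_eval \<theta> g \<noteq> 0"
  shows "\<exists>s. s \<noteq> 0 \<and> mpoly_eval (\<theta>(v := s)) g \<noteq> 0"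
proof -
  define p where "p = hom_eval (\<lambda>c. [:c:]) (\<lambda>w. if w = v then [:0, 1:] else [:\<theta> w:]) g"
  have ev: "poly p s = mpoly_eval (\<theta>(v := s)) g" for s
  proof -
    have "(\<lambda>w. poly (if w = v then [:0, 1:] else [:\<theta> w:]) s) = \<theta>(v := s)" by auto
    then show ?thesis
      by (simp add: p_def hom_eval_def mpoly_eval_alt poly_sum mon_eval_hom[OF comm_ring_hom_poly])
  qed
  have "poly p (\<theta> v) \<noteq> 0" using assms by (simp add: ev)
  then have "finite {s. poly p s = 0}" by (intro poly_roots_finite) auto
  then have "finite (insert 0 {s. poly p s = 0})" by simp
  then obtain s where "s \<notin> insert 0 {s. poly p s = 0}" using ex_new_if_finite infinite_UNIV_char_0 by blast
  then show ?thesis by (auto simp: ev)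
qed

context multigraded_map
begin

lemma sols_generic:
  "\<exists>g. mpoly_eval special_par g \<noteq> 0 \<and> (\<forall>\<theta>. mpoly_eval \<theta> g \<noteq> 0 \<longrightarrow>
    finite (main.sols \<theta>) \<and> card (main.sols \<theta>) = card leaves \<and>
    (\<forall>x. (\<forall>e\<in>eqs. mpoly_eval x (main.Eqn \<theta> e) = 0) \<longrightarrow> (\<forall>j<k. \<exists>l\<le>n j. x (j, l) \<noteq> 0) \<longrightarrow> (\<forall>j<k. x (j, 0) \<noteq> 0)))"
proof -
  obtain B \<Gamma> where B: "spanned (main.sys special_par) B \<Gamma>" "length B = card leaves" "\<forall>(\<gamma>, b)\<in>set B. b \<in> Forms \<gamma>"
    using corank_le_special unfolding corank_le_def sys_special by blast
  have fin: "finite leaves" unfolding leaves_def by (intro finite_SigmaI finite_leaf_t) (auto intro: finite_subset[OF _ finite_leaf_choices[OF finite_pending]])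
  obtain e where e: "bij_betw e {..<card leaves} leaves"
    using ex_bij_betw_nat_finite[OF fin] by (auto simp: lessThan_atLeast0)
  define p where "p a = leaf.point k n (fst (e a)) (snd (e a))" for a
  have leaf: "leaf k n d (fst (e a)) (snd (e a))" if "a < card leaves" for a
    using bij_betw_apply[OF e, of a] that by unfold_locales auto
  show ?thesis
  proof (rule main.generic_count[OF B])
    show "normalized (p a)" if "a < card leaves" for a
      using leaf.normalized_point[OF leaf[OF that]] by (simp add: p_def)
    show "inj_on p {..<card leaves}"
    proof -
      have "inj_on (\<lambda>z. leaf.point k n (fst z) (snd z)) leaves"
        by (rule inj_onI) (metis leaf_points_inj prod.collapse)
      then show ?thesis
        using comp_inj_on[of e "{..<card leaves}" "\<lambda>z. leaf.point k n (fst z) (snd z)"] e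
        unfolding bij_betw_def by (simp add: p_def [abs_def] comp_def)
    qed
    show "main.formal_solutions special_par (card leaves) p"
      unfolding main.formal_solutions_def p_def using leaf.formal_solution_exists[OF leaf] by blast
  qed
qed

text \<open>Adding F_il = 0 for all l to the equations gives corank 0 at the degenerate parameters,
  hence generically no common normalized zero.\<close>

lemma component_nonzero_generic:
  assumes i: "i < k"
  shows "\<exists>g. mpoly_eval special_par g \<noteq> 0 \<and> (\<forall>\<theta>. mpoly_eval \<theta> g \<noteq> 0 \<longrightarrow>
    (\<forall>x\<in>main.sols \<theta>. \<exists>l\<le>n i. mpoly_eval x (Fpoly \<theta> i l) \<noteq> 0))"
proof -
  interpret b: param_system k n "eqs \<union> base_eqs i" eq_deg eq_coeff
    by unfold_locales (simp add: finite_eqs base_eqs_def)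
  have "(\<lambda>e. (eq_deg e, main.Eqn special_par e)) ` base_eqs i = (\<lambda>l. (dG i, G (i, l))) ` {..n i}"
    unfolding base_eqs_def image_image by (intro image_cong refl) (simp add: Eqn_None Fpoly_special)
  then have "b.sys special_par = (\<lambda>l. (dG i, G (i, l))) ` {..n i} \<union> (\<Union>i<k. special_sys i)"
    unfolding b.sys_def image_Un sys_special[symmetric] main.sys_def by blast
  then obtain \<Gamma> where "spanned (b.sys special_par) [] \<Gamma>"
    using corank_le_special_base[OF i] unfolding corank_le_def by auto
  from b.no_common_zero_generic[OF this] obtain g where g: "mpoly_eval special_par g \<noteq> 0"
    "\<And>\<theta> x. mpoly_eval \<theta> g \<noteq> 0 \<Longrightarrow> normalized x \<Longrightarrow> \<exists>e\<in>eqs \<union> base_eqs i. mpoly_eval x (main.Eqn \<theta> e) \<noteq> 0"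
    by blast
  have "\<exists>l\<le>n i. mpoly_eval x (Fpoly \<theta> i l) \<noteq> 0" if "mpoly_eval \<theta> g \<noteq> 0" "x \<in> main.sols \<theta>" for \<theta> x
    using g(2)[OF that(1), of x] that(2) by (auto simp: main.sols_def base_eqs_def Eqn_None)
  with g(1) show ?thesis by blast
qed

lemma Forms_dG: "i < k \<Longrightarrow> Forms (dG i) = Forms (d i)"
  by (rule Forms_cong) (rule dG_eq)

text \<open>The factors \<open>s\<^bsup>-l\<^esup>\<close> turn the equations with degeneration parameter \<open>s\<close> into the fixed point equations
  of \<open>F\<close>. Parameters that do not belong to \<open>F\<close> keep their values at the degenerate point.\<close>

definition par :: "complex \<Rightarrow> (nat \<Rightarrow> nat \<Rightarrow> (nat \<times> nat, complex) mpoly) \<Rightarrow> param \<Rightarrow> complex" where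
  "par s F = (\<lambda>None \<Rightarrow> s | Some (i, l, \<mu>) \<Rightarrow>
     if i < k \<and> l \<le> n i then inverse s ^ l * lookup (F i l) \<mu> else lookup (G (i, l)) \<mu>)"

lemma par_None [simp]: "par s F None = s"
  by (simp add: par_def)

lemma Fpoly_par:
  assumes "i < k" "l \<le> n i" "F i l \<in> Forms (dG i)"
  shows "Fpoly (par s F) i l = cst (inverse s ^ l) * F i l"
proof -
  have "F i l = (\<Sum>\<mu>\<in>Mon (dG i). single \<mu> (lookup (F i l) \<mu>))"
    by (subst mpoly_sum_single, rule sum.mono_neutral_left)
      (use assms(3) in \<open>auto simp: Forms_def in_keys_iff intro: finite_Mon\<close>)
  then have "cst (inverse s ^ l) * F i l = cst (inverse s ^ l) * (\<Sum>\<mu>\<in>Mon (dG i). single \<mu> (lookup (F i l) \<mu>))"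
    by simp
  also have "\<dots> = Fpoly (par s F) i l"
    using assms by (simp add: Fpoly_def par_def sum_distrib_left mult_single)
  finally show ?thesis by simp
qed

text \<open>For fixed s the parameters depend on the coefficients of F by an affine linear map, so
  open conditions on parameters pull back to open conditions on maps.\<close>

lemma par_pullback: "\<exists>g'. \<forall>F. mpoly_eval (map_coeff F) g' = mpoly_eval (par s F) g"
proof -
  define x where "x = (\<lambda>None \<Rightarrow> cst s | Some (i, l, \<mu>) \<Rightarrow>
     if i < k \<and> l \<le> n i then cst (inverse s ^ l) * mvar (i, l, \<mu>) else cst (lookup (G (i, l)) \<mu>))"
  have "(\<lambda>v. mpoly_eval (map_coeff F) (x v)) = par s F" for F
    by (rule ext) (auto simp: x_def par_def map_coeff_def mpe.hom_mult split: option.splits)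
  then have "mpoly_eval (map_coeff F) (hom_eval cst x g) = mpoly_eval (par s F) g" for F
    by (simp only: mpoly_eval_substitution)
  then show ?thesis by blast
qed

text \<open>The factor s^l cancels the one in \<open>par\<close>. This map lies over the degenerate
  coefficients with parameter s and shows that the open set is nonempty.\<close>

definition special_map :: "complex \<Rightarrow> nat \<Rightarrow> nat \<Rightarrow> (nat \<times> nat, complex) mpoly" where
  "special_map s i l = (if i < k \<and> l \<le> n i then cst (s ^ l) * G (i, l) else 0)"

lemma par_special_map:
  assumes "s \<noteq> 0"
  shows "par s (special_map s) = special_par(None := s)"
proof
  fix v
  show "par s (special_map s) v = (special_par(None := s)) v"
    using assms by (cases v) (auto simp: par_def special_map_def lookup_cst_mult power_inverse split: prod.splits)
qed


end

context multigrading
begin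

lemma mon_eval_scale:
  fixes x :: "nat \<Rightarrow> nat \<Rightarrow> complex"
  assumes "keys \<mu> \<subseteq> vars"
  shows "mon_eval (\<lambda>(i, j). c i * x i j) \<mu> = (\<Prod>i<k. c i ^ mdeg \<mu> i) * mon_eval (\<lambda>(i, j). x i j) \<mu>"
proof -
  have "(\<Prod>v\<in>vars. c (fst v) ^ lookup \<mu> v) = (\<Prod>i<k. \<Prod>j\<le>n i. c i ^ lookup \<mu> (i, j))"
  proof -
    have "vars = (SIGMA i:{..<k}. {..n i})" by (auto simp: vars_def)
    then show ?thesis by (simp add: prod.Sigma case_prod_unfold)
  qed
  then show ?thesis
    by (simp add: mon_eval_superset[OF finite_vars assms] case_prod_unfold power_mult_distrib prod.distrib mdeg_def power_sum)
qed

lemma multihomogeneous_iff: "multihomogeneous k n D P \<longleftrightarrow> P \<in> Forms D"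
proof
  assume P: "P \<in> Forms D"
  have "mpoly_eval (\<lambda>(i, j). c i * x i j) P = (\<Prod>i<k. c i ^ D i) * mpoly_eval (\<lambda>(i, j). x i j) P" for c x
    unfolding mpoly_eval_alt sum_distrib_left
  proof (rule sum.cong[OF refl])
    fix \<mu> assume "\<mu> \<in> keys P"
    then have "keys \<mu> \<subseteq> vars" "\<And>i. i < k \<Longrightarrow> mdeg \<mu> i = D i" using P by (auto simp: Forms_def Mon_def)
    then show "lookup P \<mu> * mon_eval (\<lambda>(i, j). c i * x i j) \<mu> =
        (\<Prod>i<k. c i ^ D i) * (lookup P \<mu> * mon_eval (\<lambda>(i, j). x i j) \<mu>)"
      by (simp add: mon_eval_scale)
  qed
  moreover have "mpoly_vars P \<subseteq> {(i, j). i < k \<and> j \<le> n i}"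
    using P by (auto simp: mpoly_vars_def Forms_def Mon_def vars_def)
  ultimately show "multihomogeneous k n D P" by (simp add: multihomogeneous_def)
next
  assume hom: "multihomogeneous k n D P"
  have keys: "keys \<mu> \<subseteq> vars" if "\<mu> \<in> keys P" for \<mu>
    using hom that by (auto simp: multihomogeneous_def mpoly_vars_def vars_def)
  have deg: "mdeg \<mu> i = D i" if \<mu>: "\<mu> \<in> keys P" and i: "i < k" for \<mu> i
  proof -
    \<comment> \<open>Scaling group i alone by 2 suffices, because a power of 2 determines its
      exponent; the difference \<open>Q\<close> of both sides is then the zero polynomial.\<close>
    let ?c = "\<lambda>j. if j = i then 2 else 1 :: complex"
    have pow: "(\<Prod>j<k. ?c j ^ f j) = 2 ^ f i" for f
    proof -
      have "(\<Prod>j<k. ?c j ^ f j) = (\<Prod>j<k. if j = i then 2 ^ f i else 1)" by (rule prod.cong) auto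
      then show ?thesis using i by simp
    qed
    define Q where "Q = (\<Sum>\<mu>\<in>keys P. single \<mu> ((2 ^ mdeg \<mu> i - 2 ^ D i) * lookup P \<mu>))"
    have "mpoly_eval y Q = 0" for y
    proof -
      define x where "x i j = y (i, j)" for i j
      have y: "(\<lambda>(i, j). x i j) = y" by (auto simp: x_def)
      have "(\<Sum>\<mu>\<in>keys P. 2 ^ mdeg \<mu> i * (lookup P \<mu> * mon_eval y \<mu>)) = mpoly_eval (\<lambda>(i, j). ?c i * x i j) P"
        unfolding mpoly_eval_alt
      proof (rule sum.cong[OF refl])
        fix \<mu> assume "\<mu> \<in> keys P"
        then show "2 ^ mdeg \<mu> i * (lookup P \<mu> * mon_eval y \<mu>) = lookup P \<mu> * mon_eval (\<lambda>(i, j). ?c i * x i j) \<mu>"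
          by (subst mon_eval_scale[OF keys]) (simp_all only: pow y mult_ac)
      qed
      also have "\<dots> = 2 ^ D i * mpoly_eval y P"
        using hom unfolding multihomogeneous_def by (simp only: pow y)
      finally have "(\<Sum>\<mu>\<in>keys P. 2 ^ mdeg \<mu> i * (lookup P \<mu> * mon_eval y \<mu>)) =
          (\<Sum>\<mu>\<in>keys P. 2 ^ D i * (lookup P \<mu> * mon_eval y \<mu>))"
        by (simp only: mpoly_eval_alt sum_distrib_left)
      then have "(\<Sum>\<mu>\<in>keys P. (2 ^ mdeg \<mu> i - 2 ^ D i) * lookup P \<mu> * mon_eval y \<mu>) = 0"
        by (simp only: left_diff_distrib sum_subtractf mult.assoc diff_self)
      then show ?thesis by (simp only: Q_def mpe.hom_sum mpoly_eval_single)
    qed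
    then have "Q = 0" by (rule mpoly_eq_0_if_eval_0)
    moreover have "lookup Q \<mu> = (2 ^ mdeg \<mu> i - 2 ^ D i) * lookup P \<mu>"
      using \<mu> by (simp add: Q_def lookup_sum lookup_single when_def)
    ultimately have "(2::complex) ^ mdeg \<mu> i = 2 ^ D i" using \<mu> by (simp add: in_keys_iff)
    then have "of_nat (2 ^ mdeg \<mu> i) = (of_nat (2 ^ D i) :: complex)" by simp
    then have "(2::nat) ^ mdeg \<mu> i = 2 ^ D i" by (simp only: of_nat_eq_iff)
    then show ?thesis by simp
  qed
  from keys deg show "P \<in> Forms D" by (auto simp: Forms_def Mon_def)
qed

end

section \<open>From normalized solutions to projective fixed points\<close>

lemma equiv_proj_rel: "equiv (nonzero_vecs m) (proj_rel m)"
proof (rule equivI)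
  show "proj_rel m \<subseteq> nonzero_vecs m \<times> nonzero_vecs m" by (auto simp: proj_rel_def)
  show "refl_on (nonzero_vecs m) (proj_rel m)"
    by (rule refl_onI) (auto simp: proj_rel_def intro!: exI[of _ 1])
  show "sym (proj_rel m)"
  proof (rule symI)
    fix x y assume "(x, y) \<in> proj_rel m"
    then obtain c where "x \<in> nonzero_vecs m" "y \<in> nonzero_vecs m" "c \<noteq> 0" "y = (\<lambda>j. c * x j)"
      by (auto simp: proj_rel_def)
    then show "(y, x) \<in> proj_rel m"
      unfolding proj_rel_def by (auto intro!: exI[of _ "inverse c"])
  qed
  show "trans (proj_rel m)"
  proof (rule transI)
    fix x y z assume "(x, y) \<in> proj_rel m" "(y, z) \<in> proj_rel m"
    then obtain c c' where "x \<in> nonzero_vecs m" "z \<in> nonzero_vecs m" "c \<noteq> 0" "c' \<noteq> 0" "z = (\<lambda>j. c' * (c * x j))"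
      by (auto simp: proj_rel_def)
    then show "(x, z) \<in> proj_rel m"
      unfolding proj_rel_def by (auto intro!: exI[of _ "c' * c"])
  qed
qed

lemma proj_space_class:
  assumes "q \<in> proj_space m" "u \<in> q"
  shows "u \<in> nonzero_vecs m" "q = proj_rel m `` {u}"
proof -
  obtain v where v: "v \<in> nonzero_vecs m" "q = proj_rel m `` {v}"
    using assms(1) unfolding proj_space_def by (rule quotientE)
  then have vu: "(v, u) \<in> proj_rel m" using assms(2) by simp
  then show "u \<in> nonzero_vecs m" by (simp add: proj_rel_def)
  show "q = proj_rel m `` {u}" using equiv_class_eq[OF equiv_proj_rel vu] v(2) by simp
qed

locale given_map = multigraded_map k n d for k n d +
  fixes F :: "nat \<Rightarrow> nat \<Rightarrow> (nat \<times> nat, complex) mpoly" and s :: complex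
  assumes F: "F \<in> multiproj_maps k n d" and s: "s \<noteq> 0"
begin

lemma F_hom: "i < k \<Longrightarrow> l \<le> n i \<Longrightarrow> multihomogeneous k n (d i) (F i l)"
  using F by (auto simp: multiproj_maps_def)

lemma F_outside: "i < k \<Longrightarrow> n i < l \<Longrightarrow> F i l = 0"
  using F by (auto simp: multiproj_maps_def)

lemma F_in_Forms: "i < k \<Longrightarrow> l \<le> n i \<Longrightarrow> F i l \<in> Forms (dG i)"
  using F_hom[of i l] by (simp add: multihomogeneous_iff Forms_dG)

lemma eval_Fpoly: "i < k \<Longrightarrow> l \<le> n i \<Longrightarrow> mpoly_eval x (Fpoly (par s F) i l) = inverse s ^ l * mpoly_eval x (F i l)"
  by (simp add: Fpoly_par F_in_Forms mpe.hom_mult)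

text \<open>As s^(l'-l) s^(-l') = s^(-l), the degenerate equation is s^(-l) times the condition that
  the values of F and the coordinates are proportional.\<close>

lemma eqs_iff:
  "(\<forall>e\<in>eqs. mpoly_eval x (main.Eqn (par s F) e) = 0) \<longleftrightarrow>
    (\<forall>i<k. \<forall>l\<le>n i. \<forall>l'\<le>n i. mpoly_eval x (F i l) * x (i, l') = mpoly_eval x (F i l') * x (i, l))"
proof -
  let ?f = "\<lambda>i l. mpoly_eval x (F i l)"
  have ev: "mpoly_eval x (main.Eqn (par s F) (i, l, Some l')) = 0 \<longleftrightarrow> ?f i l * x (i, l') = ?f i l' * x (i, l)"
    if "i < k" "l < l'" "l' \<le> n i" for i l l'
  proof -
    have v: "(i, l) \<in> vars" "(i, l') \<in> vars" using that by (auto simp: vars_def)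
    have "s ^ (l' - l) * inverse s ^ l' = inverse s ^ l"
    proof -
      have "inverse s ^ l' = inverse s ^ (l' - l) * inverse s ^ l" using that by (simp flip: power_add)
      moreover have "s ^ (l' - l) * inverse s ^ (l' - l) = 1" using s by (simp add: power_inverse)
      ultimately show ?thesis by (simp only: mult.assoc[symmetric] mult_1)
    qed
    then have sl: "s ^ (l' - l) * (inverse s ^ l' * a) = inverse s ^ l * a" for a
      by (metis mult.assoc)
    have "mpoly_eval x (main.Eqn (par s F) (i, l, Some l')) = inverse s ^ l * (?f i l * x (i, l') - ?f i l' * x (i, l))"
    proof -
      have l: "l \<le> n i" using that by simp
      show ?thesis
        unfolding Eqn_Some[OF v] mpe.hom_minus mpe.hom_mult mpe.hom_power mpoly_eval_cst par_None mpoly_eval_mvar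
          eval_Fpoly[OF that(1) l] eval_Fpoly[OF that(1,3)]
        by (simp only: right_diff_distrib mult.assoc sl)
    qed
    then show ?thesis using s by simp
  qed
  show ?thesis
  proof (intro iffI allI impI)
    fix i l l' assume *: "\<forall>e\<in>eqs. mpoly_eval x (main.Eqn (par s F) e) = 0" "i < k" "l \<le> n i" "l' \<le> n i"
    have **: "?f i l * x (i, l') = ?f i l' * x (i, l)" if "l < l'" "l' \<le> n i" for l l'
      using ev[of i l l'] * that by (auto simp: eqs_def)
    show "?f i l * x (i, l') = ?f i l' * x (i, l)"
      using **[of l l'] **[of l' l] * by (cases l l' rule: linorder_cases) auto
  next
    assume *: "\<forall>i<k. \<forall>l\<le>n i. \<forall>l'\<le>n i. ?f i l * x (i, l') = ?f i l' * x (i, l)"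
    show "\<forall>e\<in>eqs. mpoly_eval x (main.Eqn (par s F) e) = 0"
    proof
      fix e assume "e \<in> eqs"
      then obtain i l l' where "e = (i, l, Some l')" "i < k" "l < l'" "l' \<le> n i" by (auto simp: eqs_def)
      with ev[of i l l'] * show "mpoly_eval x (main.Eqn (par s F) e) = 0" by auto
    qed
  qed
qed

definition proj_point :: "(nat \<times> nat \<Rightarrow> complex) \<Rightarrow> nat \<Rightarrow> (nat \<Rightarrow> complex) set" where
  "proj_point x = (\<lambda>i\<in>{..<k}. proj_rel (n i) `` {\<lambda>l. x (i, l)})"

lemma normalized_block: "normalized x \<Longrightarrow> i < k \<Longrightarrow> (\<lambda>l. x (i, l)) \<in> nonzero_vecs (n i)"
  by (auto simp: normalized_def nonzero_vecs_def vars_def intro!: exI[of _ 0])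

lemma inj_proj_point: "inj_on proj_point {x. normalized x}"
proof (rule inj_onI, clarify, rule ext, clarify)
  fix x y i l assume x: "normalized x" and y: "normalized y" and eq: "proj_point x = proj_point y"
  show "x (i, l) = y (i, l)"
  proof (cases "i < k")
    case True
    then have "proj_rel (n i) `` {\<lambda>l. x (i, l)} = proj_rel (n i) `` {\<lambda>l. y (i, l)}"
      using fun_cong[OF eq, of i] by (simp add: proj_point_def)
    then have "((\<lambda>l. x (i, l)), (\<lambda>l. y (i, l))) \<in> proj_rel (n i)"
      using eq_equiv_class_iff[OF equiv_proj_rel] normalized_block[OF x True] normalized_block[OF y True] by blast
    then obtain c where c: "y (i, l) = c * x (i, l)" for l by (auto simp: proj_rel_def fun_eq_iff)
    have "c = 1" using c[of 0] x y True by (simp add: normalized_def)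
    with c show ?thesis by simp
  next
    case False
    then show ?thesis using x y by (simp add: normalized_def vars_def)
  qed
qed

lemma proj_point_in_fixed_points:
  assumes x: "x \<in> main.sols (par s F)" and nz: "\<And>i. i < k \<Longrightarrow> \<exists>l\<le>n i. mpoly_eval x (F i l) \<noteq> 0"
  shows "proj_point x \<in> fixed_points k n F"
proof -
  have norm: "normalized x" using x by (simp add: main.sols_def)
  have eq: "mpoly_eval x (F i l) * x (i, l') = mpoly_eval x (F i l') * x (i, l)"
    if "i < k" "l \<le> n i" "l' \<le> n i" for i l l'
    using x eqs_iff[of x] that by (auto simp: main.sols_def)
  have rel: "((\<lambda>l. x (i, l)), component_value F i (\<lambda>i l. x (i, l))) \<in> proj_rel (n i)" if i: "i < k" for i
  proof -
    \<comment> \<open>Since x_i0 = 1, the equations for the pairs (0, l) exhibit this as the factor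
      of proportionality.\<close>
    define c where "c = mpoly_eval x (F i 0)"
    have f: "mpoly_eval x (F i l) = c * x (i, l)" for l
    proof (cases "l \<le> n i")
      case True
      then show ?thesis using eq[of i 0 l] i norm by (simp add: normalized_def c_def)
    next
      case False
      then have "(i, l) \<notin> vars" by (simp add: vars_def)
      then have "x (i, l) = 0" using norm unfolding normalized_def by blast
      moreover have "F i l = 0" using False i by (intro F_outside) auto
      ultimately show ?thesis by (simp only: mpe.hom_zero mult_zero_right)
    qed
    have c: "c \<noteq> 0" using nz[OF i] f by auto
    have "component_value F i (\<lambda>i l. x (i, l)) = (\<lambda>l. c * x (i, l))"
      by (simp add: component_value_def f)
    then show ?thesis
      using normalized_block[OF norm i] c by (auto simp: proj_rel_def nonzero_vecs_def)
  qed
  have space: "proj_point x \<in> multiproj_space k n"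
    unfolding multiproj_space_def proj_point_def proj_space_def
    using normalized_block[OF norm] by (auto intro: quotientI)
  have "(\<lambda>l. x (i, l)) \<in> proj_point x i \<and> component_value F i (\<lambda>i l. x (i, l)) \<in> proj_point x i" if "i < k" for i
    using rel[OF that] equiv_class_self[OF equiv_proj_rel normalized_block[OF norm that]] that
    by (simp add: proj_point_def)
  with space show ?thesis
    unfolding fixed_points_def maps_to_def by (intro CollectI conjI exI[of _ "\<lambda>i l. x (i, l)"]) simp_all
qed

text \<open>Coordinates of a fixed point solve the equations in any scaling; the assumption on the
  chart makes every x_j0 nonzero, so that they can be normalized.\<close>

lemma fixed_point_is_proj_point:
  assumes p: "p \<in> fixed_points k n F"
    and affine: "\<And>x j. (\<forall>e\<in>eqs. mpoly_eval x (main.Eqn (par s F) e) = 0) \<Longrightarrow>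
      (\<forall>j<k. \<exists>l\<le>n j. x (j, l) \<noteq> 0) \<Longrightarrow> j < k \<Longrightarrow> x (j, 0) \<noteq> 0"
  shows "\<exists>x\<in>main.sols (par s F). p = proj_point x"
proof -
  obtain x where p_space: "p \<in> multiproj_space k n" and x: "\<And>i. i < k \<Longrightarrow> x i \<in> p i"
    "\<And>i. i < k \<Longrightarrow> component_value F i x \<in> p i"
    using p by (auto simp: fixed_points_def maps_to_def)
  have pi: "p i \<in> proj_space (n i)" if "i < k" for i
    using p_space that by (auto simp: multiproj_space_def)
  note cls = proj_space_class[OF pi x(1)]
  define z where "z = (\<lambda>(i, j). x i j)"
  have "\<exists>c. \<forall>l. mpoly_eval z (F i l) = c * x i l" if i: "i < k" for i
  proof -
    have "(x i, component_value F i x) \<in> proj_rel (n i)" using x(2)[OF i] cls(2)[OF i i] by auto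
    then show ?thesis by (auto simp: proj_rel_def component_value_def z_def fun_eq_iff)
  qed
  then have eq: "mpoly_eval z (F i l) * z (i, l') = mpoly_eval z (F i l') * z (i, l)" if "i < k" for i l l'
    using that by (fastforce simp: z_def)
  have "x j 0 \<noteq> 0" if "j < k" for j
  proof -
    have "\<exists>l\<le>n j. z (j, l) \<noteq> 0" if j: "j < k" for j
    proof -
      obtain l where "x j l \<noteq> 0" "\<not> n j < l" using cls(1)[OF j j] unfolding nonzero_vecs_def by blast
      then show ?thesis by (auto simp: z_def intro!: exI[of _ l])
    qed
    then have "z (j, 0) \<noteq> 0" using affine[of z j] eqs_iff[of z] eq that by blast
    then show ?thesis by (simp add: z_def)
  qed
  note x0 = this
  define c where "c i = (if i < k then inverse (x i 0) else 0)" for i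
  define y where "y = (\<lambda>(i, j). c i * x i j)"
  have norm: "normalized y"
    using x0 cls(1) unfolding normalized_def by (auto simp: y_def c_def vars_def nonzero_vecs_def)
  have "mpoly_eval y (F i l) * y (i, l') = mpoly_eval y (F i l') * y (i, l)" if "i < k" "l \<le> n i" "l' \<le> n i" for i l l'
  proof -
    have "mpoly_eval y (F i l) = (\<Prod>j<k. c j ^ d i j) * mpoly_eval z (F i l)" if "l \<le> n i" for l
      using F_hom[OF \<open>i < k\<close> that] unfolding y_def z_def multihomogeneous_def by blast
    moreover have "y (i, l) = c i * z (i, l)" for l by (simp add: y_def z_def)
    ultimately show ?thesis using eq[of i l l'] that by simp
  qed
  then have "y \<in> main.sols (par s F)" using norm eqs_iff[of y] by (simp add: main.sols_def)
  moreover have "p = proj_point y"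
  proof
    fix i
    show "p i = proj_point y i"
    proof (cases "i < k")
      case True
      have "(x i, (\<lambda>l. y (i, l))) \<in> proj_rel (n i)"
        using cls(1)[OF True True] normalized_block[OF norm True] True x0[OF True]
        unfolding proj_rel_def by (auto simp: y_def c_def intro!: exI[of _ "inverse (x i 0)"])
      from equiv_class_eq[OF equiv_proj_rel this] cls(2)[OF True True] True show ?thesis
        by (simp add: proj_point_def)
    next
      case False
      then show ?thesis using p_space by (auto simp: multiproj_space_def proj_point_def PiE_iff extensional_def)
    qed
  qed
  ultimately show ?thesis by blast
qed

end

context multigraded_map
begin

lemma special_map_in_maps: "special_map s \<in> multiproj_maps k n d"
proof -
  have "multihomogeneous k n (d i) (special_map s i l)" if "i < k" "l \<le> n i" for i l
    using that G_in_Forms[of "(i, l)"] by (simp add: special_map_def multihomogeneous_iff Forms_cst Forms_dG)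
  then show ?thesis by (auto simp: multiproj_maps_def special_map_def)
qed

lemma generic_fixed_points:
  "for_generic_map k n d (\<lambda>F. has_num_fixed_points k n F (int (card leaves)))"
proof -
  obtain g where g: "mpoly_eval special_par g \<noteq> 0"
    and sols: "\<And>\<theta>. mpoly_eval \<theta> g \<noteq> 0 \<Longrightarrow> finite (main.sols \<theta>) \<and> card (main.sols \<theta>) = card leaves"
    and affine: "\<And>\<theta> x j. mpoly_eval \<theta> g \<noteq> 0 \<Longrightarrow> \<forall>e\<in>eqs. mpoly_eval x (main.Eqn \<theta> e) = 0 \<Longrightarrow>
      \<forall>j<k. \<exists>l\<le>n j. x (j, l) \<noteq> 0 \<Longrightarrow> j < k \<Longrightarrow> x (j, 0) \<noteq> 0"
    using sols_generic by blast
  have "\<forall>i\<in>{..<k}. \<exists>h. mpoly_eval special_par h \<noteq> 0 \<and> (\<forall>\<theta>. mpoly_eval \<theta> h \<noteq> 0 \<longrightarrow>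
    (\<forall>x\<in>main.sols \<theta>. \<exists>l\<le>n i. mpoly_eval x (Fpoly \<theta> i l) \<noteq> 0))"
    using component_nonzero_generic by simp
  from bchoice[OF this] obtain h where "\<forall>i\<in>{..<k}. mpoly_eval special_par (h i) \<noteq> 0 \<and> (\<forall>\<theta>. mpoly_eval \<theta> (h i) \<noteq> 0 \<longrightarrow>
    (\<forall>x\<in>main.sols \<theta>. \<exists>l\<le>n i. mpoly_eval x (Fpoly \<theta> i l) \<noteq> 0))" by blast
  then have h: "i < k \<Longrightarrow> mpoly_eval special_par (h i) \<noteq> 0"
    "i < k \<Longrightarrow> mpoly_eval \<theta> (h i) \<noteq> 0 \<Longrightarrow> x \<in> main.sols \<theta> \<Longrightarrow> \<exists>l\<le>n i. mpoly_eval x (Fpoly \<theta> i l) \<noteq> 0" for i \<theta> x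
    by auto
  have ev: "mpoly_eval \<theta> (g * (\<Prod>i<k. h i)) \<noteq> 0 \<longleftrightarrow> mpoly_eval \<theta> g \<noteq> 0 \<and> (\<forall>i<k. mpoly_eval \<theta> (h i) \<noteq> 0)" for \<theta>
    by (auto simp: mpe.hom_mult mpe.hom_prod)
  have "mpoly_eval special_par (g * (\<Prod>i<k. h i)) \<noteq> 0" using g h(1) by (simp add: ev)
  \<comment> \<open>The polynomial is nonzero at the degenerate point, where s = 0; the comparison
    with actual maps needs a nonzero s.\<close>
  from mpoly_eval_upd_nonzero[OF this, of None]
  obtain s where s: "s \<noteq> 0" "mpoly_eval (special_par(None := s)) (g * (\<Prod>i<k. h i)) \<noteq> 0" by blast
  obtain g' where g': "\<And>F. mpoly_eval (map_coeff F) g' = mpoly_eval (par s F) (g * (\<Prod>i<k. h i))"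
    using par_pullback by metis
  define U where "U = {F \<in> multiproj_maps k n d. mpoly_eval (map_coeff F) g' \<noteq> 0}"
  have "zariski_open_maps k n d U"
    unfolding zariski_open_maps_def U_def by (intro exI[of _ "{g'}"]) simp
  moreover have "special_map s \<in> U"
    unfolding U_def using special_map_in_maps s g' par_special_map[OF s(1)] by simp
  moreover have "has_num_fixed_points k n F (int (card leaves))" if "F \<in> U" for F
  proof -
    interpret given_map k n d F s
      using that s(1) by unfold_locales (simp_all add: U_def)
    have nz: "mpoly_eval (par s F) g \<noteq> 0" "\<And>i. i < k \<Longrightarrow> mpoly_eval (par s F) (h i) \<noteq> 0"
      using that unfolding U_def by (simp_all add: g' ev)
    have "\<exists>l\<le>n i. mpoly_eval x (F i l) \<noteq> 0" if "x \<in> main.sols (par s F)" "i < k" for x i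
      using h(2)[OF that(2) nz(2)[OF that(2)] that(1)] that(2) by (auto simp: eval_Fpoly)
    then have "proj_point ` main.sols (par s F) = fixed_points k n F"
      using proj_point_in_fixed_points fixed_point_is_proj_point affine[OF nz(1)] by blast
    moreover have "inj_on proj_point (main.sols (par s F))"
      by (rule inj_on_subset[OF inj_proj_point]) (auto simp: main.sols_def)
    ultimately show ?thesis
      using sols[OF nz(1)] card_image[of proj_point "main.sols (par s F)"] finite_imageI[of "main.sols (par s F)" proj_point]
      by (auto simp: has_num_fixed_points_def)
  qed
  ultimately show ?thesis unfolding for_generic_map_def by blast
qed

section \<open>The number of leaves as a coefficient\<close>

lemma sum_factors: "(\<Sum>y\<in>factors (i, l). f (fst y)) = (\<Sum>j<k. of_nat (d i j) * f j)"
  for f :: "nat \<Rightarrow> 'a::comm_semiring_1"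
proof -
  have "(\<Sum>y\<in>factors (i, l). f (fst y)) = (\<Sum>j<k. \<Sum>a<d i j. f j)"
    unfolding factors_def by (subst sum.Sigma) (auto simp: case_prod_unfold)
  then show ?thesis by simp
qed

text \<open>Expanding the product means choosing a factor for each pending pair; a factor in group j
  contributes \<open>f j\<close>, and \<open>d i j\<close> factors contribute the same.\<close>

lemma prod_pending:
  fixes f :: "nat \<Rightarrow> 'a::comm_semiring_1"
  shows "(\<Prod>i<k. (\<Sum>j<k. of_nat (d i j) * f j) ^ t i) = (\<Sum>c\<in>PiE (pending t) factors. \<Prod>x\<in>pending t. f (fst (c x)))"
proof -
  have "(\<Prod>i<k. (\<Sum>j<k. of_nat (d i j) * f j) ^ t i) = (\<Prod>i<k. \<Prod>l<t i. \<Sum>y\<in>factors (i, l). f (fst y))"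
    by (simp add: sum_factors)
  also have "\<dots> = (\<Prod>x\<in>pending t. \<Sum>y\<in>factors x. f (fst y))"
    unfolding pending_def by (subst prod.Sigma) (auto simp: case_prod_unfold)
  also have "\<dots> = (\<Sum>c\<in>PiE (pending t) factors. \<Prod>x\<in>pending t. f (fst (c x)))"
    by (rule prod_sum_PiE) (simp_all add: finite_pending finite_factors)
  finally show ?thesis .
qed

lemma valid_iff_exponents:
  assumes t: "t \<in> PiE {..<k} (\<lambda>i. {..n i})" and c: "c \<in> PiE (pending t) factors"
  shows "(\<Sum>x\<in>pending t. single (fst (c x)) 1) + (\<Sum>i<k. single i (n i - t i)) = (\<Sum>i<k. single i (n i)) \<longleftrightarrow> valid t c"
proof -
  have diag: "lookup (\<Sum>i<k. single i (f i)) j = (if j < k then f j else 0)" for f :: "nat \<Rightarrow> nat" and j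
    by (simp add: lookup_sum lookup_single when_def)
  have cnt: "lookup (\<Sum>x\<in>pending t. single (fst (c x)) 1) j = card {x \<in> pending t. fst (c x) = j}" for j
    using finite_pending by (simp add: lookup_sum lookup_single when_def sum.If_cases Int_def)
  have out: "card {x \<in> pending t. fst (c x) = j} = 0" if "\<not> j < k" for j
  proof -
    have "fst (c x) < k" if "x \<in> pending t" for x
      using PiE_mem[OF c that] by (auto simp: factors_def)
    then have "{x \<in> pending t. fst (c x) = j} = {}" using that by blast
    then show ?thesis by (simp only: card.empty)
  qed
  have le: "t j \<le> n j" if "j < k" for j using t that by auto
  have "(\<Sum>x\<in>pending t. single (fst (c x)) 1) + (\<Sum>i<k. single i (n i - t i)) = (\<Sum>i<k. single i (n i)) \<longleftrightarrow>
      (\<forall>j. card {x \<in> pending t. fst (c x) = j} + (if j < k then n j - t j else 0) = (if j < k then n j else 0))"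
    by (simp only: poly_mapping_eq_iff fun_eq_iff lookup_add diag cnt)
  also have "\<dots> \<longleftrightarrow> (\<forall>j. j < k \<longrightarrow> card {x \<in> pending t. fst (c x) = j} = t j)"
  proof (rule all_cong1)
    fix j
    show "card {x \<in> pending t. fst (c x) = j} + (if j < k then n j - t j else 0) = (if j < k then n j else 0) \<longleftrightarrow>
        (j < k \<longrightarrow> card {x \<in> pending t. fst (c x) = j} = t j)"
      using le[of j] out[of j] by (cases "j < k") (simp_all only: if_True if_False, arith+)
  qed
  also have "\<dots> \<longleftrightarrow> valid t c" by (simp only: valid_def)
  finally show ?thesis .
qed

lemma prod_mvar: "(\<Prod>x\<in>A. mvar (f x)) = (single (\<Sum>x\<in>A. single (f x) 1) 1 :: ('v, 'a::comm_ring_1) mpoly)"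
  by (induction A rule: infinite_finite_induct) (simp_all add: mvar_def mult_single)

lemma card_leaves_coefficient:
  "int (card leaves) = lookup
    (\<Sum>t\<in>PiE {..<k} (\<lambda>i. {0..n i}). \<Prod>i<k. (\<Sum>j<k. of_nat (d i j) * (mvar j :: (nat, int) mpoly)) ^ (n i - t i) * mvar i ^ t i)
    (\<Sum>i<k. single i (n i))" (is "_ = lookup (sum ?f _) ?N")
proof -
  let ?T = "PiE {..<k} (\<lambda>i. {..n i})"
  \<comment> \<open>The reflection t to n - t: in the polynomial, the exponent of \<alpha>_i counts
    the coordinates above the pivot, and the remaining t_i exponents the chosen factors.\<close>
  define r where "r t = (\<lambda>i\<in>{..<k}. n i - t i)" for t
  have r: "r t \<in> ?T" "r (r t) = t" if "t \<in> ?T" for t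
    using that by (auto simp: r_def PiE_iff extensional_def fun_eq_iff)
  have coeff: "lookup (?f (r t)) ?N = (\<Sum>c\<in>PiE (pending t) factors. if valid t c then 1 else 0)" if t: "t \<in> ?T" for t
  proof -
    have "?f (r t) = (\<Prod>i<k. (\<Sum>j<k. of_nat (d i j) * (mvar j :: (nat, int) mpoly)) ^ t i) * (\<Prod>i<k. mvar i ^ (n i - t i))"
      unfolding prod.distrib[symmetric]
    proof (rule prod.cong[OF refl])
      fix i assume "i \<in> {..<k}"
      moreover from this have "t i \<le> n i" using t by auto
      ultimately show "(\<Sum>j<k. of_nat (d i j) * (mvar j :: (nat, int) mpoly)) ^ (n i - r t i) * mvar i ^ r t i =
          (\<Sum>j<k. of_nat (d i j) * (mvar j :: (nat, int) mpoly)) ^ t i * mvar i ^ (n i - t i)"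
        by (simp add: r_def)
    qed
    also have "\<dots> = (\<Sum>c\<in>PiE (pending t) factors.
        single ((\<Sum>x\<in>pending t. single (fst (c x)) 1) + (\<Sum>i<k. single i (n i - t i))) 1)"
      by (simp only: prod_pending prod_mvar prod_mvar_power sum_distrib_right mult_single mult_1)
    finally have "lookup (?f (r t)) ?N = (\<Sum>c\<in>PiE (pending t) factors.
        lookup (single ((\<Sum>x\<in>pending t. single (fst (c x)) 1) + (\<Sum>i<k. single i (n i - t i))) 1) ?N)"
      by (simp only: lookup_sum)
    also have "\<dots> = (\<Sum>c\<in>PiE (pending t) factors. if valid t c then 1 else 0)"
      by (rule sum.cong[OF refl]) (simp only: lookup_single when_def valid_iff_exponents[OF t])
    finally show ?thesis .
  qed
  have "lookup (sum ?f ?T) ?N = (\<Sum>t\<in>?T. lookup (?f (r t)) ?N)"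
    unfolding lookup_sum by (rule sum.reindex_bij_witness[of _ r r]) (use r in auto)
  also have "\<dots> = int (card leaves)"
    by (simp add: card_leaves coeff if_distrib[of int] cong: if_cong)
  finally show ?thesis by (simp add: atLeast0AtMost)
qed

end

lemma generic_fixed_points_coefficient:
  "for_generic_map k n d (\<lambda>F. has_num_fixed_points k n F
    (lookup (\<Sum>t\<in>(\<Pi>\<^sub>E i\<in>{..<k}. {0..n i}).
       \<Prod>i<k. (\<Sum>j<k. of_nat (d i j) * (mvar j :: (nat, int) mpoly)) ^ (n i - t i) * mvar i ^ t i)
     (\<Sum>i<k. single i (n i))))"
proof -
  interpret multigraded_map k n d .
  show ?thesis using generic_fixed_points unfolding card_leaves_coefficient .
qed

lemma sum_PiE_3:
  "(\<Sum>t\<in>PiE {..<3} A. f (t 0) (t 1) (t 2)) = (\<Sum>i\<in>A 0. \<Sum>j\<in>A 1. \<Sum>l\<in>A (2::nat). f i j l)"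
proof -
  have "{..<3::nat} = insert 0 (insert 1 (insert 2 {}))" by auto
  then show ?thesis by (simp add: sum_PiE_insert)
qed

lemma prod_lessThan_3: "(\<Prod>i<3::nat. f i) = f 0 * f 1 * f 2"
  by (simp add: eval_nat_numeral)

lemma sum_lessThan_3: "(\<Sum>i<3::nat. f i) = f 0 + f 1 + f 2"
  by (simp add: eval_nat_numeral)

theorem theorem9:
  shows
   "(\<forall>(n::nat) (m::nat) (s::nat) (d1::nat) (d2::nat) (d3::nat)
       (e1::nat) (e2::nat) (e3::nat) (f1::nat) (f2::nat) (f3::nat).
      for_generic_map 3 (\<lambda>i. [n, m, s] ! i)
        (\<lambda>i j. [[d1, d2, d3], [e1, e2, e3], [f1, f2, f3]] ! i ! j)
        (\<lambda>F. has_num_fixed_points 3 (\<lambda>i. [n, m, s] ! i) F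
          (let \<alpha> = mvar 0; \<beta> = mvar 1; \<gamma> = mvar 2 :: (nat, int) mpoly in
           Poly_Mapping.lookup
            (\<Sum>i=0..n. \<Sum>j=0..m. \<Sum>k=0..s.
               (of_nat d1 * \<alpha> + of_nat d2 * \<beta> + of_nat d3 * \<gamma>) ^ (n - i) *
               (of_nat e1 * \<alpha> + of_nat e2 * \<beta> + of_nat e3 * \<gamma>) ^ (m - j) *
               (of_nat f1 * \<alpha> + of_nat f2 * \<beta> + of_nat f3 * \<gamma>) ^ (s - k) *
               \<alpha> ^ i * \<beta> ^ j * \<gamma> ^ k)
            (Poly_Mapping.single 0 n + Poly_Mapping.single 1 m + Poly_Mapping.single 2 s))))
    \<and>
    (\<forall>(k::nat) (n :: nat \<Rightarrow> nat) (d :: nat \<Rightarrow> nat \<Rightarrow> nat).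
      1 \<le> k \<longrightarrow>
      for_generic_map k n d
        (\<lambda>F. has_num_fixed_points k n F
          (Poly_Mapping.lookup
            (\<Sum>t\<in>(\<Pi>\<^sub>E i\<in>{..<k}. {0..n i}).
               \<Prod>i<k. (\<Sum>j<k. of_nat (d i j) * (mvar j :: (nat, int) mpoly)) ^ (n i - t i) *
                 mvar i ^ t i)
            (\<Sum>i<k. Poly_Mapping.single i (n i)))))"
proof (intro conjI allI impI)
  fix n m s d1 d2 d3 e1 e2 e3 f1 f2 f3 :: nat
  define \<alpha> \<beta> \<gamma> :: "(nat, int) mpoly" where "\<alpha> = mvar 0" and "\<beta> = mvar 1" and "\<gamma> = mvar 2"
  define dd where "dd = (\<lambda>i j. [[d1, d2, d3], [e1, e2, e3], [f1, f2, f3]] ! i ! j)"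
  define nn where "nn = (\<lambda>i. [n, m, s] ! i)"
  have nth: "nn 0 = n" "nn 1 = m" "nn 2 = s"
    and dd: "dd 0 0 = d1" "dd 0 1 = d2" "dd 0 2 = d3" "dd 1 0 = e1" "dd 1 1 = e2" "dd 1 2 = e3"
      "dd 2 0 = f1" "dd 2 1 = f2" "dd 2 2 = f3"
    by (simp_all add: nn_def dd_def)
  have "(\<Sum>t\<in>(\<Pi>\<^sub>E i\<in>{..<3}. {0..nn i}). \<Prod>i<3. (\<Sum>j<3. of_nat (dd i j) * (mvar j :: (nat, int) mpoly)) ^ (nn i - t i) * mvar i ^ t i) =
      (\<Sum>i=0..n. \<Sum>j=0..m. \<Sum>k=0..s.
        (of_nat d1 * \<alpha> + of_nat d2 * \<beta> + of_nat d3 * \<gamma>) ^ (n - i) * \<alpha> ^ i *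
        ((of_nat e1 * \<alpha> + of_nat e2 * \<beta> + of_nat e3 * \<gamma>) ^ (m - j) * \<beta> ^ j) *
        ((of_nat f1 * \<alpha> + of_nat f2 * \<beta> + of_nat f3 * \<gamma>) ^ (s - k) * \<gamma> ^ k))"
    unfolding prod_lessThan_3 sum_lessThan_3 dd nth \<alpha>_def[symmetric] \<beta>_def[symmetric] \<gamma>_def[symmetric]
    by (rule sum_PiE_3[of _ "\<lambda>i. {0..nn i}", unfolded nth])
  also have "\<dots> = (\<Sum>i=0..n. \<Sum>j=0..m. \<Sum>k=0..s.
        (of_nat d1 * \<alpha> + of_nat d2 * \<beta> + of_nat d3 * \<gamma>) ^ (n - i) *
        (of_nat e1 * \<alpha> + of_nat e2 * \<beta> + of_nat e3 * \<gamma>) ^ (m - j) *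
        (of_nat f1 * \<alpha> + of_nat f2 * \<beta> + of_nat f3 * \<gamma>) ^ (s - k) *
        \<alpha> ^ i * \<beta> ^ j * \<gamma> ^ k)"
    by (intro sum.cong refl) (simp only: mult_ac)
  finally have poly: "(\<Sum>t\<in>(\<Pi>\<^sub>E i\<in>{..<3}. {0..nn i}). \<Prod>i<3. (\<Sum>j<3. of_nat (dd i j) * (mvar j :: (nat, int) mpoly)) ^ (nn i - t i) * mvar i ^ t i) = \<dots>" .
  have mon: "(\<Sum>i<3. single i (nn i)) = single 0 n + single 1 m + single 2 s"
    by (simp only: sum_lessThan_3 nth)
  show "for_generic_map 3 (\<lambda>i. [n, m, s] ! i)
        (\<lambda>i j. [[d1, d2, d3], [e1, e2, e3], [f1, f2, f3]] ! i ! j)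
        (\<lambda>F. has_num_fixed_points 3 (\<lambda>i. [n, m, s] ! i) F
          (let \<alpha> = mvar 0; \<beta> = mvar 1; \<gamma> = mvar 2 :: (nat, int) mpoly in
           Poly_Mapping.lookup
            (\<Sum>i=0..n. \<Sum>j=0..m. \<Sum>k=0..s.
               (of_nat d1 * \<alpha> + of_nat d2 * \<beta> + of_nat d3 * \<gamma>) ^ (n - i) *
               (of_nat e1 * \<alpha> + of_nat e2 * \<beta> + of_nat e3 * \<gamma>) ^ (m - j) *
               (of_nat f1 * \<alpha> + of_nat f2 * \<beta> + of_nat f3 * \<gamma>) ^ (s - k) *
               \<alpha> ^ i * \<beta> ^ j * \<gamma> ^ k)
            (Poly_Mapping.single 0 n + Poly_Mapping.single 1 m + Poly_Mapping.single 2 s)))"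
    using generic_fixed_points_coefficient[of 3 nn dd, unfolded poly mon]
    unfolding Let_def \<alpha>_def \<beta>_def \<gamma>_def nn_def dd_def .
qed (rule generic_fixed_points_coefficient)

end
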